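(* Let $C>1$, $1/2<\beta^\star<1$, $0<T^\star<C$, $\alpha\in(0,1]$, and fix an integer $t\ge1$. For each $K$ put $\delta^\star=\sqrt{2(1/T^\star)\ln K}$, $\varepsilon^\star=K^{-\beta^\star}$, $\mathbf{P}^\star=\mathbf{P}_{\varepsilon^\star,\delta^\star}$, let $(E_s(\mathbf{\Pi}))_{s\ge1}$ be the adaptive test martingale built from the grid $\mathcal{G}_C=\mathcal{G}_C(K)$, and define $\tau^{\mathbf{\Pi}}=\inf\{s\ge1:E_s(\mathbf{\Pi})\ge1/\alpha\}$. Let $t^\star=T^\star\rho(\beta^\star)$. Then, as $K\to\infty$, $$\mathbf{P}^\star\{\tau^{\mathbf{\Pi}}\le t\}\to\begin{cases}0&\text{if } t<t^\star,\\1&\text{if } t>t^\star.\end{cases}$$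
   Context: Model: for $K\in\mathbf{N}$, $\varepsilon\in[0,1]$, $\delta>0$, $\mathbf{P}_{\varepsilon,\delta}$ is the law of an array $(X_{i,s})_{1\le i\le K,\,s\ge1}$ generated as follows: $A_1,\dots,A_K$ are i.i.d. Bernoulli$(\varepsilon)$ (latent), and conditionally on $(A_i)$ the $X_{i,s}$ are independent with $X_{i,s}\sim\mathrm{Normal}(\delta A_i,1)$. Likelihood ratio: $E_s(\varepsilon,\delta)=\prod_{i=1}^K\left\{(1-\varepsilon)+\varepsilon\frac{p_\delta(X_{i,1},\dots,X_{i,s})}{p_0(X_{i,1},\dots,X_{i,s})}\right\}$ with $p_\delta(x_1,\dots,x_s)=\prod_{u\le s}\frac{1}{\sqrt{2\pi}}e^{-(x_u-\delta)^2/2}$. Grid (depending on $K$ and $C$): $$\mathcal{G}_\varepsilon=\left\{K^{-\beta_i}:\beta_i=\tfrac12+\tfrac{i}{2\lceil\ln^2K\rceil},\ i=1,\dots,\lceil\ln^2K\rceil\right\},$$ $$\mathcal{G}_{\delta,C}(\varepsilon)=\left\{\sqrt{\frac{2\ln K}{\exp(i/\lceil\varepsilon K\rceil)}}:\ i=1,\dots,\lceil\varepsilon K\rceil\lceil\ln C\rceil\right\},$$ $$\mathcal{G}_C=\bigcup_{\varepsilon'\in\mathcal{G}_\varepsilon}\{(\varepsilon',\delta'):\delta'\in\mathcal{G}_{\delta,C}(\varepsilon')\}.$$ Adaptive test martingale: with $\mathbf{\Pi}=\mathrm{Uniform}(\mathcal{G}_C)$, $$E_s(\mathbf{\Pi})=\frac{1}{|\mathcal{G}_C|}\sum_{(\varepsilon,\delta)\in\mathcal{G}_C}E_s(\varepsilon,\delta).$$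 Detection boundary: $\rho(\beta)=\beta-\frac12$ for $\beta\in(1/2,3/4)$ and $\rho(\beta)=(1-\sqrt{1-\beta})^2$ for $\beta\in[3/4,1]$. *)

theory Defs
  imports "HOL-Probability.Probability"
begin

text \<open>
  The law of the array \<open>X\<close> (entries indexed by pairs \<open>(i, s)\<close>, \<open>1 \<le> i \<le> K\<close>, \<open>s \<ge> 1\<close>): draw the
  latent i.i.d. Bernoulli labels \<open>A\<close>, then, given \<open>A\<close>, independent entries
  \<open>X (i, s) \<sim> Normal(\<delta> A\<^sub>i, 1)\<close>; the monadic bind integrates out \<open>A\<close>.
\<close>

definition array_given_labels :: "nat \<Rightarrow> real \<Rightarrow> (nat \<Rightarrow> bool) \<Rightarrow> (nat \<times> nat \<Rightarrow> real) measure" where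
  "array_given_labels K \<delta> A =
     (\<Pi>\<^sub>M (i, s)\<in>{1..K} \<times> {1..}. density lborel (normal_density (\<delta> * of_bool (A i)) 1))"

definition array_law :: "nat \<Rightarrow> real \<Rightarrow> real \<Rightarrow> (nat \<times> nat \<Rightarrow> real) measure" where
  "array_law K \<epsilon> \<delta> =
     measure_pmf (Pi_pmf {1..K} False (\<lambda>_. bernoulli_pmf \<epsilon>)) \<bind> array_given_labels K \<delta>"

definition stream_density :: "real \<Rightarrow> nat \<Rightarrow> (nat \<Rightarrow> real) \<Rightarrow> real" where
  "stream_density \<delta> s x = (\<Prod>u=1..s. normal_density \<delta> 1 (x u))"

definition likelihood_ratio :: "nat \<Rightarrow> nat \<Rightarrow> real \<Rightarrow> real \<Rightarrow> (nat \<times> nat \<Rightarrow> real) \<Rightarrow> real" where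
  "likelihood_ratio K s \<epsilon> \<delta> x =
     (\<Prod>i=1..K. ((1 - \<epsilon>) +
        \<epsilon> * (stream_density \<delta> s (\<lambda>u. x (i, u)) / stream_density 0 s (\<lambda>u. x (i, u)))))"

definition grid_beta :: "nat \<Rightarrow> int \<Rightarrow> real" where
  "grid_beta K i = 1 / 2 + real_of_int i / (2 * real_of_int \<lceil>(ln (real K))\<^sup>2\<rceil>)"

definition grid_eps :: "nat \<Rightarrow> real set" where
  "grid_eps K = (\<lambda>i. real K powr (- grid_beta K i)) ` {1..\<lceil>(ln (real K))\<^sup>2\<rceil>}"

definition grid_delta :: "nat \<Rightarrow> real \<Rightarrow> real \<Rightarrow> real set" where
  "grid_delta K C \<epsilon> =
     (\<lambda>i. sqrt (2 * ln (real K) / exp (real_of_int i / real_of_int \<lceil>\<epsilon> * real K\<rceil>)))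
       ` {1..\<lceil>\<epsilon> * real K\<rceil> * \<lceil>ln C\<rceil>}"

definition grid :: "nat \<Rightarrow> real \<Rightarrow> (real \<times> real) set" where
  "grid K C = (\<Union>\<epsilon>\<in>grid_eps K. {(\<epsilon>, \<delta>) | \<delta>. \<delta> \<in> grid_delta K C \<epsilon>})"

definition adaptive_martingale :: "nat \<Rightarrow> real \<Rightarrow> nat \<Rightarrow> (nat \<times> nat \<Rightarrow> real) \<Rightarrow> real" where
  "adaptive_martingale K C s x =
     1 / real (card (grid K C)) * (\<Sum>(\<epsilon>, \<delta>)\<in>grid K C. likelihood_ratio K s \<epsilon> \<delta> x)"

text \<open>Values in \<^typ>\<open>enat\<close>, so that the infimum of the empty set is \<open>\<infinity>\<close>.\<close>

definition rejection_time :: "nat \<Rightarrow> real \<Rightarrow> real \<Rightarrow> (nat \<times> nat \<Rightarrow> real) \<Rightarrow> enat" where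
  "rejection_time K C \<alpha> x = Inf {enat s | s. 1 \<le> s \<and> adaptive_martingale K C s x \<ge> 1 / \<alpha>}"

text \<open>The detection boundary; only the values for \<open>1 / 2 < \<beta> \<le> 1\<close> are meaningful.\<close>

definition detection_boundary :: "real \<Rightarrow> real" where
  "detection_boundary \<beta> = (if \<beta> < 3 / 4 then \<beta> - 1 / 2 else (1 - sqrt (1 - \<beta>))\<^sup>2)"

end

theory Submission
  imports Defs "HOL-Real_Asymp.Real_Asymp"
begin

text \<open>
  Restricted to the data up to time \<open>t\<close>, the law of the array has density \<open>likelihood_ratio\<close> with
  respect to independent standard normals (the null law), and expectations of products over the
  streams factorize.

  Above the boundary, a single grid point slightly less favourable than the truth (larger \<open>\<beta>\<close>,
  larger \<open>T\<close>) is enough. By stochastic monotonicity its likelihood ratio \<open>E\<close> can be studied under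
  its own law, where \<open>P(E < M) \<le> sqrt M * h ^ K\<close> with \<open>h\<close> the Hellinger affinity of one stream
  with the null; \<open>K * (1 - h)\<close> grows like a power of \<open>K\<close>, while the size of the grid is polynomial.

  Below the boundary, the second moment of the likelihood ratio, truncated where the standardized
  sum of a stream exceeds \<open>sqrt (2 * ln K)\<close>, stays bounded, so events of vanishing null probability have vanishing
  probability under the alternative. Under the null the martingale tends to \<open>0\<close> because almost
  all grid points have \<open>\<beta>\<close> so close to \<open>1 / 2\<close> that the sum of all observations detects them.
\<close>

section \<open>The law of the data up to a fixed time\<close>

text \<open>The universal bound for a test martingale, that the null probability of ever reaching 1
  / \<alpha> is at most \<alpha>, is too weak here: \<alpha> is fixed and may be 1. Below the
  boundary a vanishing null probability is required, and it comes from the shape of the grid: a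
  sparsity e carries a number of signals proportional to e * K, so the weight of the sparsity K^(-b)
  is about K^(1 - b) and decays geometrically away from b = 1 / 2. In exchange the second moment
  need only be bounded, not tend to 1: events negligible under the null stay negligible under the
  alternative (contiguity), without closeness in total variation. Above the boundary, Markov's
  inequality is applied to the power 1 / 2 of M / E because 1 / sqrt E integrated against the
  density E is sqrt E integrated under the null. The true parameter is in general no grid point, so
  two laws must be compared; since E is increasing in every observation when its signal is
  nonnegative, rounding towards the weaker alternative keeps the comparison one-sided.\<close>

declare One_nat_def [simp del]

definition gauss :: "real \<Rightarrow> real measure" where
  "gauss m = density lborel (normal_density m 1)"

text \<open>The null law of the entries indexed by J, where J is one stream \<open>{1..t}\<close> or
  the finite array \<open>{1..K} \<times> {1..t}\<close>; fixing t keeps the integrals on finite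
  products.\<close>

definition noise :: "'i set \<Rightarrow> ('i \<Rightarrow> real) measure" where
  "noise J = (\<Pi>\<^sub>M j\<in>J. gauss 0)"

lemma sets_gauss [measurable_cong, simp]: "sets (gauss m) = sets borel"
  by (simp add: gauss_def)

lemma space_gauss [simp]: "space (gauss m) = UNIV"
  by (simp add: gauss_def)

lemma prob_space_gauss: "prob_space (gauss m)"
  unfolding gauss_def by (rule prob_space_normal_density) simp

lemma sets_noise [measurable_cong]: "sets (noise J) = sets (\<Pi>\<^sub>M j\<in>J. borel)"
  unfolding noise_def by (intro sets_PiM_cong) auto

lemma space_noise [simp]: "space (noise J) = J \<rightarrow>\<^sub>E UNIV"
  unfolding noise_def by (simp add: space_PiM)

lemma product_prob_space_gauss: "product_prob_space (\<lambda>j. gauss (m j))"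
  by (intro product_prob_spaceI prob_space_gauss)

lemma product_sigma_finite_gauss: "product_sigma_finite (\<lambda>j. gauss (m j))"
  using product_prob_space_gauss[of m] by (simp add: product_prob_space_def)

lemma prob_space_noise: "prob_space (noise J)"
  unfolding noise_def by (intro prob_space_PiM prob_space_gauss)

text \<open>Both sides agree on boxes: the indicator of a box splits into one factor per coordinate,
  so the integral of the product is a product of integrals. Sigma-finiteness of the factors with
  density lets boxes determine the measure.\<close>

lemma PiM_density:
  fixes f :: "'i \<Rightarrow> 'a \<Rightarrow> ennreal"
  assumes I: "finite I" and M: "product_sigma_finite M"
    and D: "product_sigma_finite (\<lambda>i. density (M i) (f i))"
    and f [measurable]: "\<And>i. i \<in> I \<Longrightarrow> f i \<in> borel_measurable (M i)"
  shows "(\<Pi>\<^sub>M i\<in>I. density (M i) (f i)) = density (PiM I M) (\<lambda>x. \<Prod>i\<in>I. f i (x i))"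
proof -
  interpret D: product_sigma_finite "\<lambda>i. density (M i) (f i)" by fact
  interpret M: product_sigma_finite M by fact
  show ?thesis
  proof (rule D.PiM_eqI[symmetric])
    show "finite I" by fact
    show "sets (density (PiM I M) (\<lambda>x. \<Prod>i\<in>I. f i (x i))) = sets (\<Pi>\<^sub>M i\<in>I. density (M i) (f i))"
      by (auto intro!: sets_PiM_cong)
    fix A assume A: "\<And>i. i \<in> I \<Longrightarrow> A i \<in> sets (density (M i) (f i))"
    have A' [measurable]: "\<And>i. i \<in> I \<Longrightarrow> A i \<in> sets (M i)" using A by simp
    have box: "PiE I A \<in> sets (PiM I M)" using I A' by (auto intro!: sets_PiM_I_finite)
    have "emeasure (density (PiM I M) (\<lambda>x. \<Prod>i\<in>I. f i (x i))) (PiE I A)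
        = (\<integral>\<^sup>+x. (\<Prod>i\<in>I. f i (x i)) * indicator (PiE I A) x \<partial>PiM I M)"
      using I box by (intro emeasure_density) measurable
    also have "\<dots> = (\<integral>\<^sup>+x. (\<Prod>i\<in>I. f i (x i) * indicator (A i) (x i)) \<partial>PiM I M)"
    proof (intro nn_integral_cong)
      fix x assume "x \<in> space (PiM I M)"
      then have "x \<in> extensional I" by (auto simp: space_PiM PiE_def)
      then have "indicator (PiE I A) x = (\<Prod>i\<in>I. indicator (A i) (x i) :: ennreal)"
        using I by (auto simp: indicator_def PiE_def Pi_def prod_zero_iff)
      then show "(\<Prod>i\<in>I. f i (x i)) * indicator (PiE I A) x = (\<Prod>i\<in>I. f i (x i) * indicator (A i) (x i))"
        by (simp add: prod.distrib)
    qed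
    also have "\<dots> = (\<Prod>i\<in>I. \<integral>\<^sup>+x. f i x * indicator (A i) x \<partial>M i)"
      by (intro M.product_nn_integral_prod I) measurable
    also have "\<dots> = (\<Prod>i\<in>I. emeasure (density (M i) (f i)) (A i))"
      by (intro prod.cong refl emeasure_density[symmetric]) auto
    finally show "emeasure (density (PiM I M) (\<lambda>x. \<Prod>i\<in>I. f i (x i))) (PiE I A)
        = (\<Prod>i\<in>I. emeasure (density (M i) (f i)) (A i))" .
  qed
qed

lemma normal_density_shift_ratio:
  "normal_density m 1 x / normal_density 0 1 x = exp (m * x - m\<^sup>2 / 2)"
proof -
  have "exp (- (x - m)\<^sup>2 / 2) / exp (- x\<^sup>2 / 2) = exp (m * x - m\<^sup>2 / 2)"
    by (simp add: exp_diff[symmetric] power2_eq_square field_simps)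
  then show ?thesis by (simp add: normal_density_def)
qed

lemma gauss_eq_density: "gauss m = density (gauss 0) (\<lambda>x. ennreal (exp (m * x - m\<^sup>2 / 2)))"
proof -
  have "normal_density m 1 x = normal_density 0 1 x * exp (m * x - m\<^sup>2 / 2)" for x
    using normal_density_pos[of 1 0 x] unfolding normal_density_shift_ratio[symmetric] by simp
  then show ?thesis
    unfolding gauss_def by (subst density_density_eq) (auto simp: ennreal_mult')
qed

lemma gauss_eq_distr: "gauss m = distr (gauss 0) borel (\<lambda>x. x + m)"
proof (rule measure_eqI)
  fix A assume "A \<in> sets (gauss m)"
  then have [measurable]: "A \<in> sets borel" by simp
  have "emeasure (gauss m) A = (\<integral>\<^sup>+x. ennreal (normal_density m 1 x) * indicator A x \<partial>lborel)"
    unfolding gauss_def by (intro emeasure_density) auto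
  also have "\<dots> = (\<integral>\<^sup>+x. ennreal (normal_density 0 1 x) * indicator A (x + m) \<partial>lborel)"
    by (subst nn_integral_real_affine[where c=1 and t=m])
      (auto simp: normal_density_def add.commute)
  also have "\<dots> = (\<integral>\<^sup>+x. indicator A (x + m) \<partial>gauss 0)"
    unfolding gauss_def by (subst nn_integral_density) auto
  also have "\<dots> = emeasure (distr (gauss 0) borel (\<lambda>x. x + m)) A"
    by (subst nn_integral_indicator[symmetric], simp, subst nn_integral_distr) auto
  finally show "emeasure (gauss m) A = emeasure (distr (gauss 0) borel (\<lambda>x. x + m)) A" .
qed simp

text \<open>No integral is computed: the tilted density of \<open>gauss l\<close> has total mass 1,
  and moving its constant factor to the other side leaves the moment generating function.\<close>

lemma nn_integral_gauss_exp: "(\<integral>\<^sup>+x. ennreal (exp (l * x)) \<partial>gauss 0) = ennreal (exp (l\<^sup>2 / 2))"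
proof -
  have "1 = emeasure (gauss l) (space (gauss l))"
    using prob_space.emeasure_space_1[OF prob_space_gauss[of l]] by simp
  also have "\<dots> = (\<integral>\<^sup>+x. ennreal (exp (l * x - l\<^sup>2 / 2)) * indicator UNIV x \<partial>gauss 0)"
    by (subst gauss_eq_density, subst emeasure_density) auto
  also have "\<dots> = (\<integral>\<^sup>+x. ennreal (exp (l * x)) * ennreal (exp (- (l\<^sup>2 / 2))) \<partial>gauss 0)"
    by (intro nn_integral_cong) (simp add: ennreal_mult'[symmetric] exp_add[symmetric])
  also have "\<dots> = (\<integral>\<^sup>+x. ennreal (exp (l * x)) \<partial>gauss 0) * ennreal (exp (- (l\<^sup>2 / 2)))"
    by (intro nn_integral_multc) auto
  finally have "ennreal (exp (l\<^sup>2 / 2)) = (\<integral>\<^sup>+x. ennreal (exp (l * x)) \<partial>gauss 0)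
      * (ennreal (exp (- (l\<^sup>2 / 2))) * ennreal (exp (l\<^sup>2 / 2)))"
    by (metis mult.assoc mult.left_neutral)
  also have "ennreal (exp (- (l\<^sup>2 / 2))) * ennreal (exp (l\<^sup>2 / 2)) = 1"
    by (simp add: ennreal_mult'[symmetric] exp_add[symmetric])
  finally show ?thesis by simp
qed

text \<open>Likelihood ratio of s observations from Normal(d, 1) against Normal(0, 1). It sees the
  stream only through its sum, so truncations and tail bounds are formulated for that sum.\<close>

definition lr :: "real \<Rightarrow> nat \<Rightarrow> (nat \<Rightarrow> real) \<Rightarrow> real" where
  "lr d s y = exp (d * (\<Sum>u=1..s. y u) - real s * d\<^sup>2 / 2)"

lemma lr_pos [simp]: "lr d s y > 0" by (simp add: lr_def)

lemma lr_nonneg [simp]: "lr d s y \<ge> 0" by (simp add: lr_def)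

lemma lr_eq_prod: "lr d s y = (\<Prod>u=1..s. exp (d * y u - d\<^sup>2 / 2))"
  by (simp add: lr_def exp_sum[symmetric] sum_subtractf sum_distrib_left)

lemma stream_density_ratio: "stream_density d s y / stream_density 0 s y = lr d s y"
  by (simp add: stream_density_def prod_dividef[symmetric] normal_density_shift_ratio lr_eq_prod)

lemma likelihood_ratio_eq:
  "likelihood_ratio K s e d x = (\<Prod>i=1..K. 1 - e + e * lr d s (\<lambda>u. x (i, u)))"
  by (simp add: likelihood_ratio_def stream_density_ratio)

lemma borel_measurable_lr:
  assumes "s \<le> t" shows "lr d s \<in> borel_measurable (\<Pi>\<^sub>M u\<in>{1..t}. borel)"
  unfolding lr_def by measurable (use assms in auto)

lemma noise_mgf:
  assumes "s \<le> t"
  shows "(\<integral>\<^sup>+y. ennreal (exp (l * (\<Sum>u=1..s. y u))) \<partial>noise {1..t}) = ennreal (exp (real s * l\<^sup>2 / 2))"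
proof -
  interpret product_sigma_finite "\<lambda>j. gauss 0" by (rule product_sigma_finite_gauss)
  \<comment> \<open>Padding with factors 1 beyond s lets the product run over all t coordinates, so
    that every time s \<le> t lives on the same space.\<close>
  have split: "(\<Prod>u=1..t. if u \<le> s then h u else 1) = (\<Prod>u=1..s. h u)" for h :: "nat \<Rightarrow> ennreal"
    using assms by (intro prod.mono_neutral_cong_right) auto
  have "(\<integral>\<^sup>+y. ennreal (exp (l * (\<Sum>u=1..s. y u))) \<partial>noise {1..t})
      = (\<integral>\<^sup>+y. (\<Prod>u=1..t. if u \<le> s then ennreal (exp (l * y u)) else 1) \<partial>noise {1..t})"
    by (intro nn_integral_cong)
      (simp only: split, simp add: sum_distrib_left exp_sum prod_ennreal)
  also have "\<dots> = (\<Prod>u=1..t. \<integral>\<^sup>+y. (if u \<le> s then ennreal (exp (l * y)) else 1) \<partial>gauss 0)"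
    unfolding noise_def by (intro product_nn_integral_prod) auto
  also have "\<dots> = (\<Prod>u=1..t. if u \<le> s then ennreal (exp (l\<^sup>2 / 2)) else 1)"
    using prob_space.emeasure_space_1[OF prob_space_gauss[of 0]]
    by (intro prod.cong) (auto simp: nn_integral_gauss_exp)
  also have "\<dots> = ennreal (exp (real s * l\<^sup>2 / 2))"
    by (simp only: split) (simp add: ennreal_power exp_of_nat_mult[symmetric])
  finally show ?thesis .
qed

lemma borel_measurable_likelihood_ratio:
  assumes "s \<le> t"
  shows "likelihood_ratio K s e d \<in> borel_measurable (\<Pi>\<^sub>M j\<in>{1..K} \<times> {1..t}. borel)"
  unfolding likelihood_ratio_eq lr_def by measurable (use assms in auto)

text \<open>Cameron-Martin for one stream: the product of the \<open>gauss m\<close> is written once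
  as a tilt of the noise and once as its translate. In the translated form monotonicity in the mean
  is visible pointwise.\<close>

lemma nn_integral_shift:
  assumes [measurable]: "h \<in> borel_measurable (\<Pi>\<^sub>M u\<in>{1..t}. borel)"
  shows "(\<integral>\<^sup>+y. ennreal (lr m t y) * h y \<partial>noise {1..t})
    = (\<integral>\<^sup>+y. h (\<lambda>u\<in>{1..t}. y u + m) \<partial>noise {1..t})"
proof -
  have [measurable]: "lr m t \<in> borel_measurable (noise {1..t})"
    using borel_measurable_lr[of t t m] by (simp cong: measurable_cong_sets add: sets_noise)
  have eq: "(\<Pi>\<^sub>M u\<in>{1..t}. gauss m) = density (noise {1..t}) (lr m t)"
    unfolding lr_eq_prod
    using PiM_density[of "{1..t}" "\<lambda>_. gauss 0" "\<lambda>_ x. ennreal (exp (m * x - m\<^sup>2 / 2))"]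
      product_sigma_finite_gauss[of "\<lambda>_. 0"] product_sigma_finite_gauss[of "\<lambda>_. m"]
    by (simp add: gauss_eq_density[symmetric] noise_def prod_ennreal)
  have eq2: "(\<Pi>\<^sub>M u\<in>{1..t}. gauss m) = distr (noise {1..t}) (\<Pi>\<^sub>M u\<in>{1..t}. borel) (\<lambda>y. \<lambda>u\<in>{1..t}. y u + m)"
  proof -
    have "(\<Pi>\<^sub>M u\<in>{1..t}. gauss m) = (\<Pi>\<^sub>M u\<in>{1..t}. distr (gauss 0) (gauss 0) (\<lambda>x. x + m))"
      by (subst gauss_eq_distr) (simp cong: distr_cong)
    also have "\<dots> = distr (noise {1..t}) (noise {1..t}) (compose {1..t} (\<lambda>x. x + m))"
      unfolding noise_def
      by (intro distr_PiM_finite_prob_space[symmetric] product_prob_space_gauss) auto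
    also have "\<dots> = distr (noise {1..t}) (\<Pi>\<^sub>M u\<in>{1..t}. borel) (\<lambda>y. \<lambda>u\<in>{1..t}. y u + m)"
      by (intro distr_cong) (auto simp: sets_noise compose_def)
    finally show ?thesis .
  qed
  have "(\<integral>\<^sup>+y. ennreal (lr m t y) * h y \<partial>noise {1..t}) = (\<integral>\<^sup>+y. h y \<partial>density (noise {1..t}) (lr m t))"
    by (subst nn_integral_density) (auto simp: measurable_cong_sets[OF sets_noise refl])
  also have "\<dots> = (\<integral>\<^sup>+y. h y \<partial>distr (noise {1..t}) (\<Pi>\<^sub>M u\<in>{1..t}. borel) (\<lambda>y. \<lambda>u\<in>{1..t}. y u + m))"
    using eq eq2 by simp
  also have "\<dots> = (\<integral>\<^sup>+y. h (\<lambda>u\<in>{1..t}. y u + m) \<partial>noise {1..t})"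
    by (subst nn_integral_distr) auto
  finally show ?thesis .
qed

section \<open>The array as a family of independent streams\<close>

lemma measurable_uncurry:
  "(\<lambda>y. \<lambda>(i, u)\<in>I \<times> U. y i u) \<in> measurable (\<Pi>\<^sub>M i\<in>I. noise U) (noise (I \<times> U))"
  unfolding noise_def
proof (rule measurable_restrict, clarify)
  fix i u assume "i \<in> I" "u \<in> U"
  then show "(\<lambda>y. y i u) \<in> measurable (\<Pi>\<^sub>M i\<in>I. \<Pi>\<^sub>M u\<in>U. gauss 0) (gauss 0)"
    using measurable_compose[where f="\<lambda>y. y i" and g="\<lambda>z. z u"]
      measurable_component_singleton[of i I "\<lambda>i. \<Pi>\<^sub>M u\<in>U. gauss 0"]
      measurable_component_singleton[of u U "\<lambda>u. gauss 0"] by blast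
qed

text \<open>Under uncurrying, the preimage of a box over pairs is a box of boxes, so both measures
  give it the same iterated product.\<close>

lemma noise_times_eq_distr:
  assumes I: "finite I" and U: "finite U"
  shows "noise (I \<times> U) = distr (\<Pi>\<^sub>M i\<in>I. noise U) (noise (I \<times> U)) (\<lambda>y. \<lambda>(i, u)\<in>I \<times> U. y i u)"
proof -
  interpret product_sigma_finite "\<lambda>j. gauss 0" by (rule product_sigma_finite_gauss)
  interpret N: product_prob_space "\<lambda>i. noise U" by (intro product_prob_spaceI prob_space_noise)
  have [measurable]: "(\<lambda>y. \<lambda>(i, u)\<in>I \<times> U. y i u) \<in> measurable (\<Pi>\<^sub>M i\<in>I. noise U) (noise (I \<times> U))"
    by (rule measurable_uncurry)
  have "distr (\<Pi>\<^sub>M i\<in>I. noise U) (noise (I \<times> U)) (\<lambda>y. \<lambda>(i, u)\<in>I \<times> U. y i u) = PiM (I \<times> U) (\<lambda>j. gauss 0)"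
  proof (rule PiM_eqI)
    show "finite (I \<times> U)" using I U by simp
    show "sets (distr (\<Pi>\<^sub>M i\<in>I. noise U) (noise (I \<times> U)) (\<lambda>y. \<lambda>(i, u)\<in>I \<times> U. y i u)) = sets (Pi\<^sub>M (I \<times> U) (\<lambda>j. gauss 0))"
      by (simp add: noise_def)
    fix A :: "_ \<Rightarrow> real set" assume A: "\<And>j. j \<in> I \<times> U \<Longrightarrow> A j \<in> sets (gauss 0)"
    have pre: "(\<lambda>y. \<lambda>(i, u)\<in>I \<times> U. y i u) -` PiE (I \<times> U) A \<inter> space (\<Pi>\<^sub>M i\<in>I. noise U)
        = (\<Pi>\<^sub>E i\<in>I. \<Pi>\<^sub>E u\<in>U. A (i, u))"
      by (auto simp: space_PiM PiE_def Pi_def extensional_def)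
    have "emeasure (distr (\<Pi>\<^sub>M i\<in>I. noise U) (noise (I \<times> U)) (\<lambda>y. \<lambda>(i, u)\<in>I \<times> U. y i u)) (PiE (I \<times> U) A)
        = emeasure (\<Pi>\<^sub>M i\<in>I. noise U) (\<Pi>\<^sub>E i\<in>I. \<Pi>\<^sub>E u\<in>U. A (i, u))"
    proof (subst emeasure_distr[OF measurable_uncurry])
      show "PiE (I \<times> U) A \<in> sets (noise (I \<times> U))"
        unfolding noise_def using A I U by (intro sets_PiM_I_finite) auto
    qed (simp only: pre)
    also have "\<dots> = (\<Prod>i\<in>I. emeasure (noise U) (\<Pi>\<^sub>E u\<in>U. A (i, u)))"
      using A I U by (intro N.emeasure_PiM) (auto simp: noise_def intro!: sets_PiM_I_finite)
    also have "\<dots> = (\<Prod>i\<in>I. \<Prod>u\<in>U. emeasure (gauss 0) (A (i, u)))"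
      unfolding noise_def using A U by (intro prod.cong refl emeasure_PiM) auto
    also have "\<dots> = (\<Prod>j\<in>I \<times> U. emeasure (gauss 0) (A j))"
      by (subst prod.cartesian_product) (simp add: case_prod_eta)
    finally show "emeasure (distr (\<Pi>\<^sub>M i\<in>I. noise U) (noise (I \<times> U)) (\<lambda>y. \<lambda>(i, u)\<in>I \<times> U. y i u)) (PiE (I \<times> U) A)
        = (\<Prod>j\<in>I \<times> U. emeasure (gauss 0) (A j))" .
  qed
  then show ?thesis by (simp add: noise_def)
qed

text \<open>Independence of the streams. The second assumption says that \<open>g\<close> looks only
  at the first t entries, so it may be applied to a row of the array regardless of the values
  outside the index set.\<close>

lemma nn_integral_noise_prod:
  fixes t :: nat
  assumes [measurable]: "g \<in> borel_measurable (\<Pi>\<^sub>M u\<in>{1..t}. borel)"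
    and g: "\<And>y. g (restrict y {1..t}) = g y"
  shows "(\<integral>\<^sup>+x. (\<Prod>i=1..K. g (\<lambda>u. x (i, u))) \<partial>noise ({1..K} \<times> {1..t})) = (\<integral>\<^sup>+y. g y \<partial>noise {1..t}) ^ K"
proof -
  interpret N: product_prob_space "\<lambda>i. noise {1..t}" by (intro product_prob_spaceI prob_space_noise)
  let ?F = "\<lambda>y. \<lambda>(i, u)\<in>{1..K} \<times> {1..t}. y i u :: real"
  have m1: "?F \<in> measurable (\<Pi>\<^sub>M i\<in>{1..K}. noise {1..t}) (noise ({1..K} \<times> {1..t}))"
    by (rule measurable_uncurry)
  have eq: "(\<lambda>x. \<Prod>i=1..K. g (\<lambda>u. x (i, u))) = (\<lambda>x. \<Prod>i=1..K. g (\<lambda>u\<in>{1..t}. x (i, u)))"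
    by (subst g[symmetric]) simp
  have m2: "(\<lambda>x. \<Prod>i=1..K. g (\<lambda>u. x (i, u))) \<in> borel_measurable (noise ({1..K} \<times> {1..t}))"
    unfolding eq by measurable
  have "(\<integral>\<^sup>+x. (\<Prod>i=1..K. g (\<lambda>u. x (i, u))) \<partial>noise ({1..K} \<times> {1..t}))
      = (\<integral>\<^sup>+y. (\<Prod>i=1..K. g (\<lambda>u. ?F y (i, u))) \<partial>(\<Pi>\<^sub>M i\<in>{1..K}. noise {1..t}))"
    using nn_integral_distr[OF m1, of "\<lambda>x. \<Prod>i=1..K. g (\<lambda>u. x (i, u))"] m2
      noise_times_eq_distr[of "{1..K}" "{1..t}"] by simp
  also have "\<dots> = (\<integral>\<^sup>+y. (\<Prod>i=1..K. g (y i)) \<partial>(\<Pi>\<^sub>M i\<in>{1..K}. noise {1..t}))"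
  proof (intro nn_integral_cong prod.cong refl)
    fix y :: "nat \<Rightarrow> nat \<Rightarrow> real" and i assume i: "i \<in> {1..K}"
    have "restrict (\<lambda>u. ?F y (i, u)) {1..t} = restrict (y i) {1..t}"
      using i by (auto simp: restrict_def fun_eq_iff)
    then show "g (\<lambda>u. ?F y (i, u)) = g (y i)" by (metis g)
  qed
  also have "\<dots> = (\<Prod>i=1..K. \<integral>\<^sup>+y. g y \<partial>noise {1..t})"
    by (intro N.product_nn_integral_prod) auto
  finally show ?thesis by simp
qed

section \<open>The density of the array law up to time t\<close>

lemma nn_integral_array_given_labels:
  assumes [measurable]: "g \<in> borel_measurable (\<Pi>\<^sub>M j\<in>{1..K} \<times> {1..t}. borel)"
  shows "(\<integral>\<^sup>+x. g (restrict x ({1..K} \<times> {1..t})) \<partial>array_given_labels K d A)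
    = (\<integral>\<^sup>+x. (\<Prod>i=1..K. ennreal (if A i then lr d t (\<lambda>u. x (i, u)) else 1)) * g x
        \<partial>noise ({1..K} \<times> {1..t}))"
proof -
  let ?J = "{1..K} \<times> {1..t}" and ?I = "{1..K} \<times> {1..}"
  define m where "m j = d * of_bool (A (fst j))" for j :: "nat \<times> nat"
  interpret product_prob_space "\<lambda>j. gauss (m j)" ?I by (rule product_prob_space_gauss)
  have law: "array_given_labels K d A = PiM ?I (\<lambda>j. gauss (m j))"
    by (auto simp: array_given_labels_def gauss_def m_def intro!: PiM_cong)
  have gm: "g \<in> borel_measurable (PiM ?J (\<lambda>j. gauss (m j)))"
    using assms by (subst measurable_cong_sets[OF sets_PiM_cong[OF refl sets_gauss] refl]) auto
  have [measurable]: "(\<lambda>x. restrict x ?J) \<in> measurable (PiM ?I (\<lambda>j. gauss (m j))) (PiM ?J (\<lambda>j. gauss (m j)))"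
    by (rule measurable_restrict_subset) auto
  have dens: "PiM ?J (\<lambda>j. gauss (m j))
      = density (noise ?J) (\<lambda>x. \<Prod>j\<in>?J. ennreal (exp (m j * x j - (m j)\<^sup>2 / 2)))"
    using PiM_density[of ?J "\<lambda>_. gauss 0" "\<lambda>j x. ennreal (exp (m j * x - (m j)\<^sup>2 / 2))"]
      product_sigma_finite_gauss[of "\<lambda>_. 0"] product_sigma_finite_gauss[of m]
    by (simp add: gauss_eq_density[symmetric] noise_def)
  have prod: "(\<Prod>j\<in>?J. ennreal (exp (m j * x j - (m j)\<^sup>2 / 2)))
      = (\<Prod>i=1..K. ennreal (if A i then lr d t (\<lambda>u. x (i, u)) else 1))" for x
  proof -
    have "(\<Prod>j\<in>?J. ennreal (exp (m j * x j - (m j)\<^sup>2 / 2)))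
        = (\<Prod>i=1..K. \<Prod>u=1..t. ennreal (exp (m (i, u) * x (i, u) - (m (i, u))\<^sup>2 / 2)))"
      by (subst prod.cartesian_product) (simp add: case_prod_beta)
    also have "\<dots> = (\<Prod>i=1..K. ennreal (if A i then lr d t (\<lambda>u. x (i, u)) else 1))"
      by (intro prod.cong refl) (auto simp: m_def lr_eq_prod prod_ennreal)
    finally show ?thesis .
  qed
  have "(\<integral>\<^sup>+x. g (restrict x ?J) \<partial>array_given_labels K d A)
      = (\<integral>\<^sup>+x. g x \<partial>distr (PiM ?I (\<lambda>j. gauss (m j))) (PiM ?J (\<lambda>j. gauss (m j))) (\<lambda>x. restrict x ?J))"
    unfolding law using gm by (subst nn_integral_distr) auto
  \<comment> \<open>The projection of the infinite product to the finitely many coordinates up to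
    time t is a finite product, and that one has a density.\<close>
  also have "\<dots> = (\<integral>\<^sup>+x. g x \<partial>PiM ?J (\<lambda>j. gauss (m j)))"
    by (subst distr_PiM_restrict_finite) auto
  also have "\<dots> = (\<integral>\<^sup>+x. (\<Prod>j\<in>?J. ennreal (exp (m j * x j - (m j)\<^sup>2 / 2))) * g x \<partial>noise ?J)"
    unfolding dens
    by (subst nn_integral_density) (auto simp: measurable_cong_sets[OF sets_noise refl])
  finally show ?thesis unfolding prod .
qed

lemma sets_array_given_labels:
  "sets (array_given_labels K d A) = sets (\<Pi>\<^sub>M j\<in>{1..K} \<times> {1..}. borel)"
  unfolding array_given_labels_def by (intro sets_PiM_cong) auto

lemma prob_space_array_given_labels: "prob_space (array_given_labels K d A)"
  unfolding array_given_labels_def by (intro prob_space_PiM) (auto intro: prob_space_normal_density)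

lemma measurable_array_given_labels:
  "array_given_labels K d \<in> measurable (measure_pmf p) (subprob_algebra (\<Pi>\<^sub>M j\<in>{1..K} \<times> {1..}. borel))"
  using prob_space_imp_subprob_space[OF prob_space_array_given_labels]
  by (auto simp: measurable_pmf_measure1 space_subprob_algebra sets_array_given_labels)

lemma sets_array_law:
  "sets (array_law K e d) = sets (\<Pi>\<^sub>M j\<in>{1..K} \<times> {1..}. borel)"
  unfolding array_law_def by (intro sets_bind[OF sets_kernel[OF measurable_array_given_labels]]) auto

lemma prob_space_array_law: "prob_space (array_law K e d)"
  unfolding array_law_def
  by (intro measure_pmf.prob_space_bind[OF _ measurable_array_given_labels])
    (simp add: prob_space_array_given_labels)

text \<open>Averaging over independent labels acts on each row separately and turns its factor into
  the two-point mixture, so the product over the rows becomes the likelihood ratio.\<close>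

lemma nn_integral_array_law:
  assumes [measurable]: "g \<in> borel_measurable (\<Pi>\<^sub>M j\<in>{1..K} \<times> {1..t}. borel)"
    and e: "0 \<le> e" "e \<le> 1"
  shows "(\<integral>\<^sup>+x. g (restrict x ({1..K} \<times> {1..t})) \<partial>array_law K e d)
    = (\<integral>\<^sup>+x. ennreal (likelihood_ratio K t e d x) * g x \<partial>noise ({1..K} \<times> {1..t}))"
proof -
  let ?J = "{1..K} \<times> {1..t}"
  let ?p = "Pi_pmf {1..K} False (\<lambda>_. bernoulli_pmf e)"
  let ?f = "\<lambda>i b x. ennreal (if b then lr d t (\<lambda>u. x (i, u)) else 1)"
  \<comment> \<open>The label law has finite support, so integrating over labels is a finite sum and
    is exchanged with the integral over the data by linearity.\<close>
  have fin: "finite (set_pmf ?p)"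
    by (rule finite_subset[OF set_Pi_pmf_subset']) (auto intro!: finite_PiE_dflt)
  have [measurable]: "(\<lambda>x. \<Prod>i=1..K. ?f i (A i) x) \<in> borel_measurable (noise ?J)" for A
    unfolding lr_def by measurable
  have [measurable]: "g \<in> borel_measurable (noise ?J)"
    by (simp add: measurable_cong_sets[OF sets_noise refl])
  have [measurable]: "(\<lambda>x. restrict x ?J) \<in> measurable (\<Pi>\<^sub>M j\<in>{1..K} \<times> {1..}. borel) (\<Pi>\<^sub>M j\<in>?J. borel)"
    by (rule measurable_restrict_subset) auto
  have LR: "(\<integral>\<^sup>+A. (\<Prod>i=1..K. ?f i (A i) x) \<partial>?p) = ennreal (likelihood_ratio K t e d x)" for x
  proof -
    have "(\<integral>\<^sup>+A. (\<Prod>i=1..K. ?f i (A i) x) \<partial>?p) = (\<Prod>i=1..K. \<integral>\<^sup>+b. ?f i b x \<partial>bernoulli_pmf e)"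
      using nn_integral_prod_Pi_pmf[of "{1..K}" False "\<lambda>_. bernoulli_pmf e" "\<lambda>i b. ?f i b x"] by simp
    also have "\<dots> = (\<Prod>i=1..K. ennreal (1 - e + e * lr d t (\<lambda>u. x (i, u))))"
      using e by (intro prod.cong refl)
        (simp add: ennreal_mult'[symmetric] ennreal_plus[symmetric] mult.commute add.commute del: ennreal_plus)
    also have "\<dots> = ennreal (likelihood_ratio K t e d x)"
      unfolding likelihood_ratio_eq using e by (intro prod_ennreal) auto
    finally show ?thesis .
  qed
  have "(\<integral>\<^sup>+x. g (restrict x ?J) \<partial>array_law K e d)
      = (\<integral>\<^sup>+A. (\<integral>\<^sup>+x. g (restrict x ?J) \<partial>array_given_labels K d A) \<partial>?p)"
    unfolding array_law_def by (intro nn_integral_bind[OF _ measurable_array_given_labels]) measurable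
  also have "\<dots> = (\<integral>\<^sup>+A. (\<integral>\<^sup>+x. (\<Prod>i=1..K. ?f i (A i) x) * g x \<partial>noise ?J) \<partial>?p)"
    by (subst nn_integral_array_given_labels) auto
  also have "\<dots> = (\<Sum>A\<in>set_pmf ?p. (\<integral>\<^sup>+x. (\<Prod>i=1..K. ?f i (A i) x) * g x \<partial>noise ?J) * pmf ?p A)"
    by (intro nn_integral_measure_pmf_finite fin) auto
  also have "\<dots> = (\<Sum>A\<in>set_pmf ?p. (\<integral>\<^sup>+x. (\<Prod>i=1..K. ?f i (A i) x) * pmf ?p A * g x \<partial>noise ?J))"
    by (intro sum.cong refl, subst nn_integral_multc[symmetric]) (auto intro!: nn_integral_cong simp: mult_ac)
  also have "\<dots> = (\<integral>\<^sup>+x. (\<Sum>A\<in>set_pmf ?p. (\<Prod>i=1..K. ?f i (A i) x) * pmf ?p A * g x) \<partial>noise ?J)"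
    by (intro nn_integral_sum[symmetric]) measurable
  also have "\<dots> = (\<integral>\<^sup>+x. (\<integral>\<^sup>+A. (\<Prod>i=1..K. ?f i (A i) x) \<partial>?p) * g x \<partial>noise ?J)"
    by (subst nn_integral_measure_pmf_finite[OF fin]) (auto simp: sum_distrib_right)
  finally show ?thesis unfolding LR .
qed

section \<open>Likelihood ratios of Gaussian mixtures\<close>

lemma borel_measurable_noise_eq: "borel_measurable (noise J) = borel_measurable (\<Pi>\<^sub>M j\<in>J. borel)"
  by (rule measurable_cong_sets[OF sets_noise refl])

lemma sum_restrict_le [simp]:
  fixes s t :: nat
  shows "s \<le> t \<Longrightarrow> (\<Sum>u=1..s. restrict y {1..t} u :: real) = (\<Sum>u=1..s. y u)"
  by (auto intro!: sum.cong)

lemma lr_restrict [simp]: "s \<le> t \<Longrightarrow> lr d s (restrict y {1..t}) = lr d s y"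
  by (simp only: lr_def sum_restrict_le)

lemma borel_measurable_stream_sum:
  fixes s t :: nat
  assumes "s \<le> t"
  shows "(\<lambda>y. \<Sum>u=1..s. y u :: real) \<in> borel_measurable (\<Pi>\<^sub>M u\<in>{1..t}. borel)"
  by measurable (use assms in auto)

text \<open>The product of the two exponentials of the sum has slope d + l, so the moment generating
  function suffices. Total mass, Chernoff bounds and second moments all come from this
  identity.\<close>

lemma nn_integral_lr_exp:
  assumes "s \<le> t"
  shows "(\<integral>\<^sup>+y. ennreal (lr d s y * exp (l * (\<Sum>u=1..s. y u))) \<partial>noise {1..t})
    = ennreal (exp (real s * ((d + l)\<^sup>2 - d\<^sup>2) / 2))"
proof -
  have [measurable]: "(\<lambda>y. \<Sum>u=1..s. y u :: real) \<in> borel_measurable (noise {1..t})"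
    using borel_measurable_stream_sum[OF assms] by (simp add: borel_measurable_noise_eq)
  have "(\<integral>\<^sup>+y. ennreal (lr d s y * exp (l * (\<Sum>u=1..s. y u))) \<partial>noise {1..t})
      = (\<integral>\<^sup>+y. ennreal (exp (- real s * d\<^sup>2 / 2)) * ennreal (exp ((d + l) * (\<Sum>u=1..s. y u))) \<partial>noise {1..t})"
    by (intro nn_integral_cong)
      (simp add: lr_def ennreal_mult'[symmetric] exp_add[symmetric] algebra_simps)
  also have "\<dots> = ennreal (exp (- real s * d\<^sup>2 / 2)) * ennreal (exp (real s * (d + l)\<^sup>2 / 2))"
    by (subst nn_integral_cmult) (auto simp: noise_mgf[OF assms])
  also have "\<dots> = ennreal (exp (real s * ((d + l)\<^sup>2 - d\<^sup>2) / 2))"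
    by (simp add: ennreal_mult'[symmetric] exp_add[symmetric] algebra_simps diff_divide_distrib)
  finally show ?thesis .
qed

lemma nn_integral_lr: "s \<le> t \<Longrightarrow> (\<integral>\<^sup>+y. ennreal (lr d s y) \<partial>noise {1..t}) = 1"
  using nn_integral_lr_exp[of s t d 0] by simp

lemma emeasure_noise_space [simp]: "emeasure (noise J) (J \<rightarrow>\<^sub>E UNIV) = 1"
  using prob_space.emeasure_space_1[OF prob_space_noise[of J]] by simp

definition mix :: "real \<Rightarrow> real \<Rightarrow> nat \<Rightarrow> (nat \<Rightarrow> real) \<Rightarrow> real" where
  "mix e d s y = 1 - e + e * lr d s y"

lemma likelihood_ratio_eq_prod_mix: "likelihood_ratio K s e d x = (\<Prod>i=1..K. mix e d s (\<lambda>u. x (i, u)))"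
  by (simp add: likelihood_ratio_eq mix_def)

lemma mix_nonneg: "0 \<le> e \<Longrightarrow> e \<le> 1 \<Longrightarrow> 0 \<le> mix e d s y"
  by (simp add: mix_def)

lemma mix_pos: "0 \<le> e \<Longrightarrow> e < 1 \<Longrightarrow> 0 < mix e d s y"
  by (simp add: mix_def add_pos_nonneg)

lemma mix_restrict [simp]: "s \<le> t \<Longrightarrow> mix e d s (restrict y {1..t}) = mix e d s y"
  by (simp add: mix_def)

lemma borel_measurable_mix [measurable]:
  "s \<le> t \<Longrightarrow> mix e d s \<in> borel_measurable (\<Pi>\<^sub>M u\<in>{1..t}. borel)"
  unfolding mix_def using borel_measurable_lr[of s t d] by measurable

lemma ennreal_mix:
  "0 \<le> e \<Longrightarrow> e \<le> 1 \<Longrightarrow> ennreal (mix e d s y) = ennreal (1 - e) + ennreal e * ennreal (lr d s y)"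
  by (simp add: mix_def ennreal_mult')

lemma nn_integral_mix_mult:
  assumes e: "0 \<le> e" "e \<le> 1" and "s \<le> t" and h: "h \<in> borel_measurable (\<Pi>\<^sub>M u\<in>{1..t}. borel)"
  shows "(\<integral>\<^sup>+y. ennreal (mix e d s y) * h y \<partial>noise {1..t})
    = ennreal (1 - e) * (\<integral>\<^sup>+y. h y \<partial>noise {1..t})
      + ennreal e * (\<integral>\<^sup>+y. ennreal (lr d s y) * h y \<partial>noise {1..t})"
proof -
  have [measurable]: "h \<in> borel_measurable (noise {1..t})" "lr d s \<in> borel_measurable (noise {1..t})"
    using h borel_measurable_lr[OF \<open>s \<le> t\<close>] by (auto simp: borel_measurable_noise_eq)
  have "(\<integral>\<^sup>+y. ennreal (mix e d s y) * h y \<partial>noise {1..t})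
      = (\<integral>\<^sup>+y. ennreal (1 - e) * h y + ennreal e * (ennreal (lr d s y) * h y) \<partial>noise {1..t})"
    using e by (simp add: ennreal_mix algebra_simps)
  also have "\<dots> = ennreal (1 - e) * (\<integral>\<^sup>+y. h y \<partial>noise {1..t})
      + ennreal e * (\<integral>\<^sup>+y. ennreal (lr d s y) * h y \<partial>noise {1..t})"
    by (simp add: nn_integral_add nn_integral_cmult)
  finally show ?thesis .
qed

lemma nn_integral_mix:
  assumes "0 \<le> e" "e \<le> 1" "s \<le> t"
  shows "(\<integral>\<^sup>+y. ennreal (mix e d s y) \<partial>noise {1..t}) = 1"
  using nn_integral_mix_mult[of e s t "\<lambda>_. 1" d] assms
  by (simp add: nn_integral_lr ennreal_plus[symmetric] del: ennreal_plus)

section \<open>Stochastic monotonicity and reduction to the Hellinger affinity\<close>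

lemma lr_shift_mono:
  assumes "0 \<le> d" "m \<le> m'"
  shows "lr d t (\<lambda>u\<in>{1..t}. y u + m) \<le> lr d t (\<lambda>u\<in>{1..t}. y u + m')"
proof -
  have "(\<Sum>u=1..t. y u + m) \<le> (\<Sum>u=1..t. y u + m')" using assms by (intro sum_mono) auto
  then show ?thesis using assms by (simp add: lr_def mult_left_mono)
qed

text \<open>Stochastic monotonicity of one stream. After the shift the mean m appears only inside
  \<open>lr d'\<close>, which increases with m because \<open>d'\<close> is nonnegative; hence
  \<open>H\<close>, the integral of the decreasing \<open>h\<close>, falls as m grows.\<close>

lemma nn_integral_mix_antimono:
  fixes h :: "real \<Rightarrow> real"
  assumes e: "0 \<le> e'" "e' \<le> e" "e \<le> 1" and d: "0 \<le> d'" "d' \<le> d"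
    and h: "\<And>a b. 0 < a \<Longrightarrow> a \<le> b \<Longrightarrow> h b \<le> h a" and hm [measurable]: "h \<in> borel_measurable borel"
  shows "(\<integral>\<^sup>+y. ennreal (mix e d t y) * ennreal (h (lr d' t y)) \<partial>noise {1..t})
    \<le> (\<integral>\<^sup>+y. ennreal (mix e' d' t y) * ennreal (h (lr d' t y)) \<partial>noise {1..t})"
proof -
  define H where "H m = (\<integral>\<^sup>+y. ennreal (lr m t y) * ennreal (h (lr d' t y)) \<partial>noise {1..t})" for m
  have [measurable]: "lr m t \<in> borel_measurable (\<Pi>\<^sub>M u\<in>{1..t}. borel)" for m
    by (rule borel_measurable_lr) simp
  have meas: "(\<lambda>y. ennreal (h (lr d' t y))) \<in> borel_measurable (\<Pi>\<^sub>M u\<in>{1..t}. borel)"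
    by measurable
  have H: "H m' \<le> H m" if "m \<le> m'" for m m'
    unfolding H_def nn_integral_shift[OF meas]
    by (intro nn_integral_mono ennreal_leI h lr_pos lr_shift_mono that d(1))
  have H0: "(\<integral>\<^sup>+y. ennreal (h (lr d' t y)) \<partial>noise {1..t}) = H 0"
    by (simp add: H_def lr_def)
  \<comment> \<open>The alternative is weakened in two moves: the signal is lowered from d to
    \<open>d'\<close>, and then the weight e - \<open>e'\<close> is moved from mean
    \<open>d'\<close> to mean 0.\<close>
  have "ennreal (1 - e) * H 0 + ennreal e * H d \<le> ennreal (1 - e) * H 0 + ennreal e * H d'"
    by (intro add_mono mult_left_mono H d) auto
  also have "ennreal e * H d' = (ennreal (e - e') + ennreal e') * H d'"
    using e by (simp add: ennreal_plus[symmetric] del: ennreal_plus)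
  also have "ennreal (1 - e) * H 0 + (ennreal (e - e') + ennreal e') * H d'
      \<le> ennreal (1 - e) * H 0 + ennreal (e - e') * H 0 + ennreal e' * H d'"
    unfolding distrib_right[of _ _ "H d'"] add.assoc by (intro add_mono mult_left_mono H d order_refl) auto
  also have "ennreal (1 - e) * H 0 + ennreal (e - e') * H 0 = ennreal (1 - e') * H 0"
    unfolding distrib_right[symmetric]
    using e by (simp add: ennreal_plus[symmetric] del: ennreal_plus)
  finally have "ennreal (1 - e) * H 0 + ennreal e * H d \<le> ennreal (1 - e') * H 0 + ennreal e' * H d'" .
  then show ?thesis
    using e by (simp add: nn_integral_mix_mult[OF _ _ order_refl meas] H0 H_def[symmetric])
qed

lemma likelihood_ratio_restrict:
  "s \<le> t \<Longrightarrow> likelihood_ratio K s e d (restrict x ({1..K} \<times> {1..t})) = likelihood_ratio K s e d x"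
  unfolding likelihood_ratio_eq lr_def by (intro prod.cong refl) (auto intro!: sum.cong)

lemma likelihood_ratio_nonneg: "0 \<le> e \<Longrightarrow> e \<le> 1 \<Longrightarrow> 0 \<le> likelihood_ratio K s e d x"
  unfolding likelihood_ratio_eq_prod_mix by (intro prod_nonneg) (auto simp: mix_nonneg)

lemma likelihood_ratio_pos: "0 \<le> e \<Longrightarrow> e < 1 \<Longrightarrow> 0 < likelihood_ratio K s e d x"
  unfolding likelihood_ratio_eq_prod_mix by (intro prod_pos) (auto simp: mix_pos)

lemma measurable_restrict_array:
  "(\<lambda>x. restrict x ({1..K} \<times> {1..t}))
    \<in> measurable (array_law K e d) (\<Pi>\<^sub>M j\<in>{1..K} \<times> {1..t}. borel)"
  by (subst measurable_cong_sets[OF sets_array_law refl]) (rule measurable_restrict_subset, auto)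

lemma emeasure_array_law_restrict:
  assumes B: "B \<in> sets (\<Pi>\<^sub>M j\<in>{1..K} \<times> {1..t}. borel)" and e: "0 \<le> e" "e \<le> 1"
  shows "emeasure (array_law K e d) {x \<in> space (array_law K e d). restrict x ({1..K} \<times> {1..t}) \<in> B}
    = (\<integral>\<^sup>+x. ennreal (likelihood_ratio K t e d x) * indicator B x \<partial>noise ({1..K} \<times> {1..t}))"
proof -
  let ?M = "array_law K e d" and ?J = "{1..K} \<times> {1..t}"
  have "{x \<in> space ?M. restrict x ?J \<in> B} \<in> sets ?M"
    using measurable_sets[OF measurable_restrict_array B] by (simp add: vimage_def Int_def conj_commute)
  then have "emeasure ?M {x \<in> space ?M. restrict x ?J \<in> B}
      = (\<integral>\<^sup>+x. indicator {x \<in> space ?M. restrict x ?J \<in> B} x \<partial>?M)"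
    by (rule nn_integral_indicator[symmetric])
  also have "\<dots> = (\<integral>\<^sup>+x. indicator B (restrict x ?J) \<partial>?M)"
    by (intro nn_integral_cong) (auto split: split_indicator)
  also have "\<dots> = (\<integral>\<^sup>+x. ennreal (likelihood_ratio K t e d x) * indicator B x \<partial>noise ?J)"
    using B e by (intro nn_integral_array_law) auto
  finally show ?thesis .
qed

text \<open>Markov's inequality for sqrt (M / E), with E the likelihood ratio at \<open>e'\<close>
  and \<open>d'\<close>. The mean of 1 / sqrt E factorises over the streams, and each factor can
  only grow when the true parameters are lowered to those of E; there mix / sqrt mix = sqrt mix, and
  no trace of the true parameters is left.\<close>

lemma array_law_likelihood_ratio_less:
  assumes e: "0 \<le> e'" "e' \<le> e" "e \<le> 1" "e' < 1" and d: "0 \<le> d'" "d' \<le> d" and M: "0 < M"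
  shows "emeasure (array_law K e d) {x \<in> space (array_law K e d). likelihood_ratio K t e' d' x < M}
    \<le> ennreal (sqrt M) * (\<integral>\<^sup>+y. ennreal (sqrt (mix e' d' t y)) \<partial>noise {1..t}) ^ K"
proof -
  let ?J = "{1..K} \<times> {1..t}"
  define B where "B = {x \<in> space (\<Pi>\<^sub>M j\<in>?J. borel). likelihood_ratio K t e' d' x < M}"
  define h where "h a = 1 / sqrt (1 - e' + e' * a)" for a
  have hm [measurable]: "h \<in> borel_measurable borel" unfolding h_def by measurable
  have anti: "h b \<le> h a" if "0 < a" "a \<le> b" for a b
  proof -
    have "1 - e' + e' * a \<le> 1 - e' + e' * b" "0 < 1 - e' + e' * a"
      using that e by (auto intro: mult_left_mono add_pos_nonneg)
    then show ?thesis by (simp add: h_def frac_le)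
  qed
  have hmix: "h (lr d' t y) = 1 / sqrt (mix e' d' t y)" for y by (simp add: h_def mix_def)
  have [measurable]: "likelihood_ratio K t e' d' \<in> borel_measurable (\<Pi>\<^sub>M j\<in>?J. borel)"
    by (rule borel_measurable_likelihood_ratio) simp
  have [measurable]: "lr d' t \<in> borel_measurable (\<Pi>\<^sub>M u\<in>{1..t}. borel)"
    "mix e d t \<in> borel_measurable (\<Pi>\<^sub>M u\<in>{1..t}. borel)"
    by (auto intro: borel_measurable_lr borel_measurable_mix)
  have [measurable]: "(\<lambda>x. lr d' t (\<lambda>u. x (i, u))) \<in> borel_measurable (\<Pi>\<^sub>M j\<in>?J. borel)"
    "(\<lambda>x. mix e d t (\<lambda>u. x (i, u))) \<in> borel_measurable (\<Pi>\<^sub>M j\<in>?J. borel)" if "i \<in> {1..K}" for i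
    unfolding mix_def lr_def by (measurable, use that in auto)+
  have B: "B \<in> sets (\<Pi>\<^sub>M j\<in>?J. borel)" unfolding B_def by measurable
  have "{x \<in> space (array_law K e d). likelihood_ratio K t e' d' x < M}
      = {x \<in> space (array_law K e d). restrict x ?J \<in> B}"
    by (auto simp: B_def space_PiM likelihood_ratio_restrict)
  then have "emeasure (array_law K e d) {x \<in> space (array_law K e d). likelihood_ratio K t e' d' x < M}
      = (\<integral>\<^sup>+x. ennreal (likelihood_ratio K t e d x) * indicator B x \<partial>noise ?J)"
    using emeasure_array_law_restrict[OF B, of e d] e by simp
  also have "\<dots> \<le> (\<integral>\<^sup>+x. ennreal (sqrt M) *
      (\<Prod>i=1..K. ennreal (mix e d t (\<lambda>u. x (i, u))) * ennreal (h (lr d' t (\<lambda>u. x (i, u))))) \<partial>noise ?J)"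
  proof (intro nn_integral_mono)
    fix x
    let ?L = "likelihood_ratio K t e d x" and ?L' = "likelihood_ratio K t e' d' x"
    have L: "0 \<le> ?L" "0 < ?L'" using e by (auto intro: likelihood_ratio_nonneg likelihood_ratio_pos)
    have "1 / sqrt ?L' = (\<Prod>i=1..K. h (lr d' t (\<lambda>u. x (i, u))))"
    proof -
      have "sqrt (\<Prod>i\<in>I. f i) = (\<Prod>i\<in>I. sqrt (f i))" for f :: "nat \<Rightarrow> real" and I
        by (induction I rule: infinite_finite_induct) (auto simp: real_sqrt_mult)
      then show ?thesis by (simp add: hmix likelihood_ratio_eq_prod_mix prod_dividef)
    qed
    moreover have "0 \<le> mix e d t (\<lambda>u. x (i, u)) * h (lr d' t (\<lambda>u. x (i, u)))" for i
      using e by (auto simp: hmix intro!: divide_nonneg_nonneg mix_nonneg)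
    ultimately have "(\<Prod>i=1..K. ennreal (mix e d t (\<lambda>u. x (i, u))) * ennreal (h (lr d' t (\<lambda>u. x (i, u)))))
        = ennreal (?L * (1 / sqrt ?L'))"
      using e by (simp add: ennreal_mult'[symmetric] mix_nonneg prod_ennreal prod.distrib
          likelihood_ratio_eq_prod_mix)
    moreover have "?L * indicator B x \<le> sqrt M * (?L * (1 / sqrt ?L'))"
    proof (cases "x \<in> B")
      case True
      then have "sqrt ?L' \<le> sqrt M" by (simp add: B_def)
      then have "?L * 1 \<le> ?L * (sqrt M / sqrt ?L')" using L by (intro mult_left_mono) auto
      then show ?thesis using True by (simp add: mult_ac)
    qed (use L M in auto)
    moreover have "ennreal ?L * indicator B x = ennreal (?L * indicator B x)"
      by (simp add: indicator_def)
    ultimately show "ennreal ?L * indicator B x \<le> ennreal (sqrt M) *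
        (\<Prod>i=1..K. ennreal (mix e d t (\<lambda>u. x (i, u))) * ennreal (h (lr d' t (\<lambda>u. x (i, u)))))"
      using M by (simp add: ennreal_mult'[symmetric] ennreal_leI)
  qed
  also have "\<dots> = ennreal (sqrt M) *
      (\<integral>\<^sup>+y. ennreal (mix e d t y) * ennreal (h (lr d' t y)) \<partial>noise {1..t}) ^ K"
    by (subst nn_integral_cmult, simp add: borel_measurable_noise_eq, subst nn_integral_noise_prod) auto
  also have "\<dots> \<le> ennreal (sqrt M) *
      (\<integral>\<^sup>+y. ennreal (mix e' d' t y) * ennreal (h (lr d' t y)) \<partial>noise {1..t}) ^ K"
    using e d anti by (intro mult_left_mono power_mono nn_integral_mix_antimono) auto
  also have "(\<integral>\<^sup>+y. ennreal (mix e' d' t y) * ennreal (h (lr d' t y)) \<partial>noise {1..t})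
      = (\<integral>\<^sup>+y. ennreal (sqrt (mix e' d' t y)) \<partial>noise {1..t})"
  proof (intro nn_integral_cong)
    fix y
    have "mix e' d' t y > 0" using e by (intro mix_pos) auto
    then show "ennreal (mix e' d' t y) * ennreal (h (lr d' t y)) = ennreal (sqrt (mix e' d' t y))"
      by (simp add: hmix ennreal_mult'[symmetric] real_div_sqrt)
  qed
  finally show ?thesis .
qed

section \<open>The Hellinger affinity of one stream with the null\<close>

lemma sqrt_one_plus_le:
  assumes "0 \<le> w" "w \<le> v"
  shows "sqrt (1 + v) \<le> 1 + v / 2 - min w (w\<^sup>2) / 12"
proof -
  define r where "r = sqrt (1 + v) - 1"
  have r0: "0 \<le> r" and v: "v = r * (r + 2)"
    using assms by (auto simp: r_def algebra_simps power2_eq_square[symmetric])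
  \<comment> \<open>With r = sqrt (1 + v) - 1 the concavity deficit is exactly r^2 / 2, quadratic in
    v for small v and linear for large v. Splitting at r = 2 / 5 makes the constant 6 work on both
    sides: (12 / 5)^2 = 5.76 below, and 2 r \<le> 5 r^2 above.\<close>
  have "min v (v\<^sup>2) \<le> 6 * r\<^sup>2"
  proof (cases "r \<le> 2/5")
    case True
    then have "(r + 2)\<^sup>2 \<le> (12/5)\<^sup>2" using r0 by (intro power_mono) auto
    then have "r\<^sup>2 * (r + 2)\<^sup>2 \<le> r\<^sup>2 * 6" by (intro mult_left_mono) (auto simp: power2_eq_square)
    then show ?thesis by (simp add: v power_mult_distrib)
  next
    case False
    then have "2 * r \<le> 5 * r * r" using r0 by (intro mult_right_mono) auto
    then show ?thesis by (simp add: v power2_eq_square algebra_simps)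
  qed
  moreover have "min w (w\<^sup>2) \<le> min v (v\<^sup>2)"
    using assms by (intro min.mono power_mono) auto
  ultimately have "min w (w\<^sup>2) \<le> 6 * r\<^sup>2" by (rule order_trans[rotated])
  moreover have "sqrt (1 + v) = 1 + v / 2 - r\<^sup>2 / 2"
  proof -
    have "v / 2 = r\<^sup>2 / 2 + r" by (simp add: v algebra_simps power2_eq_square)
    then show ?thesis by (simp add: r_def)
  qed
  ultimately show ?thesis by simp
qed

text \<open>The density decreases on the interval, so its value at the right end times the length 1
  is a lower bound. Passing from a to a + 1 costs the factor exp (- a - 1 / 2), subpolynomial in K
  when a is of order sqrt (ln K).\<close>

lemma emeasure_gauss_unit_interval:
  assumes "0 \<le> a"
  shows "ennreal (std_normal_density (a + 1)) \<le> emeasure (gauss 0) {a..a + 1}"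
proof -
  have "ennreal (std_normal_density (a + 1)) = (\<integral>\<^sup>+x. ennreal (std_normal_density (a + 1)) * indicator {a..a + 1} x \<partial>lborel)"
    by (subst nn_integral_cmult) auto
  also have "\<dots> \<le> (\<integral>\<^sup>+x. ennreal (std_normal_density x) * indicator {a..a + 1} x \<partial>lborel)"
  proof (intro nn_integral_mono)
    fix x :: real
    have "std_normal_density (a + 1) \<le> std_normal_density x" if "a \<le> x" "x \<le> a + 1"
      using that assms by (simp add: std_normal_density_def power_mono divide_right_mono)
    then show "ennreal (std_normal_density (a + 1)) * indicator {a..a + 1} x
        \<le> ennreal (std_normal_density x) * indicator {a..a + 1} x"
      by (auto split: split_indicator intro!: ennreal_leI)
  qed
  also have "\<dots> = emeasure (gauss 0) {a..a + 1}"
    unfolding gauss_def by (subst emeasure_density) auto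
  finally show ?thesis .
qed

text \<open>AM-GM alone bounds the affinity by 1. The gain comes from the box \<open>W\<close>,
  where all t entries lie near a and the mixture exceeds 1 by at least w. The box has the same
  leading exponent as the event that the sum reaches t * a, since equal entries are the most likely
  way to get there.\<close>

lemma nn_integral_sqrt_mix_le:
  assumes e: "0 \<le> e" "e < 1" and d: "0 \<le> d" and a: "0 \<le> a"
    and l: "2 \<le> exp (real t * (d * a - d\<^sup>2 / 2))"
    and w: "w = e * exp (real t * (d * a - d\<^sup>2 / 2)) / 2"
  shows "(\<integral>\<^sup>+y. ennreal (sqrt (mix e d t y)) \<partial>noise {1..t})
    \<le> ennreal (exp (- (min w (w\<^sup>2) / 12 * std_normal_density (a + 1) ^ t)))"
proof -
  let ?N = "noise {1..t} :: (nat \<Rightarrow> real) measure"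
  define m where "m = min w (w\<^sup>2) / 12"
  define W :: "(nat \<Rightarrow> real) set" where "W = (\<Pi>\<^sub>E u\<in>{1..t}. {a..a + 1})"
  define q where "q = std_normal_density (a + 1) ^ t"
  interpret product_sigma_finite "\<lambda>j. gauss 0" by (rule product_sigma_finite_gauss)
  have w0: "0 \<le> w" unfolding w using e by simp
  then have m0: "0 \<le> m" by (simp add: m_def)
  have [measurable]: "mix e d t \<in> borel_measurable ?N"
    unfolding borel_measurable_noise_eq by (rule borel_measurable_mix) simp
  have W [measurable]: "W \<in> sets ?N"
    unfolding W_def noise_def by (intro sets_PiM_I_finite) auto
  have "ennreal q \<le> (\<Prod>u\<in>{1..t}. emeasure (gauss 0) {a..a + 1})"
    using emeasure_gauss_unit_interval[OF a] unfolding q_def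
    by (simp add: ennreal_power[symmetric] power_mono)
  also have "\<dots> = emeasure ?N W"
    unfolding W_def noise_def by (subst emeasure_PiM) auto
  finally have qW: "ennreal q \<le> emeasure ?N W" .
  \<comment> \<open>Pointwise AM-GM, strengthened on \<open>W\<close> by the deficit
    \<open>m\<close>; integrating it bounds the affinity by 1 - m * q.\<close>
  have pt: "sqrt (mix e d t y) + m * indicator W y \<le> (1 + mix e d t y) / 2" for y
  proof (cases "y \<in> W")
    case True
    have "(\<Sum>u=1..t. a) \<le> (\<Sum>u=1..t. y u)"
      using True by (intro sum_mono) (auto simp: W_def)
    then have "d * (real t * a) \<le> d * (\<Sum>u=1..t. y u)"
      using d by (intro mult_left_mono) auto
    then have "exp (real t * (d * a - d\<^sup>2 / 2)) \<le> lr d t y"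
      by (simp add: lr_def algebra_simps)
    then have "e * exp (real t * (d * a - d\<^sup>2 / 2)) \<le> e * lr d t y"
      using e by (intro mult_left_mono) auto
    \<comment> \<open>As the lower bound for the likelihood ratio on \<open>W\<close> is at least 2,
      the -1 in e * (lr - 1) is absorbed by the factor 1 / 2 in \<open>w\<close>.\<close>
    moreover have "e * 2 \<le> e * exp (real t * (d * a - d\<^sup>2 / 2))"
      using e l by (intro mult_left_mono) auto
    ultimately have "w \<le> e * (lr d t y - 1)" by (simp add: w algebra_simps)
    from sqrt_one_plus_le[OF w0 this] show ?thesis
      using True by (simp add: mix_def m_def field_simps)
  next
    case False
    have "sqrt (mix e d t y) \<le> (mix e d t y + 1) / 2"
      using e arith_geo_mean_sqrt[of "mix e d t y" 1] by (simp add: mix_nonneg)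
    then show ?thesis using False by (simp add: add.commute)
  qed
  define I where "I = (\<integral>\<^sup>+y. ennreal (sqrt (mix e d t y)) \<partial>?N)"
  have "I + ennreal m * emeasure ?N W = (\<integral>\<^sup>+y. ennreal (sqrt (mix e d t y)) + ennreal m * indicator W y \<partial>?N)"
    unfolding I_def by (subst nn_integral_add) (auto simp: nn_integral_cmult)
  also have "\<dots> \<le> (\<integral>\<^sup>+y. ennreal (1/2) * (1 + ennreal (mix e d t y)) \<partial>?N)"
  proof (intro nn_integral_mono)
    fix y
    have "ennreal (sqrt (mix e d t y)) + ennreal m * indicator W y
        = ennreal (sqrt (mix e d t y) + m * indicator W y)"
      using m0 e by (auto simp: ennreal_plus mix_nonneg split: split_indicator)
    also have "\<dots> \<le> ennreal ((1 + mix e d t y) / 2)" using pt by (rule ennreal_leI)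
    also have "\<dots> = ennreal (1/2 * (1 + mix e d t y))" by simp
    also have "\<dots> = ennreal (1/2) * ennreal (1 + mix e d t y)" by (intro ennreal_mult') simp
    also have "ennreal (1 + mix e d t y) = 1 + ennreal (mix e d t y)"
      using e by (simp add: ennreal_plus mix_nonneg)
    finally show "ennreal (sqrt (mix e d t y)) + ennreal m * indicator W y
        \<le> ennreal (1/2) * (1 + ennreal (mix e d t y))" .
  qed
  also have "\<dots> = ennreal (1/2) * (1 + 1)"
    using e nn_integral_mix[of e t t d]
    by (subst nn_integral_cmult) (auto simp: nn_integral_add)
  also have "\<dots> = ennreal (1/2) * ennreal 2" by simp
  also have "\<dots> = ennreal (1/2 * 2)" by (rule ennreal_mult'[symmetric]) simp
  also have "\<dots> = 1" by simp
  finally have "I + ennreal m * emeasure ?N W \<le> 1" .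
  then have le: "I + ennreal (m * q) \<le> 1"
    using mult_left_mono[OF qW, of "ennreal m"] m0
    by (simp add: ennreal_mult') (meson add_left_mono order_trans)
  then obtain r where r: "I = ennreal r" "0 \<le> r"
    by (cases I) (auto simp: top_unique)
  have "0 \<le> q" by (simp add: q_def)
  then have "r + m * q \<le> 1"
    using le r m0 by (simp flip: ennreal_1 ennreal_plus add: ennreal_le_iff)
  then have "r \<le> exp (- (m * q))" using exp_ge_add_one_self[of "- (m * q)"] by simp
  then show ?thesis using r(1) by (simp add: I_def m_def q_def ennreal_leI)
qed

lemma likelihood_ratio_large:
  assumes e: "0 \<le> e'" "e' \<le> e" "e \<le> 1" "e' < 1" and d: "0 \<le> d'" "d' \<le> d" and M: "0 < M"
    and a: "0 \<le> a"
    and l: "2 \<le> exp (real t * (d' * a - d'\<^sup>2 / 2))"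
    and w: "w = e' * exp (real t * (d' * a - d'\<^sup>2 / 2)) / 2"
  shows "measure (array_law K e d) {x \<in> space (array_law K e d). likelihood_ratio K t e' d' x < M}
    \<le> sqrt M * exp (- (real K * (min w (w\<^sup>2) / 12 * std_normal_density (a + 1) ^ t)))"
proof -
  let ?X = "{x \<in> space (array_law K e d). likelihood_ratio K t e' d' x < M}"
  define b where "b = min w (w\<^sup>2) / 12 * std_normal_density (a + 1) ^ t"
  interpret prob_space "array_law K e d" by (rule prob_space_array_law)
  have "emeasure (array_law K e d) ?X
      \<le> ennreal (sqrt M) * (\<integral>\<^sup>+y. ennreal (sqrt (mix e' d' t y)) \<partial>noise {1..t}) ^ K"
    by (rule array_law_likelihood_ratio_less[OF e d M])
  also have "\<dots> \<le> ennreal (sqrt M) * ennreal (exp (- b)) ^ K"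
    unfolding b_def by (intro mult_left_mono power_mono nn_integral_sqrt_mix_le e d a l w) auto
  also have "\<dots> = ennreal (sqrt M * exp (- (real K * b)))"
    using M by (simp add: ennreal_power ennreal_mult' exp_of_nat_mult[symmetric])
  finally show ?thesis
    unfolding b_def emeasure_eq_measure using M by (subst (asm) ennreal_le_iff) auto
qed

section \<open>Tails and truncated second moment of one stream\<close>

lemma lr_upper_tail:
  assumes t: "0 < t" and c: "real t * d \<le> c"
  shows "(\<integral>\<^sup>+y. ennreal (lr d t y) * indicator {y. c < (\<Sum>u=1..t. y u)} y \<partial>noise {1..t})
    \<le> ennreal (exp (- (c - real t * d)\<^sup>2 / (2 * real t)))"
proof -
  \<comment> \<open>The optimal Chernoff tilt: it moves the mean of the sum from t * d to c, and t *
    d \<le> c makes it nonnegative.\<close>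
  define l where "l = c / t - d"
  have l: "0 \<le> l" using assms by (simp add: l_def field_simps)
  have [measurable]: "lr d t \<in> borel_measurable (noise {1..t})"
      "(\<lambda>y. \<Sum>u=1..t. y u :: real) \<in> borel_measurable (noise {1..t})"
    using borel_measurable_lr[of t t d] borel_measurable_stream_sum[of t t]
    by (auto simp: borel_measurable_noise_eq)
  have "(\<integral>\<^sup>+y. ennreal (lr d t y) * indicator {y. c < (\<Sum>u=1..t. y u)} y \<partial>noise {1..t})
      \<le> (\<integral>\<^sup>+y. ennreal (exp (- l * c)) * ennreal (lr d t y * exp (l * (\<Sum>u=1..t. y u))) \<partial>noise {1..t})"
  proof (intro nn_integral_mono)
    fix y :: "nat \<Rightarrow> real"
    have "1 \<le> exp (- l * c) * exp (l * (\<Sum>u=1..t. y u))" if "c < (\<Sum>u=1..t. y u)"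
      using that l by (simp add: exp_add[symmetric] mult_left_mono)
    then have "lr d t y * 1 \<le> lr d t y * (exp (- l * c) * exp (l * (\<Sum>u=1..t. y u)))"
      if "c < (\<Sum>u=1..t. y u)"
      using that by (intro mult_left_mono) auto
    then show "ennreal (lr d t y) * indicator {y. c < (\<Sum>u=1..t. y u)} y
        \<le> ennreal (exp (- l * c)) * ennreal (lr d t y * exp (l * (\<Sum>u=1..t. y u)))"
      by (auto simp: ennreal_mult'[symmetric] mult_ac intro!: ennreal_leI split: split_indicator)
  qed
  also have "\<dots> = ennreal (exp (- l * c)) * ennreal (exp (real t * ((d + l)\<^sup>2 - d\<^sup>2) / 2))"
    by (subst nn_integral_cmult) (auto simp: nn_integral_lr_exp)
  also have "\<dots> = ennreal (exp (- l * c + real t * ((d + l)\<^sup>2 - d\<^sup>2) / 2))"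
    by (subst ennreal_mult'[symmetric]) (simp_all add: exp_add[symmetric] algebra_simps)
  also have "- l * c + real t * ((d + l)\<^sup>2 - d\<^sup>2) / 2 = - (c - real t * d)\<^sup>2 / (2 * real t)"
    using t by (simp add: l_def field_simps power2_eq_square)
  finally show ?thesis .
qed

text \<open>The square of a Gaussian likelihood ratio is, up to the constant
  \<open>exp (real t * d\<^sup>2)\<close>, the likelihood ratio for the doubled mean; so the second
  moment is again a tilted first moment.\<close>

lemma lr_square_exp:
  "(\<integral>\<^sup>+y. ennreal ((lr d t y)\<^sup>2 * exp (- l * (\<Sum>u=1..t. y u))) \<partial>noise {1..t})
    = ennreal (exp (real t * ((2 * d - l)\<^sup>2 - 2 * d\<^sup>2) / 2))"
proof -
  have [measurable]: "lr d t \<in> borel_measurable (noise {1..t})"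
      "(\<lambda>y. \<Sum>u=1..t. y u :: real) \<in> borel_measurable (noise {1..t})" for d
    using borel_measurable_lr[of t t d] borel_measurable_stream_sum[of t t]
    by (auto simp: borel_measurable_noise_eq)
  have sq: "(lr d t y)\<^sup>2 = exp (real t * d\<^sup>2) * lr (2 * d) t y" for y
    by (simp add: lr_def exp_add[symmetric] power2_eq_square[of "exp _"] power_mult_distrib algebra_simps)
  have "(\<integral>\<^sup>+y. ennreal ((lr d t y)\<^sup>2 * exp (- l * (\<Sum>u=1..t. y u))) \<partial>noise {1..t})
      = (\<integral>\<^sup>+y. ennreal (exp (real t * d\<^sup>2)) * ennreal (lr (2 * d) t y * exp (- l * (\<Sum>u=1..t. y u))) \<partial>noise {1..t})"
    by (intro nn_integral_cong) (simp add: sq ennreal_mult'[symmetric] mult_ac)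
  also have "\<dots> = ennreal (exp (real t * d\<^sup>2)) * ennreal (exp (real t * ((2 * d + - l)\<^sup>2 - (2 * d)\<^sup>2) / 2))"
    by (subst nn_integral_cmult) (auto simp: nn_integral_lr_exp[of t t _ "- l", simplified])
  also have "\<dots> = ennreal (exp (real t * ((2 * d - l)\<^sup>2 - 2 * d\<^sup>2) / 2))"
    by (simp add: ennreal_mult'[symmetric] exp_add[symmetric] algebra_simps power2_eq_square diff_divide_distrib add_divide_distrib)
  finally show ?thesis .
qed

text \<open>Chernoff bound to the left under the doubled mean. The tilt stays free because its best
  value depends on which side of c the mean 2 * t * d lies.\<close>

lemma lr_square_lower_tail:
  assumes l: "0 \<le> l"
  shows "(\<integral>\<^sup>+y. ennreal ((lr d t y)\<^sup>2) * indicator {y. (\<Sum>u=1..t. y u) \<le> c} y \<partial>noise {1..t})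
    \<le> ennreal (exp (l * c + real t * ((2 * d - l)\<^sup>2 - 2 * d\<^sup>2) / 2))"
proof -
  have [measurable]: "lr d t \<in> borel_measurable (noise {1..t})"
      "(\<lambda>y. \<Sum>u=1..t. y u :: real) \<in> borel_measurable (noise {1..t})"
    using borel_measurable_lr[of t t d] borel_measurable_stream_sum[of t t]
    by (auto simp: borel_measurable_noise_eq)
  have "(\<integral>\<^sup>+y. ennreal ((lr d t y)\<^sup>2) * indicator {y. (\<Sum>u=1..t. y u) \<le> c} y \<partial>noise {1..t})
      \<le> (\<integral>\<^sup>+y. ennreal (exp (l * c)) * ennreal ((lr d t y)\<^sup>2 * exp (- l * (\<Sum>u=1..t. y u))) \<partial>noise {1..t})"
  proof (intro nn_integral_mono)
    fix y :: "nat \<Rightarrow> real"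
    have "1 \<le> exp (l * c) * exp (- l * (\<Sum>u=1..t. y u))" if "(\<Sum>u=1..t. y u) \<le> c"
      using that l by (simp add: exp_add[symmetric] mult_left_mono)
    then have "(lr d t y)\<^sup>2 * 1 \<le> (lr d t y)\<^sup>2 * (exp (l * c) * exp (- l * (\<Sum>u=1..t. y u)))"
      if "(\<Sum>u=1..t. y u) \<le> c"
      using that by (intro mult_left_mono) auto
    then show "ennreal ((lr d t y)\<^sup>2) * indicator {y. (\<Sum>u=1..t. y u) \<le> c} y
        \<le> ennreal (exp (l * c)) * ennreal ((lr d t y)\<^sup>2 * exp (- l * (\<Sum>u=1..t. y u)))"
      by (auto simp: ennreal_mult'[symmetric] mult_ac intro!: ennreal_leI split: split_indicator)
  qed
  also have "\<dots> = ennreal (exp (l * c)) * ennreal (exp (real t * ((2 * d - l)\<^sup>2 - 2 * d\<^sup>2) / 2))"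
    by (subst nn_integral_cmult) (auto simp: lr_square_exp[simplified])
  finally show ?thesis by (simp add: ennreal_mult'[symmetric] exp_add)
qed

section \<open>Truncated second moments and the null behaviour of mixtures\<close>

lemma nn_integral_likelihood_ratio:
  assumes e: "0 \<le> e" "e \<le> 1" and s: "s \<le> t"
  shows "(\<integral>\<^sup>+x. ennreal (likelihood_ratio K s e d x) \<partial>noise ({1..K} \<times> {1..t})) = 1"
proof -
  have "(\<integral>\<^sup>+x. ennreal (likelihood_ratio K s e d x) \<partial>noise ({1..K} \<times> {1..t}))
      = (\<integral>\<^sup>+x. (\<Prod>i=1..K. ennreal (mix e d s (\<lambda>u. x (i, u)))) \<partial>noise ({1..K} \<times> {1..t}))"
    using e by (simp add: likelihood_ratio_eq_prod_mix prod_ennreal mix_nonneg)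
  also have "\<dots> = (\<integral>\<^sup>+y. ennreal (mix e d s y) \<partial>noise {1..t}) ^ K"
    using s by (intro nn_integral_noise_prod) (auto intro!: measurable_compose[OF borel_measurable_mix])
  finally show ?thesis using nn_integral_mix[OF e s] by simp
qed

text \<open>
  The density is truncated before its second moment is taken: the moment of the full likelihood
  ratio can explode below the detection boundary once \<open>\<beta> > 3 / 4\<close>.
\<close>

lemma likelihood_ratio_event_le:
  assumes e: "0 \<le> e" "e \<le> 1" and p: "0 \<le> p" "e * p \<le> 1" and q: "0 \<le> q" and L: "0 < L"
    and B [measurable]: "B \<in> sets (\<Pi>\<^sub>M j\<in>{1..K} \<times> {1..t}. borel)"
    and up: "(\<integral>\<^sup>+y. ennreal (lr d t y) * indicator {y. c < (\<Sum>u=1..t. y u)} y \<partial>noise {1..t}) \<le> ennreal p"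
    and low: "(\<integral>\<^sup>+y. ennreal ((lr d t y)\<^sup>2) * indicator {y. (\<Sum>u=1..t. y u) \<le> c} y \<partial>noise {1..t}) \<le> ennreal q"
  shows "(\<integral>\<^sup>+x. ennreal (likelihood_ratio K t e d x) * indicator B x \<partial>noise ({1..K} \<times> {1..t}))
    \<le> ennreal (real K * e * p) + ennreal L * emeasure (noise ({1..K} \<times> {1..t})) B
      + ennreal (exp (real K * e\<^sup>2 * q) / L)"
proof -
  let ?J = "{1..K} \<times> {1..t}"
  let ?N = "noise {1..t} :: (nat \<Rightarrow> real) measure"
  let ?hi = "indicator {y. c < (\<Sum>u=1..t. y u)} :: (nat \<Rightarrow> real) \<Rightarrow> real"
  let ?lo = "indicator {y. (\<Sum>u=1..t. y u) \<le> c} :: (nat \<Rightarrow> real) \<Rightarrow> real"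
  \<comment> \<open>\<open>f\<close> drops the signal part of a row whose sum exceeds c, so that
    \<open>G\<close> is a subprobability density dominated by the likelihood ratio.\<close>
  define f where "f y = 1 - e + e * (lr d t y * ?lo y)" for y
  define G where "G x = (\<Prod>i=1..K. f (\<lambda>u. x (i, u)))" for x :: "nat \<times> nat \<Rightarrow> real"
  have f0: "0 \<le> f y" for y using e by (simp add: f_def)
  have f_mix: "mix e d t y = f y + e * (lr d t y * ?hi y)" for y
    by (auto simp: f_def mix_def split: split_indicator)
  have f_le: "f y \<le> mix e d t y" for y using e by (simp add: f_mix)
  have [simp]: "f (restrict y {1..t}) = f y" for y
    by (simp add: f_def indicator_def)
  have S [measurable]: "(\<lambda>y. \<Sum>u=1..t. y u :: real) \<in> borel_measurable (\<Pi>\<^sub>M u\<in>{1..t}. borel)"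
    by (rule borel_measurable_stream_sum) simp
  have lrm [measurable]: "lr d t \<in> borel_measurable (\<Pi>\<^sub>M u\<in>{1..t}. borel)"
    by (rule borel_measurable_lr) simp
  have ind [measurable]: "?lo \<in> borel_measurable (\<Pi>\<^sub>M u\<in>{1..t}. borel)"
    "?hi \<in> borel_measurable (\<Pi>\<^sub>M u\<in>{1..t}. borel)"
    unfolding indicator_def by measurable
  have fm [measurable]: "f \<in> borel_measurable (\<Pi>\<^sub>M u\<in>{1..t}. borel)"
    unfolding f_def by measurable
  note [measurable] = lrm[folded borel_measurable_noise_eq] ind[folded borel_measurable_noise_eq]
    fm[folded borel_measurable_noise_eq]
  have Gm [measurable]: "G \<in> borel_measurable (noise ?J)"
    unfolding G_def borel_measurable_noise_eq
  proof (rule borel_measurable_prod)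
    fix i assume i: "i \<in> {1..K}"
    have "(\<lambda>x. f (\<lambda>u\<in>{1..t}. x (i, u))) \<in> borel_measurable (\<Pi>\<^sub>M j\<in>?J. borel)"
      by (rule measurable_compose[OF measurable_restrict fm]) (measurable, use i in auto)
    moreover have "f (\<lambda>u\<in>{1..t}. x (i, u)) = f (\<lambda>u. x (i, u))" for x
      by (simp add: f_def lr_def indicator_def)
    ultimately show "(\<lambda>x. f (\<lambda>u. x (i, u))) \<in> borel_measurable (\<Pi>\<^sub>M j\<in>?J. borel)" by simp
  qed
  have LRm [measurable]: "likelihood_ratio K t e d \<in> borel_measurable (noise ?J)"
    unfolding borel_measurable_noise_eq by (rule borel_measurable_likelihood_ratio) simp
  have [measurable]: "B \<in> sets (noise ?J)" by (simp add: sets_noise)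
  have G0: "0 \<le> G x" for x unfolding G_def by (intro prod_nonneg) (simp add: f0)
  have GL: "G x \<le> likelihood_ratio K t e d x" for x
    unfolding G_def likelihood_ratio_eq_prod_mix by (intro prod_mono) (auto simp: f0 f_le)

  have intG: "(\<integral>\<^sup>+x. ennreal (G x) \<partial>noise ?J) = (\<integral>\<^sup>+y. ennreal (f y) \<partial>?N) ^ K"
    using nn_integral_noise_prod[of "\<lambda>y. ennreal (f y)" t K] by (simp add: G_def prod_ennreal f0)
  have intG2: "(\<integral>\<^sup>+x. ennreal ((G x)\<^sup>2) \<partial>noise ?J) = (\<integral>\<^sup>+y. ennreal ((f y)\<^sup>2) \<partial>?N) ^ K"
    using nn_integral_noise_prod[of "\<lambda>y. ennreal ((f y)\<^sup>2)" t K]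
    by (simp add: G_def prod_ennreal f0 prod_power_distrib)

  have "1 = (\<integral>\<^sup>+y. ennreal (mix e d t y) \<partial>?N)" using e by (simp add: nn_integral_mix)
  also have "\<dots> = (\<integral>\<^sup>+y. ennreal (f y) + ennreal e * (ennreal (lr d t y) * indicator {y. c < (\<Sum>u=1..t. y u)} y) \<partial>?N)"
    using e f0 by (intro nn_integral_cong)
      (auto simp: f_mix ennreal_mult' ennreal_plus split: split_indicator)
  also have "\<dots> = (\<integral>\<^sup>+y. ennreal (f y) \<partial>?N)
      + ennreal e * (\<integral>\<^sup>+y. ennreal (lr d t y) * indicator {y. c < (\<Sum>u=1..t. y u)} y \<partial>?N)"
    by (subst nn_integral_add) (auto simp: nn_integral_cmult)
  also have "\<dots> \<le> (\<integral>\<^sup>+y. ennreal (f y) \<partial>?N) + ennreal e * ennreal p"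
    by (intro add_left_mono mult_left_mono up) auto
  finally have "1 \<le> (\<integral>\<^sup>+y. ennreal (f y) \<partial>?N) + ennreal (e * p)"
    using e by (simp add: ennreal_mult')
  then have f_ge: "ennreal (1 - e * p) \<le> (\<integral>\<^sup>+y. ennreal (f y) \<partial>?N)"
    using e p by (cases "\<integral>\<^sup>+y. ennreal (f y) \<partial>?N") (auto simp flip: ennreal_plus ennreal_1 intro!: ennreal_leI)
  \<comment> \<open>Bernoulli's inequality acts as a union bound: each of the K rows loses mass at
    most e * p.\<close>
  have "1 - real K * e * p \<le> (1 - e * p) ^ K"
    using Bernoulli_inequality[of "- (e * p)" K] p(2) by (simp add: mult_ac)
  then have "ennreal (1 - real K * e * p) \<le> ennreal (1 - e * p) ^ K"
    using p by (simp add: ennreal_power ennreal_leI)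
  also have "\<dots> \<le> (\<integral>\<^sup>+x. ennreal (G x) \<partial>noise ?J)"
    unfolding intG by (intro power_mono f_ge) auto
  finally have G_ge: "ennreal (1 - real K * e * p) \<le> (\<integral>\<^sup>+x. ennreal (G x) \<partial>noise ?J)" .
  have "(\<integral>\<^sup>+x. ennreal (likelihood_ratio K t e d x - G x) \<partial>noise ?J)
      = (\<integral>\<^sup>+x. ennreal (likelihood_ratio K t e d x) - ennreal (G x) \<partial>noise ?J)"
    by (intro nn_integral_cong) (simp add: ennreal_minus G0)
  also have "\<dots> = (\<integral>\<^sup>+x. ennreal (likelihood_ratio K t e d x) \<partial>noise ?J) - (\<integral>\<^sup>+x. ennreal (G x) \<partial>noise ?J)"
  proof (rule nn_integral_diff)
    have "(\<integral>\<^sup>+x. ennreal (G x) \<partial>noise ?J) \<le> (\<integral>\<^sup>+x. ennreal (likelihood_ratio K t e d x) \<partial>noise ?J)"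
      by (intro nn_integral_mono ennreal_leI GL)
    also have "\<dots> = 1" using e by (simp add: nn_integral_likelihood_ratio)
    finally show "(\<integral>\<^sup>+x. ennreal (G x) \<partial>noise ?J) \<noteq> \<infinity>"
      by (auto simp: top_unique)
  qed (auto intro!: AE_I2 ennreal_leI GL)
  also have "\<dots> \<le> 1 - ennreal (1 - real K * e * p)"
    using e G_ge by (intro ennreal_minus_mono) (simp_all add: nn_integral_likelihood_ratio)
  also have "\<dots> \<le> ennreal (real K * e * p)"
    using e p by (cases "0 \<le> 1 - real K * e * p") (simp_all add: ennreal_minus ennreal_neg flip: ennreal_1)
  finally have diff: "(\<integral>\<^sup>+x. ennreal (likelihood_ratio K t e d x - G x) \<partial>noise ?J) \<le> ennreal (real K * e * p)" .

  have "(\<integral>\<^sup>+y. ennreal ((f y)\<^sup>2) \<partial>?N)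
      \<le> (\<integral>\<^sup>+y. ennreal ((1 - e)\<^sup>2) + (ennreal (2 * (1 - e) * e) * ennreal (lr d t y)
          + ennreal (e\<^sup>2) * (ennreal ((lr d t y)\<^sup>2) * indicator {y. (\<Sum>u=1..t. y u) \<le> c} y)) \<partial>?N)"
  proof (intro nn_integral_mono)
    fix y
    \<comment> \<open>The indicator is dropped in the cross term, where \<open>lr\<close> has mean
      1, and kept in the square, where it matters.\<close>
    have "(f y)\<^sup>2 \<le> (1 - e)\<^sup>2 + (2 * (1 - e) * e * lr d t y + e\<^sup>2 * ((lr d t y)\<^sup>2 * ?lo y))"
      using e by (auto simp: f_def power2_eq_square algebra_simps mult_left_mono split: split_indicator)
    then have "ennreal ((f y)\<^sup>2) \<le> ennreal ((1 - e)\<^sup>2 + (2 * (1 - e) * e * lr d t y + e\<^sup>2 * ((lr d t y)\<^sup>2 * ?lo y)))"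
      by (rule ennreal_leI)
    also have "\<dots> = ennreal ((1 - e)\<^sup>2) + (ennreal (2 * (1 - e) * e) * ennreal (lr d t y)
          + ennreal (e\<^sup>2) * (ennreal ((lr d t y)\<^sup>2) * indicator {y. (\<Sum>u=1..t. y u) \<le> c} y))"
      using e by (simp add: ennreal_mult' ennreal_plus ennreal_indicator)
    finally show "ennreal ((f y)\<^sup>2) \<le> \<dots>" .
  qed
  also have "\<dots> = ennreal ((1 - e)\<^sup>2) + (ennreal (2 * (1 - e) * e) * 1
      + ennreal (e\<^sup>2) * (\<integral>\<^sup>+y. ennreal ((lr d t y)\<^sup>2) * indicator {y. (\<Sum>u=1..t. y u) \<le> c} y \<partial>?N))"
    by (simp add: nn_integral_add nn_integral_cmult nn_integral_lr)
  also have "\<dots> \<le> ennreal ((1 - e)\<^sup>2) + (ennreal (2 * (1 - e) * e) * 1 + ennreal (e\<^sup>2) * ennreal q)"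
    by (intro add_left_mono mult_left_mono low) auto
  also have "\<dots> = ennreal ((1 - e)\<^sup>2 + 2 * (1 - e) * e + e\<^sup>2 * q)"
    using e q by (simp add: ennreal_plus[symmetric] ennreal_mult'[symmetric] add.assoc del: ennreal_plus)
  also have "\<dots> \<le> ennreal (exp (e\<^sup>2 * q))"
  proof (intro ennreal_leI)
    have "(1 - e)\<^sup>2 + 2 * (1 - e) * e + e\<^sup>2 * q = 1 - e\<^sup>2 + e\<^sup>2 * q"
      by (simp add: power2_eq_square algebra_simps)
    also have "\<dots> \<le> 1 + e\<^sup>2 * q" by simp
    also have "\<dots> \<le> exp (e\<^sup>2 * q)" by (rule exp_ge_add_one_self)
    finally show "(1 - e)\<^sup>2 + 2 * (1 - e) * e + e\<^sup>2 * q \<le> exp (e\<^sup>2 * q)" .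
  qed
  finally have "(\<integral>\<^sup>+x. ennreal ((G x)\<^sup>2) \<partial>noise ?J) \<le> ennreal (exp (e\<^sup>2 * q)) ^ K"
    unfolding intG2 by (intro power_mono) auto
  also have "\<dots> = ennreal (exp (real K * e\<^sup>2 * q))"
    by (simp add: ennreal_power exp_of_nat_mult[symmetric] mult_ac)
  finally have G2: "(\<integral>\<^sup>+x. ennreal ((G x)\<^sup>2) \<partial>noise ?J) \<le> ennreal (exp (real K * e\<^sup>2 * q))" .

  have "(\<integral>\<^sup>+x. ennreal (likelihood_ratio K t e d x) * indicator B x \<partial>noise ?J)
      \<le> (\<integral>\<^sup>+x. ennreal (likelihood_ratio K t e d x - G x) + ennreal L * indicator B x
          + ennreal ((G x)\<^sup>2) * ennreal (1 / L) \<partial>noise ?J)"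
  proof (intro nn_integral_mono)
    fix x
    \<comment> \<open>\<open>G\<close> is split at the level \<open>L\<close>: either it is at most
      \<open>L\<close>, or it is larger and its second moment pays.\<close>
    have "G x \<le> L + (G x)\<^sup>2 / L"
    proof (cases "G x \<le> L")
      case False
      then have "G x * L \<le> G x * G x" using G0[of x] by (intro mult_left_mono) auto
      then have "G x \<le> (G x)\<^sup>2 / L" using L by (simp add: pos_le_divide_eq power2_eq_square)
      then show ?thesis using L by simp
    qed (use L in \<open>simp add: add_increasing2\<close>)
    then have "likelihood_ratio K t e d x * indicator B x
        \<le> likelihood_ratio K t e d x - G x + L * indicator B x + (G x)\<^sup>2 * (1 / L)"
      using GL[of x] L by (auto split: split_indicator)
    then have "ennreal (likelihood_ratio K t e d x * indicator B x)
        \<le> ennreal (likelihood_ratio K t e d x - G x + L * indicator B x + (G x)\<^sup>2 * (1 / L))"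
      by (rule ennreal_leI)
    then show "ennreal (likelihood_ratio K t e d x) * indicator B x
        \<le> ennreal (likelihood_ratio K t e d x - G x) + ennreal L * indicator B x + ennreal ((G x)\<^sup>2) * ennreal (1 / L)"
      using GL[of x] L by (auto simp: ennreal_plus[symmetric] ennreal_mult'[symmetric] simp del: ennreal_plus split: split_indicator)
  qed
  also have "\<dots> = (\<integral>\<^sup>+x. ennreal (likelihood_ratio K t e d x - G x) \<partial>noise ?J)
      + ennreal L * emeasure (noise ?J) B + (\<integral>\<^sup>+x. ennreal ((G x)\<^sup>2) \<partial>noise ?J) * ennreal (1 / L)"
    by (simp add: nn_integral_add nn_integral_cmult nn_integral_multc)
  also have "\<dots> \<le> ennreal (real K * e * p) + ennreal L * emeasure (noise ?J) B
      + ennreal (exp (real K * e\<^sup>2 * q)) * ennreal (1 / L)"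
    by (intro add_mono mult_right_mono diff G2) auto
  also have "ennreal (exp (real K * e\<^sup>2 * q)) * ennreal (1 / L) = ennreal (exp (real K * e\<^sup>2 * q) / L)"
    by (simp add: ennreal_mult'[symmetric])
  finally show ?thesis .
qed

section \<open>The sum of all observations under the null and under mixtures\<close>

definition grand_total :: "nat \<Rightarrow> nat \<Rightarrow> (nat \<times> nat \<Rightarrow> real) \<Rightarrow> real" where
  "grand_total K s x = (\<Sum>i=1..K. \<Sum>u=1..s. x (i, u))"

lemma borel_measurable_grand_total:
  assumes "s \<le> t" shows "grand_total K s \<in> borel_measurable (\<Pi>\<^sub>M j\<in>{1..K} \<times> {1..t}. borel)"
  unfolding grand_total_def by measurable (use assms in auto)

lemma nn_integral_exp_grand_total:
  assumes s: "s \<le> t"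
  shows "(\<integral>\<^sup>+x. ennreal (exp (l * grand_total K s x)) \<partial>noise ({1..K} \<times> {1..t}))
    = ennreal (exp (real K * (real s * l\<^sup>2 / 2)))"
proof -
  have [measurable]: "(\<lambda>y. \<Sum>u=1..s. y u :: real) \<in> borel_measurable (\<Pi>\<^sub>M u\<in>{1..t}. borel)"
    by (rule borel_measurable_stream_sum[OF s])
  have "(\<integral>\<^sup>+x. ennreal (exp (l * grand_total K s x)) \<partial>noise ({1..K} \<times> {1..t}))
      = (\<integral>\<^sup>+x. (\<Prod>i=1..K. ennreal (exp (l * (\<Sum>u=1..s. x (i, u))))) \<partial>noise ({1..K} \<times> {1..t}))"
    by (simp add: grand_total_def sum_distrib_left[of l _ "{1..K}"] exp_sum prod_ennreal)
  also have "\<dots> = (\<integral>\<^sup>+y. ennreal (exp (l * (\<Sum>u=1..s. y u))) \<partial>noise {1..t}) ^ K"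
    using s by (intro nn_integral_noise_prod) auto
  also have "\<dots> = ennreal (exp (real K * (real s * l\<^sup>2 / 2)))"
    by (simp add: noise_mgf[OF s] ennreal_power exp_of_nat_mult[symmetric])
  finally show ?thesis .
qed

text \<open>The Laplace transform of the total under the mixture law, written as a null integral. A
  signal row gains the factor exp (- s * l * d) over a noise row, and 1 + x \<le> exp x turns the
  K-th power into an exponential.\<close>

lemma nn_integral_likelihood_ratio_exp_grand_total:
  assumes s: "s \<le> t" and e: "0 \<le> e" "e \<le> 1"
  shows "(\<integral>\<^sup>+x. ennreal (likelihood_ratio K s e d x * exp (- l * grand_total K s x)) \<partial>noise ({1..K} \<times> {1..t}))
    \<le> ennreal (exp (real K * (real s * l\<^sup>2 / 2 - e * (1 - exp (- real s * l * d)))))"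
proof -
  let ?g = "\<lambda>y. mix e d s y * exp (- l * (\<Sum>u=1..s. y u))"
  have [measurable]: "(\<lambda>y. \<Sum>u=1..s. y u :: real) \<in> borel_measurable (\<Pi>\<^sub>M u\<in>{1..t}. borel)"
      "mix e d s \<in> borel_measurable (\<Pi>\<^sub>M u\<in>{1..t}. borel)"
    by (auto intro: borel_measurable_stream_sum[OF s] borel_measurable_mix[OF s])
  have "(\<integral>\<^sup>+x. ennreal (likelihood_ratio K s e d x * exp (- l * grand_total K s x)) \<partial>noise ({1..K} \<times> {1..t}))
      = (\<integral>\<^sup>+x. (\<Prod>i=1..K. ennreal (?g (\<lambda>u. x (i, u)))) \<partial>noise ({1..K} \<times> {1..t}))"
  proof (intro nn_integral_cong)
    fix x :: "nat \<times> nat \<Rightarrow> real"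
    have "exp (- l * grand_total K s x) = (\<Prod>i=1..K. exp (- l * (\<Sum>u=1..s. x (i, u))))"
      unfolding grand_total_def sum_distrib_left[of "- l" _ "{1..K}"] by (simp add: exp_sum)
    then show "ennreal (likelihood_ratio K s e d x * exp (- l * grand_total K s x)) = (\<Prod>i=1..K. ennreal (?g (\<lambda>u. x (i, u))))"
      using e by (simp add: likelihood_ratio_eq_prod_mix prod.distrib prod_ennreal mix_nonneg)
  qed
  also have "\<dots> = (\<integral>\<^sup>+y. ennreal (?g y) \<partial>noise {1..t}) ^ K"
    using s by (intro nn_integral_noise_prod) (auto simp del: mult_minus_left)
  also have "(\<integral>\<^sup>+y. ennreal (?g y) \<partial>noise {1..t})
      = (\<integral>\<^sup>+y. ennreal (mix e d s y) * ennreal (exp (- l * (\<Sum>u=1..s. y u))) \<partial>noise {1..t})"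
    using e by (simp add: ennreal_mult' mix_nonneg)
  also have "\<dots> = ennreal (1 - e) * ennreal (exp (real s * (- l)\<^sup>2 / 2))
      + ennreal e * ennreal (exp (real s * ((d + - l)\<^sup>2 - d\<^sup>2) / 2))"
    using nn_integral_lr_exp[OF s, of d "- l"]
    by (subst nn_integral_mix_mult[OF e s]) (auto simp: noise_mgf[OF s, of "- l", simplified] ennreal_mult')
  also have "\<dots> = ennreal ((1 - e) * exp (real s * l\<^sup>2 / 2) + e * exp (real s * ((d - l)\<^sup>2 - d\<^sup>2) / 2))"
    using e by (simp add: ennreal_mult' ennreal_plus)
  also have "(1 - e) * exp (real s * l\<^sup>2 / 2) + e * exp (real s * ((d - l)\<^sup>2 - d\<^sup>2) / 2)
      = exp (real s * l\<^sup>2 / 2) * (1 + - (e * (1 - exp (- real s * l * d))))"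
  proof -
    have "real s * ((d - l)\<^sup>2 - d\<^sup>2) / 2 = real s * l\<^sup>2 / 2 + (- real s * l * d)"
      by (simp add: power2_eq_square algebra_simps diff_divide_distrib add_divide_distrib)
    then have "exp (real s * ((d - l)\<^sup>2 - d\<^sup>2) / 2) = exp (real s * l\<^sup>2 / 2) * exp (- real s * l * d)"
      by (simp only: exp_add)
    then show ?thesis by (simp add: algebra_simps)
  qed
  also have "ennreal (exp (real s * l\<^sup>2 / 2) * (1 + - (e * (1 - exp (- real s * l * d))))) ^ K
      \<le> ennreal (exp (real s * l\<^sup>2 / 2) * exp (- (e * (1 - exp (- real s * l * d))))) ^ K"
    by (intro power_mono ennreal_leI mult_left_mono exp_ge_add_one_self) auto
  also have "\<dots> = ennreal (exp (real K * (real s * l\<^sup>2 / 2 - e * (1 - exp (- real s * l * d)))))"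
    by (simp add: ennreal_power exp_add[symmetric] exp_of_nat_mult[symmetric])
  finally show ?thesis .
qed

text \<open>The total serves as a test. If it is at least c, a Chernoff bound under the null pays.
  If it is below c, a component marked by \<open>H\<close> contributes at most the Chernoff bound
  for so small a total under the component itself, which \<open>head\<close> makes at most b. The
  unmarked components have null mean 1 each and are paid by their share of \<open>G\<close>.\<close>

lemma noise_mixture_ge:
  fixes G :: "(real \<times> real) set" and H :: "real \<times> real \<Rightarrow> bool"
  assumes s: "s \<le> t" and G: "finite G" "G \<noteq> {}" and e: "\<And>e d. (e, d) \<in> G \<Longrightarrow> 0 \<le> e \<and> e \<le> 1"
    and l: "0 \<le> l" and b0: "0 < b"
    and head: "\<And>e d. (e, d) \<in> G \<Longrightarrow> H (e, d) \<Longrightarrow>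
      l * c + real K * (real s * l\<^sup>2 / 2 - e * (1 - exp (- real s * l * d))) \<le> ln b"
  shows "measure (noise ({1..K} \<times> {1..t}))
      {x \<in> space (noise ({1..K} \<times> {1..t})). 1 \<le> 1 / real (card G) * (\<Sum>(e, d)\<in>G. likelihood_ratio K s e d x)}
    \<le> exp (- l * c + real K * (real s * l\<^sup>2 / 2)) + 2 * b + 2 * (real (card {g \<in> G. \<not> H g}) / real (card G))"
proof -
  let ?J = "{1..K} \<times> {1..t}"
  let ?LR = "\<lambda>g x. likelihood_ratio K s (fst g) (snd g) x"
  define N where "N = real (card G)"
  define T where "T = {g \<in> G. \<not> H g}"
  define D where "D = {g \<in> G. H g}"
  interpret prob_space "noise ?J" by (rule prob_space_noise)
  have b: "0 \<le> b" using b0 by simp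
  have N: "0 < N" using G by (simp add: N_def card_gt_0_iff)
  have fin: "finite T" "finite D" using G by (auto simp: T_def D_def)
  have [measurable]: "likelihood_ratio K s e d \<in> borel_measurable (noise ?J)" for e d
    unfolding borel_measurable_noise_eq by (rule borel_measurable_likelihood_ratio[OF s])
  have [measurable]: "grand_total K s \<in> borel_measurable (noise ?J)"
    unfolding borel_measurable_noise_eq by (rule borel_measurable_grand_total[OF s])
  let ?B = "{x \<in> space (noise ?J). 1 \<le> 1 / real (card G) * (\<Sum>(e, d)\<in>G. likelihood_ratio K s e d x)}"
  have Bm: "?B \<in> sets (noise ?J)" by measurable
  have LR0: "0 \<le> ?LR g x" if "g \<in> G" for g x
    using e[of "fst g" "snd g"] that by (auto intro: likelihood_ratio_nonneg)
  have pt: "indicator ?B x \<le> exp (- l * c) * exp (l * grand_total K s x)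
      + (2 / N) * (\<Sum>g\<in>D. exp (l * c) * (?LR g x * exp (- l * grand_total K s x)))
      + (2 / N) * (\<Sum>g\<in>T. ?LR g x)" (is "_ \<le> ?a + ?h + ?u") for x
  proof (cases "x \<in> ?B")
    case True
    have a: "0 \<le> ?a" by simp
    have h: "0 \<le> ?h" using N LR0 by (intro mult_nonneg_nonneg sum_nonneg) (auto simp: D_def)
    have u: "0 \<le> ?u" using N LR0 by (intro mult_nonneg_nonneg sum_nonneg) (auto simp: T_def)
    show ?thesis
    proof (cases "c \<le> grand_total K s x")
      case True
      then have "1 \<le> ?a" using l by (simp add: exp_add[symmetric] mult_left_mono)
      moreover have "indicator ?B x \<le> (1::real)" by (simp add: indicator_def)
      ultimately show ?thesis using h u by linarith
    next
      case False
      have sum: "(\<Sum>(e, d)\<in>G. likelihood_ratio K s e d x) = (\<Sum>g\<in>D. ?LR g x) + (\<Sum>g\<in>T. ?LR g x)"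
      proof -
        have "G = D \<union> T" by (auto simp: D_def T_def)
        moreover have "D \<inter> T = {}" by (auto simp: D_def T_def)
        ultimately show ?thesis using fin by (simp add: sum.union_disjoint case_prod_beta)
      qed
      \<comment> \<open>Below c the inserted factor exp (l * (c - total)) is at least 1; with it the
        null integral becomes the Laplace transform of the total under the component.\<close>
      have "(\<Sum>g\<in>D. ?LR g x * 1) \<le> (\<Sum>g\<in>D. ?LR g x * (exp (l * c) * exp (- l * grand_total K s x)))"
        using False l LR0
        by (intro sum_mono mult_left_mono) (auto simp: D_def exp_add[symmetric] mult_left_mono)
      then have "(\<Sum>g\<in>D. ?LR g x) \<le> (\<Sum>g\<in>D. exp (l * c) * (?LR g x * exp (- l * grand_total K s x)))"
        by (simp add: mult_ac)
      then have "(\<Sum>(e, d)\<in>G. likelihood_ratio K s e d x)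
          \<le> (\<Sum>g\<in>D. exp (l * c) * (?LR g x * exp (- l * grand_total K s x))) + (\<Sum>g\<in>T. ?LR g x)"
        unfolding sum by simp
      then have "1 / N * (\<Sum>(e, d)\<in>G. likelihood_ratio K s e d x) \<le> 1 / N *
          ((\<Sum>g\<in>D. exp (l * c) * (?LR g x * exp (- l * grand_total K s x))) + (\<Sum>g\<in>T. ?LR g x))"
        using N by (intro mult_left_mono) auto
      also have "\<dots> = (?h + ?u) / 2" by (simp add: ring_distribs add_divide_distrib)
      finally have "1 / N * (\<Sum>(e, d)\<in>G. likelihood_ratio K s e d x) \<le> (?h + ?u) / 2" .
      moreover have "1 \<le> 1 / N * (\<Sum>(e, d)\<in>G. likelihood_ratio K s e d x)"
        using True unfolding N_def by blast
      ultimately have "1 \<le> (?h + ?u) / 2" by (rule order_trans[rotated])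
      moreover have "indicator ?B x = (1::real)" using True by (rule indicator_simps)
      moreover have "i \<le> a + h + u" if "1 \<le> (h + u) / 2" "i = 1" "0 \<le> a" for a h u i :: real
        using that by simp
      ultimately show ?thesis using a by blast
    qed
  next
    case False
    have "0 \<le> ?h" using N LR0 by (intro mult_nonneg_nonneg sum_nonneg) (auto simp: D_def)
    moreover have "0 \<le> ?u" using N LR0 by (intro mult_nonneg_nonneg sum_nonneg) (auto simp: T_def)
    moreover have "0 \<le> ?a" by simp
    ultimately show ?thesis using False by (simp del: mult_minus_left)
  qed
  have "emeasure (noise ?J) ?B = (\<integral>\<^sup>+x. ennreal (indicator ?B x) \<partial>noise ?J)"
    using Bm by (simp add: ennreal_indicator)
  also have "\<dots> \<le> (\<integral>\<^sup>+x. ennreal (exp (- l * c)) * ennreal (exp (l * grand_total K s x))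
      + ennreal (2 / N) * (\<Sum>g\<in>D. ennreal (exp (l * c)) * ennreal (?LR g x * exp (- l * grand_total K s x)))
      + ennreal (2 / N) * (\<Sum>g\<in>T. ennreal (?LR g x)) \<partial>noise ?J)"
  proof (intro nn_integral_mono)
    fix x
    have D: "(\<Sum>g\<in>D. ennreal (exp (l * c)) * ennreal (?LR g x * exp (- l * grand_total K s x)))
        = ennreal (\<Sum>g\<in>D. exp (l * c) * (?LR g x * exp (- l * grand_total K s x)))"
      unfolding ennreal_mult'[OF exp_ge_zero, symmetric]
      by (intro sum_ennreal) (auto intro!: mult_nonneg_nonneg LR0 simp: D_def)
    have T: "(\<Sum>g\<in>T. ennreal (?LR g x)) = ennreal (\<Sum>g\<in>T. ?LR g x)"
      by (intro sum_ennreal) (auto intro!: LR0 simp: T_def)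
    have pos: "0 \<le> (\<Sum>g\<in>D. exp (l * c) * (?LR g x * exp (- l * grand_total K s x)))"
      "0 \<le> (\<Sum>g\<in>T. ?LR g x)"
      using LR0 by (auto intro!: mult_nonneg_nonneg sum_nonneg simp: D_def T_def)
    have ennreal_distr: "ennreal (a * b + n * h + n * u)
        = ennreal a * ennreal b + ennreal n * ennreal h + ennreal n * ennreal u"
      if "0 \<le> a" "0 \<le> b" "0 \<le> n" "0 \<le> h" "0 \<le> u" for a b n h u :: real
      using that by (simp add: ennreal_plus ennreal_mult')
    have "ennreal (indicator ?B x) \<le> ennreal (exp (- l * c) * exp (l * grand_total K s x)
      + (2 / N) * (\<Sum>g\<in>D. exp (l * c) * (?LR g x * exp (- l * grand_total K s x)))
      + (2 / N) * (\<Sum>g\<in>T. ?LR g x))"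
      by (rule ennreal_leI[OF pt])
    also have "\<dots> = ennreal (exp (- l * c)) * ennreal (exp (l * grand_total K s x))
      + ennreal (2 / N) * (\<Sum>g\<in>D. ennreal (exp (l * c)) * ennreal (?LR g x * exp (- l * grand_total K s x)))
      + ennreal (2 / N) * (\<Sum>g\<in>T. ennreal (?LR g x))"
      unfolding D T using pos N by (intro ennreal_distr) auto
    finally show "ennreal (indicator ?B x) \<le> \<dots>" .
  qed
  also have "\<dots> = ennreal (exp (- l * c)) * (\<integral>\<^sup>+x. ennreal (exp (l * grand_total K s x)) \<partial>noise ?J)
      + ennreal (2 / N) * (\<Sum>g\<in>D. ennreal (exp (l * c)) *
          (\<integral>\<^sup>+x. ennreal (?LR g x * exp (- l * grand_total K s x)) \<partial>noise ?J))
      + ennreal (2 / N) * (\<Sum>g\<in>T. \<integral>\<^sup>+x. ennreal (?LR g x) \<partial>noise ?J)"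
    by (simp add: nn_integral_add nn_integral_cmult nn_integral_sum)
  also have "\<dots> \<le> ennreal (exp (- l * c)) * ennreal (exp (real K * (real s * l\<^sup>2 / 2)))
      + ennreal (2 / N) * (\<Sum>g\<in>D. ennreal b) + ennreal (2 / N) * (\<Sum>g\<in>T. 1)"
  proof (intro add_mono mult_left_mono sum_mono)
    fix g assume g: "g \<in> D"
    obtain e' d' where g': "g = (e', d')" by (cases g)
    have "ennreal (exp (l * c)) * (\<integral>\<^sup>+x. ennreal (?LR g x * exp (- l * grand_total K s x)) \<partial>noise ?J)
        \<le> ennreal (exp (l * c)) * ennreal (exp (real K * (real s * l\<^sup>2 / 2 - e' * (1 - exp (- real s * l * d')))))"
      using e[of e' d'] g g' unfolding g' fst_conv snd_conv
      by (intro mult_left_mono nn_integral_likelihood_ratio_exp_grand_total s) (auto simp: D_def)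
    also have "\<dots> = ennreal (exp (l * c + real K * (real s * l\<^sup>2 / 2 - e' * (1 - exp (- real s * l * d')))))"
      by (simp add: ennreal_mult'[symmetric] exp_add)
    also have "\<dots> \<le> ennreal (exp (ln b))"
      using head[of e' d'] g g' by (intro ennreal_leI) (auto simp: D_def)
    also have "\<dots> = ennreal b" using b0 by simp
    finally show "ennreal (exp (l * c)) * (\<integral>\<^sup>+x. ennreal (?LR g x * exp (- l * grand_total K s x)) \<partial>noise ?J) \<le> ennreal b" .
  next
    fix g assume "g \<in> T"
    then show "(\<integral>\<^sup>+x. ennreal (?LR g x) \<partial>noise ?J) \<le> 1"
      using e[of "fst g" "snd g"] s by (auto simp: T_def nn_integral_likelihood_ratio)
  qed (auto simp: nn_integral_exp_grand_total[OF s])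
  also have "\<dots> = ennreal (exp (- l * c + real K * (real s * l\<^sup>2 / 2)) + 2 / N * (real (card D) * b) + 2 / N * real (card T))"
    using N b by (simp add: ennreal_mult'[symmetric] exp_add[symmetric] ennreal_plus[symmetric]
        ennreal_of_nat_eq_real_of_nat del: ennreal_plus)
  also have "\<dots> \<le> ennreal (exp (- l * c + real K * (real s * l\<^sup>2 / 2)) + 2 * b + 2 * (real (card T) / N))"
  proof (intro ennreal_leI add_mono order_refl)
    have "real (card D) \<le> N" using G by (auto simp: N_def D_def intro: card_mono)
    then have "real (card D) * b \<le> N * b" using b by (intro mult_right_mono)
    then show "2 / N * (real (card D) * b) \<le> 2 * b" using N by (simp add: field_simps)
  qed simp
  finally show ?thesis
    unfolding emeasure_eq_measure N_def[symmetric] T_def[symmetric]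
    using N b by (subst (asm) ennreal_le_iff) (auto intro!: add_nonneg_nonneg)
qed

section \<open>The grid\<close>

definition levels :: "nat \<Rightarrow> nat" where
  "levels K = nat \<lceil>(ln (real K))\<^sup>2\<rceil>"

text \<open>The sparsities of the grid form the geometric progression
  \<open>grid_ratio K ^ i / sqrt (real K)\<close>. The ratio differs from 1 by an amount of order 1
  / ln K, and the last term is 1 / K.\<close>

definition grid_ratio :: "nat \<Rightarrow> real" where
  "grid_ratio K = exp (- ln (real K) / (2 * real (levels K)))"

lemma ln_ge_1: "3 \<le> K \<Longrightarrow> 1 \<le> ln (real K)"
  using exp_le by (subst ln_ge_iff) (auto intro: order_trans)

lemma levels_ge: "(ln (real K))\<^sup>2 \<le> real (levels K)"
  unfolding levels_def by (meson of_nat_ceiling)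

lemma levels_le: "real (levels K) \<le> (ln (real K))\<^sup>2 + 1"
proof -
  have "- 1 < (ln (real K))\<^sup>2" by (rule less_le_trans[of _ 0]) auto
  then have "0 \<le> \<lceil>(ln (real K))\<^sup>2\<rceil>" by simp
  then show ?thesis unfolding levels_def using ceiling_correct[of "(ln (real K))\<^sup>2"] by simp
qed

lemma of_int_levels: "\<lceil>(ln (real K))\<^sup>2\<rceil> = int (levels K)"
proof -
  have "- 1 < (ln (real K))\<^sup>2" by (rule less_le_trans[of _ 0]) auto
  then show ?thesis by (simp add: levels_def)
qed

lemma levels_pos: "3 \<le> K \<Longrightarrow> 0 < levels K"
proof -
  assume "3 \<le> K"
  then have "1\<^sup>2 \<le> (ln (real K))\<^sup>2" by (intro power_mono ln_ge_1) auto
  then show ?thesis using levels_ge[of K] by simp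
qed

lemma powr_grid_beta:
  assumes "3 \<le> K"
  shows "real K powr (- grid_beta K (int i)) = grid_ratio K ^ i / sqrt (real K)"
proof -
  have "ln (real K) * (- grid_beta K (int i)) = real i * (- ln (real K) / (2 * real (levels K))) - ln (real K) / 2"
    using levels_pos[OF assms] by (simp add: grid_beta_def of_int_levels field_simps)
  then have "real K powr (- grid_beta K (int i)) = exp (real i * (- ln (real K) / (2 * real (levels K))) - ln (real K) / 2)"
    using assms by (simp add: powr_def mult.commute)
  also have "\<dots> = grid_ratio K ^ i / exp (ln (real K) / 2)"
    unfolding exp_diff grid_ratio_def exp_of_nat_mult by simp
  also have "exp (ln (real K) / 2) = sqrt (real K)"
    using assms by (simp add: powr_half_sqrt[symmetric] powr_def)
  finally show ?thesis .
qed

lemma grid_eps_eq: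
  assumes "3 \<le> K"
  shows "grid_eps K = (\<lambda>i. grid_ratio K ^ i / sqrt (real K)) ` {1..levels K}"
proof -
  have "{1..int (levels K)} = int ` {1..levels K}"
    by (simp add: image_int_atLeastAtMost)
  then show ?thesis
    using powr_grid_beta[OF assms] by (simp add: grid_eps_def of_int_levels image_image)
qed

lemma grid_ratio_bounds:
  assumes "3 \<le> K"
  shows "0 < grid_ratio K" "grid_ratio K < 1" "exp (- 1 / (2 * ln (real K))) \<le> grid_ratio K"
    "grid_ratio K ^ levels K = 1 / sqrt (real K)"
proof -
  have ln: "1 \<le> ln (real K)" by (rule ln_ge_1[OF assms])
  have lev: "0 < real (levels K)" using levels_pos[OF assms] by simp
  show "0 < grid_ratio K" by (simp add: grid_ratio_def)
  show "grid_ratio K < 1" using ln lev by (simp add: grid_ratio_def)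
  have "ln (real K) / real (levels K) \<le> ln (real K) / (ln (real K))\<^sup>2"
    using ln lev levels_ge[of K] by (intro divide_left_mono mult_pos_pos zero_less_power) auto
  also have "\<dots> = 1 / ln (real K)" by (simp add: power2_eq_square)
  finally show "exp (- 1 / (2 * ln (real K))) \<le> grid_ratio K"
    unfolding grid_ratio_def by (simp add: field_simps)
  have "grid_ratio K ^ levels K = exp (- ln (real K) / 2)"
    using lev unfolding grid_ratio_def exp_of_nat_mult[symmetric] by simp
  also have "\<dots> = 1 / sqrt (real K)"
    using assms by (simp add: powr_half_sqrt[symmetric] powr_def exp_minus field_simps)
  finally show "grid_ratio K ^ levels K = 1 / sqrt (real K)" .
qed

lemma inj_grid_ratio:
  assumes "3 \<le> K"
  shows "inj_on (\<lambda>i. grid_ratio K ^ i / sqrt (real K)) {1..levels K}"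
proof (rule inj_onI)
  fix i j assume "grid_ratio K ^ i / sqrt (real K) = grid_ratio K ^ j / sqrt (real K)"
  then have "grid_ratio K ^ i = grid_ratio K ^ j" using assms by simp
  then show "i = j"
    using grid_ratio_bounds(1,2)[OF assms]
    by (metis linorder_neqE_nat order_less_irrefl power_strict_decreasing)
qed

lemma grid_eps_bounds:
  assumes "3 \<le> K" "e \<in> grid_eps K"
  shows "0 < e" "e < 1" "e * sqrt (real K) \<le> 1"
proof -
  obtain i where i: "e = grid_ratio K ^ i / sqrt (real K)"
    using assms grid_eps_eq[OF assms(1)] by auto
  have K: "1 < sqrt (real K)" using assms by simp
  have q: "0 < grid_ratio K ^ i" "grid_ratio K ^ i \<le> 1"
    using grid_ratio_bounds[OF assms(1)] by (auto intro: power_le_one)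
  show "0 < e" "e * sqrt (real K) \<le> 1" using q K by (auto simp: i)
  have "e = grid_ratio K ^ i / sqrt (real K)" by (rule i)
  also have "\<dots> < 1"
  proof -
    have "grid_ratio K ^ i < sqrt (real K)" using q(2) K by (rule le_less_trans)
    then show ?thesis using K by (simp add: divide_less_eq)
  qed
  finally show "e < 1" .
qed

lemma card_grid_delta:
  assumes K: "3 \<le> K" and C: "1 < C" and e: "0 < e"
  shows "card (grid_delta K C e) = nat \<lceil>e * real K\<rceil> * nat \<lceil>ln C\<rceil>"
proof -
  define N where "N = real_of_int \<lceil>e * real K\<rceil>"
  have N: "0 < N" using K e by (simp add: N_def)
  have "inj_on (\<lambda>i. sqrt (2 * ln (real K) / exp (real_of_int i / N))) {1..\<lceil>e * real K\<rceil> * \<lceil>ln C\<rceil>}"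
    using ln_ge_1[OF K] N by (intro inj_onI) simp
  then have "card (grid_delta K C e) = card {1..\<lceil>e * real K\<rceil> * \<lceil>ln C\<rceil>}"
    unfolding grid_delta_def N_def by (rule card_image)
  then show ?thesis using N C by (simp add: N_def nat_mult_distrib)
qed

lemma finite_grid_delta: "finite (grid_delta K C e)"
  by (simp add: grid_delta_def)

lemma finite_grid_eps: "finite (grid_eps K)"
  by (simp add: grid_eps_def)

lemma grid_eq_Sigma: "grid K C = Sigma (grid_eps K) (grid_delta K C)"
  by (auto simp: grid_def)

lemma finite_grid: "finite (grid K C)"
  unfolding grid_eq_Sigma by (intro finite_SigmaI finite_grid_delta finite_grid_eps)

text \<open>The number of signals at sparsity e is the ceiling of e * K times a constant, and e * K
  is sqrt K times a power of the ratio. Up to rounding, the uniform law on the grid thus weights the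
  levels geometrically.\<close>

lemma card_grid_weights:
  assumes K: "3 \<le> K" and C: "1 < C"
  shows "real (card {g \<in> grid K C. P (fst g)})
    = (\<Sum>i\<in>{i \<in> {1..levels K}. P (grid_ratio K ^ i / sqrt (real K))}.
        real (nat \<lceil>sqrt (real K) * grid_ratio K ^ i\<rceil>)) * real (nat \<lceil>ln C\<rceil>)"
proof -
  let ?e = "\<lambda>i. grid_ratio K ^ i / sqrt (real K)"
  let ?I = "{i \<in> {1..levels K}. P (?e i)}"
  have "{g \<in> grid K C. P (fst g)} = Sigma {e \<in> grid_eps K. P e} (grid_delta K C)"
    by (auto simp: grid_eq_Sigma)
  then have "card {g \<in> grid K C. P (fst g)} = (\<Sum>e\<in>{e \<in> grid_eps K. P e}. card (grid_delta K C e))"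
    by (simp add: card_SigmaI finite_grid_eps finite_grid_delta)
  also have "{e \<in> grid_eps K. P e} = ?e ` ?I" by (auto simp: grid_eps_eq[OF K])
  also have "(\<Sum>e\<in>?e ` ?I. card (grid_delta K C e)) = (\<Sum>i\<in>?I. card (grid_delta K C (?e i)))"
    by (subst sum.reindex) (auto intro: inj_on_subset[OF inj_grid_ratio[OF K]])
  also have "\<dots> = (\<Sum>i\<in>?I. nat \<lceil>sqrt (real K) * grid_ratio K ^ i\<rceil> * nat \<lceil>ln C\<rceil>)"
  proof (intro sum.cong refl)
    fix i assume "i \<in> ?I"
    have "0 < ?e i" using grid_ratio_bounds[OF K] K by simp
    moreover have "?e i * real K = sqrt (real K) * grid_ratio K ^ i"
      using real_sqrt_mult_self[of "real K"] K by (simp add: field_simps)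
    ultimately show "card (grid_delta K C (?e i)) = nat \<lceil>sqrt (real K) * grid_ratio K ^ i\<rceil> * nat \<lceil>ln C\<rceil>"
      using card_grid_delta[OF K C] by simp
  qed
  finally show ?thesis by (simp add: sum_distrib_right)
qed

text \<open>All exponents in \<open>A\<close> are at least the least one, so the sum is below a full
  geometric tail whose first term is less than k.\<close>

lemma sum_geometric_lt:
  fixes q :: real
  assumes q: "0 < q" "q < 1" and k: "0 \<le> k" and A: "finite A" "\<And>i. i \<in> A \<Longrightarrow> q ^ i < k"
  shows "(\<Sum>i\<in>A. q ^ i) \<le> k / (1 - q)"
proof (cases "A = {}")
  case False
  define m where "m = Min A"
  have m: "m \<in> A" using A False by (simp add: m_def)
  have "(\<Sum>i\<in>A. q ^ i) \<le> (\<Sum>i\<in>{m..Max A}. q ^ i)"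
    using A q by (intro sum_mono2) (auto simp: m_def)
  also have "\<dots> \<le> q ^ m / (1 - q)"
    using q m A by (subst sum_gp) (auto simp: divide_right_mono)
  also have "\<dots> \<le> k / (1 - q)" using A(2)[OF m] q by (intro divide_right_mono) auto
  finally show ?thesis .
qed (use q k in simp)

text \<open>The geometric tail starting below k is compared with the whole progression, and the
  common factor r / (1 - q) cancels. Rounding up adds at most 1 per level, in total at most (ln K)^2
  + 1, which is negligible against r = sqrt K.\<close>

lemma grid_tail_fraction:
  assumes K: "3 \<le> K" and C: "1 < C" and k: "0 \<le> k"
  shows "real (card {g \<in> grid K C. \<not> k \<le> fst g * sqrt (real K)}) / real (card (grid K C))
    \<le> (k + ((ln (real K))\<^sup>2 + 1) / sqrt (real K)) / (exp (- 1 / (2 * ln (real K))) * (1 - 1 / sqrt (real K)))"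
proof -
  define q where "q = grid_ratio K"
  define D where "D = real (nat \<lceil>ln C\<rceil>)"
  define r where "r = sqrt (real K)"
  let ?I = "{i \<in> {1..levels K}. q ^ i < k}"
  have q: "0 < q" "q < 1" "exp (- 1 / (2 * ln (real K))) \<le> q" "q ^ levels K = 1 / r"
    using grid_ratio_bounds[OF K] by (simp_all add: q_def r_def)
  have r: "1 < r" using K by (simp add: r_def)
  have D: "0 < D" using C by (simp add: D_def)
  have "real (card {g \<in> grid K C. \<not> k \<le> fst g * r}) = (\<Sum>i\<in>?I. real (nat \<lceil>r * q ^ i\<rceil>)) * D"
    using card_grid_weights[OF K C, of "\<lambda>e. \<not> k \<le> e * r"] r
    by (simp add: q_def D_def r_def[symmetric] not_le)
  also have "(\<Sum>i\<in>?I. real (nat \<lceil>r * q ^ i\<rceil>)) \<le> (\<Sum>i\<in>?I. r * q ^ i + 1)"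
  proof (intro sum_mono)
    fix i
    have "0 \<le> r * q ^ i" using q r by simp
    then show "real (nat \<lceil>r * q ^ i\<rceil>) \<le> r * q ^ i + 1" by linarith
  qed
  also have "\<dots> = r * (\<Sum>i\<in>?I. q ^ i) + real (card ?I)" by (simp add: sum.distrib sum_distrib_left)
  also have "\<dots> \<le> r * (k / (1 - q)) + ((ln (real K))\<^sup>2 + 1)"
  proof (intro add_mono mult_left_mono sum_geometric_lt q k)
    have "card ?I \<le> card {1..levels K}" by (intro card_mono) auto
    then show "real (card ?I) \<le> (ln (real K))\<^sup>2 + 1" using levels_le[of K] by simp
  qed (use r in auto)
  finally have num: "real (card {g \<in> grid K C. \<not> k \<le> fst g * r})
      \<le> (r * (k / (1 - q)) + ((ln (real K))\<^sup>2 + 1)) * D" using D by simp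
  \<comment> \<open>The progression ends at q ^ levels K = 1 / r, so almost the full geometric
    series is present.\<close>
  have "r * (q * (1 - 1 / r) / (1 - q)) = (\<Sum>i\<in>{1..levels K}. r * q ^ i)"
    using q levels_pos[OF K] unfolding sum_distrib_left[symmetric]
    by (subst sum_gp) (auto simp: algebra_simps)
  also have "\<dots> \<le> (\<Sum>i\<in>{1..levels K}. real (nat \<lceil>r * q ^ i\<rceil>))"
    by (intro sum_mono) (simp add: of_nat_ceiling)
  finally have "r * (q * (1 - 1 / r) / (1 - q)) * D \<le> (\<Sum>i\<in>{1..levels K}. real (nat \<lceil>r * q ^ i\<rceil>)) * D"
    using D by (intro mult_right_mono) auto
  also have "\<dots> = real (card (grid K C))"
    using card_grid_weights[OF K C, of "\<lambda>_. True"]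
    unfolding simp_thms Collect_mem_eq q_def[symmetric] D_def[symmetric] r_def[symmetric] by simp
  finally have "r * (q * (1 - 1 / r) / (1 - q)) * D \<le> real (card (grid K C))" .
  then have den: "r / (1 - q) * D * (q * (1 - 1 / r)) \<le> real (card (grid K C))"
    by (simp add: mult_ac)
  have Q: "0 < r / (1 - q) * D" using r q D by simp
  have "real (card {g \<in> grid K C. \<not> k \<le> fst g * r}) / real (card (grid K C))
      \<le> ((r * (k / (1 - q)) + ((ln (real K))\<^sup>2 + 1)) * D) / (r / (1 - q) * D * (q * (1 - 1 / r)))"
    using num den Q q r k D by (intro frac_le) (auto intro!: mult_nonneg_nonneg mult_pos_pos)
  also have "(r * (k / (1 - q)) + ((ln (real K))\<^sup>2 + 1)) * D
      = r / (1 - q) * D * (k + ((ln (real K))\<^sup>2 + 1) / r * (1 - q))"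
    using q r by (simp add: field_simps)
  also have "\<dots> / (r / (1 - q) * D * (q * (1 - 1 / r)))
      = (k + ((ln (real K))\<^sup>2 + 1) / r * (1 - q)) / (q * (1 - 1 / r))"
    using Q by (intro mult_divide_mult_cancel_left) auto
  also have "\<dots> \<le> (k + ((ln (real K))\<^sup>2 + 1) / r) / (exp (- 1 / (2 * ln (real K))) * (1 - 1 / r))"
    using q r k by (intro frac_le add_left_mono mult_right_mono mult_left_le add_nonneg_nonneg) auto
  finally show ?thesis unfolding r_def .
qed

section \<open>Signal sizes and the martingale under the null\<close>

lemma grid_delta_bounds:
  assumes K: "3 \<le> K" and C: "1 < C" and e: "0 < e" and d: "d \<in> grid_delta K C e"
  shows "sqrt (2 * ln (real K) / exp (real_of_int \<lceil>ln C\<rceil>)) \<le> d" "d \<le> sqrt (2 * ln (real K))"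
proof -
  define N where "N = real_of_int \<lceil>e * real K\<rceil>"
  obtain i where i: "1 \<le> i" "i \<le> \<lceil>e * real K\<rceil> * \<lceil>ln C\<rceil>"
    and d: "d = sqrt (2 * ln (real K) / exp (real_of_int i / N))"
    using d by (auto simp: grid_delta_def N_def)
  have N: "0 < N" using K e by (simp add: N_def)
  have L: "0 \<le> ln (real K)" using ln_ge_1[OF K] by simp
  have "real_of_int i \<le> real_of_int (\<lceil>e * real K\<rceil> * \<lceil>ln C\<rceil>)" using i(2) by (simp only: of_int_le_iff)
  then have "real_of_int i / N \<le> real_of_int \<lceil>ln C\<rceil>" using N by (simp add: N_def field_simps)
  then show "sqrt (2 * ln (real K) / exp (real_of_int \<lceil>ln C\<rceil>)) \<le> d"
    unfolding d using L by (intro real_sqrt_le_mono divide_left_mono) auto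
  have "1 \<le> exp (real_of_int i / N)" using N i by simp
  then have "2 * ln (real K) / exp (real_of_int i / N) \<le> 2 * ln (real K) / 1"
    using L by (intro divide_left_mono) auto
  then show "d \<le> sqrt (2 * ln (real K))" unfolding d by simp
qed

lemma one_minus_exp_ge:
  assumes "0 \<le> x" "x \<le> (1::real)" shows "x / 2 \<le> 1 - exp (- x)"
proof -
  have "1 + x \<le> exp x" by (rule exp_ge_add_one_self)
  then have "exp (- x) \<le> 1 / (1 + x)" using assms by (simp add: exp_minus field_simps)
  also have "\<dots> \<le> 1 - x / 2"
  proof -
    have "x * x \<le> x * 1" using assms by (intro mult_left_mono) auto
    then show ?thesis using assms by (simp add: field_simps)
  qed
  finally show ?thesis by simp
qed

text \<open>
  The grid is concentrated on sparsities \<open>\<beta>\<close> within \<open>O(ln (ln K) / ln K)\<close> of \<open>1 / 2\<close>, where the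
  sum of all observations separates the alternatives from the null; so the martingale
  vanishes under the null instead of merely being bounded in probability.
\<close>

lemma noise_adaptive_martingale_le:
  assumes K: "3 \<le> K" and C: "1 < C" and s: "1 \<le> s" "s \<le> t"
    and small: "real s * sqrt (2 * ln (real K)) \<le> sqrt (real K)"
  defines "c1 \<equiv> sqrt (2 / exp (real_of_int \<lceil>ln C\<rceil>)) / 2"
  shows "measure (noise ({1..K} \<times> {1..t}))
      {x \<in> space (noise ({1..K} \<times> {1..t})). 1 \<le> adaptive_martingale K C s x}
    \<le> exp (- (ln (real K) powr (1/8)) + real s / 2)
      + 2 * exp (ln (real K) powr (1/8) + real s / 2 - c1 * ln (real K) powr (1/4))
      + 2 * ((ln (real K) powr (-1/4) + ((ln (real K))\<^sup>2 + 1) / sqrt (real K))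
          / (exp (- 1 / (2 * ln (real K))) * (1 - 1 / sqrt (real K))))"
proof -
  define r where "r = sqrt (real K)"
  define L where "L = ln (real K)"
  \<comment> \<open>With tilt 1 / sqrt K the quadratic term of the Chernoff bounds is the constant s
    / 2. The powers of L have to satisfy three demands: the cutoff \<open>k\<close> vanishes, c / r
    = L^(1/8) grows, and the normalised drift of the total, of order at least k * sqrt L = L^(1/4),
    wins over L^(1/8).\<close>
  define l where "l = 1 / r"
  define c where "c = r * L powr (1/8)"
  define k where "k = L powr (-1/4)"
  define b where "b = exp (L powr (1/8) + real s / 2 - c1 * L powr (1/4))"
  let ?H = "\<lambda>g :: real \<times> real. k \<le> fst g * r"
  let ?N = "noise ({1..K} \<times> {1..t}) :: (nat \<times> nat \<Rightarrow> real) measure"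
  have r: "0 < r" "r * r = real K" using K by (auto simp: r_def)
  have L: "1 \<le> L" using ln_ge_1[OF K] by (simp add: L_def)
  have lc: "l * c = L powr (1/8)" using r by (simp add: l_def c_def)
  have Kl: "real K * (real s * l\<^sup>2 / 2) = real s / 2"
    using r by (simp add: l_def power2_eq_square r(2)[symmetric])
  have ne: "grid K C \<noteq> {}"
  proof -
    have "grid_ratio K ^ 1 / sqrt (real K) \<in> grid_eps K"
      unfolding grid_eps_eq[OF K] using levels_pos[OF K] by (intro imageI) auto
    moreover have "grid_delta K C e \<noteq> {}" if "e \<in> grid_eps K" for e
    proof -
      have "0 < e * real K" using grid_eps_bounds[OF K that] K by simp
      then show ?thesis using card_grid_delta[OF K C, of e] grid_eps_bounds[OF K that] C by auto
    qed
    ultimately show ?thesis unfolding grid_eq_Sigma by blast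
  qed
  have "measure ?N {x \<in> space ?N. 1 \<le> 1 / real (card (grid K C)) * (\<Sum>(e, d)\<in>grid K C. likelihood_ratio K s e d x)}
      \<le> exp (- l * c + real K * (real s * l\<^sup>2 / 2)) + 2 * b
        + 2 * (real (card {g \<in> grid K C. \<not> ?H g}) / real (card (grid K C)))"
  proof (rule noise_mixture_ge[OF s(2) finite_grid ne])
    fix e d assume g: "(e, d) \<in> grid K C"
    then have ed: "e \<in> grid_eps K" "d \<in> grid_delta K C e" by (auto simp: grid_eq_Sigma)
    note e = grid_eps_bounds[OF K ed(1)]
    note d = grid_delta_bounds[OF K C e(1) ed(2)]
    show "0 \<le> e \<and> e \<le> 1" using e by simp
    assume H: "?H (e, d)"
    define x where "x = real s * l * d"
    have d0: "0 \<le> d" using d(1) L by (intro order_trans[OF _ d(1)]) (simp add: L_def)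
    have x0: "0 \<le> x" using d0 r by (simp add: x_def l_def)
    \<comment> \<open>The assumption \<open>small\<close> keeps x \<le> 1, so that 1 - exp (- x) has
      a linear lower bound.\<close>
    have "real s * d \<le> r"
      using mult_left_mono[OF d(2), of "real s"] small by (simp add: r_def)
    then have x1: "x \<le> 1" using r by (simp add: x_def l_def field_simps)
    have "sqrt (2 * ln (real K) / exp (real_of_int \<lceil>ln C\<rceil>)) = 2 * c1 * L powr (1/2)"
      using L by (simp add: c1_def L_def real_sqrt_divide real_sqrt_mult powr_half_sqrt)
    then have "k * (2 * c1 * L powr (1/2)) \<le> (e * r) * d"
      using H d(1) e(1) r L by (intro mult_mono) (auto simp: k_def c1_def)
    moreover have "k * (2 * c1 * L powr (1/2)) = 2 * c1 * L powr (1/4)"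
      by (simp add: k_def powr_add[symmetric])
    moreover have "(e * r) * d * 1 \<le> (e * r) * d * real s"
      using e(1) r d0 s by (intro mult_left_mono mult_nonneg_nonneg) auto
    ultimately have "2 * c1 * L powr (1/4) \<le> e * r * d * real s" by simp
    moreover have "real K * e * (x / 2) = e * r * d * real s / 2"
      using r by (simp add: x_def l_def r(2)[symmetric])
    moreover have "real K * e * (x / 2) \<le> real K * e * (1 - exp (- x))"
      using e x0 x1 by (intro mult_left_mono one_minus_exp_ge mult_nonneg_nonneg) auto
    ultimately have "c1 * L powr (1/4) \<le> real K * e * (1 - exp (- x))" by linarith
    then show "l * c + real K * (real s * l\<^sup>2 / 2 - e * (1 - exp (- real s * l * d))) \<le> ln b"
      unfolding right_diff_distrib Kl lc by (simp add: b_def x_def mult.assoc)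
  qed (use r in \<open>auto simp: l_def b_def\<close>)
  also have "\<dots> \<le> exp (- (L powr (1/8)) + real s / 2) + 2 * b
      + 2 * ((k + (L\<^sup>2 + 1) / r) / (exp (- 1 / (2 * L)) * (1 - 1 / r)))"
    unfolding Kl mult_minus_left lc
    using grid_tail_fraction[OF K C, of k, folded L_def r_def]
    by (intro add_left_mono mult_left_mono) (auto simp: k_def)
  finally show ?thesis
    by (simp add: adaptive_martingale_def b_def k_def L_def r_def)
qed

lemma noise_adaptive_martingale_tendsto_0:
  assumes C: "1 < C" and s: "1 \<le> s" "s \<le> t"
  shows "(\<lambda>K. measure (noise ({1..K} \<times> {1..t}))
      {x \<in> space (noise ({1..K} \<times> {1..t})). 1 \<le> adaptive_martingale K C s x}) \<longlonglongrightarrow> 0"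
proof -
  define c1 where "c1 = sqrt (2 / exp (real_of_int \<lceil>ln C\<rceil>)) / 2"
  define S where "S = real s"
  have c1: "0 < c1" by (simp add: c1_def)
  have S: "0 < S" using s by (simp add: S_def)
  show ?thesis
  proof (rule tendsto_sandwich[of "\<lambda>_. 0"])
    show "\<forall>\<^sub>F K in sequentially. measure (noise ({1..K} \<times> {1..t}))
      {x \<in> space (noise ({1..K} \<times> {1..t})). 1 \<le> adaptive_martingale K C s x}
      \<le> exp (- (ln (real K) powr (1/8)) + S / 2)
      + 2 * exp (ln (real K) powr (1/8) + S / 2 - c1 * ln (real K) powr (1/4))
      + 2 * ((ln (real K) powr (-1/4) + ((ln (real K))\<^sup>2 + 1) / sqrt (real K))
          / (exp (- 1 / (2 * ln (real K))) * (1 - 1 / sqrt (real K))))"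
    proof -
      have "\<forall>\<^sub>F K in sequentially. S * sqrt (2 * ln (real K)) \<le> sqrt (real K)" using S by real_asymp
      then show ?thesis
        using eventually_ge_at_top[of 3]
        by eventually_elim (use noise_adaptive_martingale_le[OF _ C s, folded c1_def] in \<open>auto simp: S_def\<close>)
    qed
    show "(\<lambda>K. exp (- (ln (real K) powr (1/8)) + S / 2)
      + 2 * exp (ln (real K) powr (1/8) + S / 2 - c1 * ln (real K) powr (1/4))
      + 2 * ((ln (real K) powr (-1/4) + ((ln (real K))\<^sup>2 + 1) / sqrt (real K))
          / (exp (- 1 / (2 * ln (real K))) * (1 - 1 / sqrt (real K))))) \<longlonglongrightarrow> 0"
      using c1 by real_asymp
  qed (auto intro!: always_eventually)
qed

section \<open>Below the detection boundary\<close>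

text \<open>A nonempty set in \<open>enat\<close> attains its infimum, and a finite bound excludes
  the empty set, whose infimum is infinite.\<close>

lemma rejection_time_le_iff:
  "rejection_time K C \<alpha> x \<le> enat t \<longleftrightarrow> (\<exists>s\<in>{1..t}. 1 / \<alpha> \<le> adaptive_martingale K C s x)"
proof
  let ?A = "{enat s | s. 1 \<le> s \<and> adaptive_martingale K C s x \<ge> 1 / \<alpha>}"
  assume le: "rejection_time K C \<alpha> x \<le> enat t"
  have "?A \<noteq> {}"
  proof
    assume "?A = {}"
    then have "rejection_time K C \<alpha> x = \<infinity>" unfolding rejection_time_def Inf_enat_def by (rule if_P)
    then show False using le by simp
  qed
  then have "rejection_time K C \<alpha> x \<in> ?A"
    unfolding rejection_time_def Inf_enat_def by (simp only: if_False) (metis (mono_tags, lifting) LeastI all_not_in_conv)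
  then show "\<exists>s\<in>{1..t}. 1 / \<alpha> \<le> adaptive_martingale K C s x" using le by auto
next
  assume "\<exists>s\<in>{1..t}. 1 / \<alpha> \<le> adaptive_martingale K C s x"
  then obtain s where "1 \<le> s" "s \<le> t" "1 / \<alpha> \<le> adaptive_martingale K C s x" by auto
  then have "rejection_time K C \<alpha> x \<le> enat s" unfolding rejection_time_def by (intro Inf_lower) auto
  also have "\<dots> \<le> enat t" using \<open>s \<le> t\<close> by simp
  finally show "rejection_time K C \<alpha> x \<le> enat t" .
qed

lemma adaptive_martingale_restrict:
  "s \<le> t \<Longrightarrow> adaptive_martingale K C s (restrict x ({1..K} \<times> {1..t})) = adaptive_martingale K C s x"
  by (simp add: adaptive_martingale_def likelihood_ratio_restrict)

lemma borel_measurable_adaptive_martingale: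
  assumes "s \<le> t"
  shows "adaptive_martingale K C s \<in> borel_measurable (\<Pi>\<^sub>M j\<in>{1..K} \<times> {1..t}. borel)"
proof -
  have [measurable]: "likelihood_ratio K s e d \<in> borel_measurable (\<Pi>\<^sub>M j\<in>{1..K} \<times> {1..t}. borel)" for e d
    by (rule borel_measurable_likelihood_ratio[OF assms])
  show ?thesis unfolding adaptive_martingale_def case_prod_beta by measurable
qed

text \<open>Rejection by time t as an event of the finite array, where null and alternative can be
  compared through the density.\<close>

definition rejection_event :: "nat \<Rightarrow> real \<Rightarrow> real \<Rightarrow> nat \<Rightarrow> (nat \<times> nat \<Rightarrow> real) set" where
  "rejection_event K C \<alpha> t =
     {x \<in> space (\<Pi>\<^sub>M j\<in>{1..K} \<times> {1..t}. borel). \<exists>s\<in>{1..t}. 1 / \<alpha> \<le> adaptive_martingale K C s x}"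

lemma sets_rejection_event: "rejection_event K C \<alpha> t \<in> sets (\<Pi>\<^sub>M j\<in>{1..K} \<times> {1..t}. borel)"
proof -
  have [measurable]: "adaptive_martingale K C s \<in> borel_measurable (\<Pi>\<^sub>M j\<in>{1..K} \<times> {1..t}. borel)"
    if "s \<in> {1..t}" for s
    using that by (intro borel_measurable_adaptive_martingale) auto
  show ?thesis unfolding rejection_event_def by measurable
qed

lemma rejection_time_le_event:
  "{x \<in> space (array_law K e d). rejection_time K C \<alpha> x \<le> enat t}
    = {x \<in> space (array_law K e d). restrict x ({1..K} \<times> {1..t}) \<in> rejection_event K C \<alpha> t}"
  by (auto simp: rejection_time_le_iff rejection_event_def space_PiM adaptive_martingale_restrict)

text \<open>As \<alpha> \<le> 1, reaching 1 / \<alpha> implies reaching 1; and t is fixed, so a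
  union bound over the times 1 to t suffices.\<close>

lemma noise_rejection_event_tendsto_0:
  assumes C: "1 < C" and \<alpha>: "0 < \<alpha>" "\<alpha> \<le> 1"
  shows "(\<lambda>K. measure (noise ({1..K} \<times> {1..t})) (rejection_event K C \<alpha> t)) \<longlonglongrightarrow> 0"
proof (rule tendsto_sandwich[of "\<lambda>_. 0"])
  let ?X = "\<lambda>K s. {x \<in> space (noise ({1..K} \<times> {1..t})). 1 \<le> adaptive_martingale K C s x}"
  show "\<forall>\<^sub>F K in sequentially. measure (noise ({1..K} \<times> {1..t})) (rejection_event K C \<alpha> t)
      \<le> (\<Sum>s=1..t. measure (noise ({1..K} \<times> {1..t})) (?X K s))"
  proof (rule always_eventually, rule allI)
    fix K :: nat
    interpret prob_space "noise ({1..K} \<times> {1..t})" by (rule prob_space_noise)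
    have m: "?X K s \<in> sets (noise ({1..K} \<times> {1..t}))" if "s \<in> {1..t}" for s
    proof -
      have [measurable]: "adaptive_martingale K C s \<in> borel_measurable (noise ({1..K} \<times> {1..t}))"
        using that borel_measurable_adaptive_martingale[of s t K C] by (simp add: borel_measurable_noise_eq)
      show ?thesis by measurable
    qed
    have "1 \<le> 1 / \<alpha>" using \<alpha> by simp
    then have "rejection_event K C \<alpha> t \<subseteq> (\<Union>s\<in>{1..t}. ?X K s)"
      by (auto simp: rejection_event_def space_PiM)
    then have "measure (noise ({1..K} \<times> {1..t})) (rejection_event K C \<alpha> t)
        \<le> measure (noise ({1..K} \<times> {1..t})) (\<Union>s\<in>{1..t}. ?X K s)"
      using m by (intro finite_measure_mono sets.finite_UN) auto
    also have "\<dots> \<le> (\<Sum>s=1..t. measure (noise ({1..K} \<times> {1..t})) (?X K s))"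
      using m by (intro finite_measure_subadditive_finite) auto
    finally show "measure (noise ({1..K} \<times> {1..t})) (rejection_event K C \<alpha> t)
      \<le> (\<Sum>s=1..t. measure (noise ({1..K} \<times> {1..t})) (?X K s))" .
  qed
  show "(\<lambda>K. \<Sum>s=1..t. measure (noise ({1..K} \<times> {1..t})) (?X K s)) \<longlonglongrightarrow> 0"
    by (intro tendsto_null_sum noise_adaptive_martingale_tendsto_0 C) auto
qed auto

text \<open>Here a * sqrt (2 * ln K) is the standardised mean of a signal row at time t, to be
  compared with the truncation level sqrt (2 * ln K). The second quantity is the exponent of the
  expected number of truncated signal rows, the third that of K * e^2 times the untruncated second
  moment.\<close>

lemma below_boundary_exponents:
  assumes \<beta>: "1 / 2 < \<beta>" "\<beta> < 1" and a: "0 \<le> a" "a\<^sup>2 < detection_boundary \<beta>"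
  shows "a < 1" "1 - \<beta> - (1 - a)\<^sup>2 < 0" "2 * a \<le> 1 \<Longrightarrow> 1 - 2 * \<beta> + 2 * a\<^sup>2 \<le> 0"
proof -
  have "a < 1 \<and> 1 - \<beta> - (1 - a)\<^sup>2 < 0"
  proof (cases "\<beta> < 3 / 4")
    case True
    then have a2: "a\<^sup>2 < \<beta> - 1 / 2" using a by (simp add: detection_boundary_def)
    then have "a\<^sup>2 < 1\<^sup>2" using True by simp
    then have "a < 1" using power_less_imp_less_base[of a 2 1] by simp
    \<comment> \<open>The curves 2 a - a^2 and a^2 + 1 / 2 touch at a = 1 / 2, so \<beta> > a^2 + 1
      / 2 implies \<beta> > 2 a - a^2.\<close>
    moreover have "0 \<le> 2 * (a - 1 / 2)\<^sup>2" by simp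
    then have "2 * a - a\<^sup>2 \<le> a\<^sup>2 + 1 / 2" by (simp add: power2_eq_square field_simps)
    then have "1 - \<beta> < (1 - a)\<^sup>2" using a2 by (simp add: power2_eq_square algebra_simps)
    ultimately show ?thesis by simp
  next
    case False
    have "sqrt (1 - \<beta>) \<le> sqrt ((1 / 2)\<^sup>2)"
      using False by (intro real_sqrt_le_mono) (simp add: power2_eq_square)
    then have "sqrt (1 - \<beta>) \<le> 1 / 2" by (simp only: real_sqrt_unique)
    then have h: "0 \<le> 1 - sqrt (1 - \<beta>)" by linarith
    have "a\<^sup>2 < (1 - sqrt (1 - \<beta>))\<^sup>2" using a False by (simp add: detection_boundary_def)
    then have lt: "a < 1 - sqrt (1 - \<beta>)" using h by (rule power_less_imp_less_base)
    have pos: "0 < sqrt (1 - \<beta>)" using \<beta> by simp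
    have "(sqrt (1 - \<beta>))\<^sup>2 < (1 - a)\<^sup>2" using lt pos by (intro power_strict_mono) auto
    moreover have "a < 1" using lt pos by linarith
    ultimately show ?thesis using \<beta> by simp
  qed
  then show "a < 1" "1 - \<beta> - (1 - a)\<^sup>2 < 0" by auto
  assume "2 * a \<le> 1"
  then have "a\<^sup>2 \<le> (1 / 2)\<^sup>2" using a by (intro power_mono) auto
  then have "a\<^sup>2 \<le> 1 / 4" by (simp add: power2_eq_square)
  then show "1 - 2 * \<beta> + 2 * a\<^sup>2 \<le> 0"
    using a by (cases "\<beta> < 3 / 4") (auto simp: detection_boundary_def)
qed

lemma array_law_below_boundary:
  fixes \<beta> T :: real and t K :: nat
  defines "a \<equiv> sqrt (real t / T)"
  assumes K: "3 \<le> K" and \<beta>: "1 / 2 < \<beta>" "\<beta> < 1" and T: "0 < T" and t: "1 \<le> t"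
    and below: "real t < T * detection_boundary \<beta>" and L: "0 < L"
    and B: "B \<in> sets (\<Pi>\<^sub>M j\<in>{1..K} \<times> {1..t}. borel)"
  shows "measure (array_law K (real K powr - \<beta>) (sqrt (2 * (1 / T) * ln (real K))))
      {x \<in> space (array_law K (real K powr - \<beta>) (sqrt (2 * (1 / T) * ln (real K)))).
        restrict x ({1..K} \<times> {1..t}) \<in> B}
    \<le> real K powr (1 - \<beta> - (1 - a)\<^sup>2) + L * measure (noise ({1..K} \<times> {1..t})) B + exp 1 / L"
proof -
  define e where "e = real K powr - \<beta>"
  define d where "d = sqrt (2 * (1 / T) * ln (real K))"
  define lam where "lam = ln (real K)"
  \<comment> \<open>This is sqrt t times sqrt (2 * ln K), the order of the largest of K null sums.
    Since t * d = a * c, all exponents of K become polynomials in a and \<beta>.\<close>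
  define c where "c = sqrt (2 * real t * lam)"
  define p where "p = exp (- (c - real t * d)\<^sup>2 / (2 * real t))"
  \<comment> \<open>Under the square of the likelihood ratio the sum has mean 2 * t * d = 2 * a * c.
    If this is at most c, truncation gains nothing and the tilt is 0; otherwise the tilt moves the
    mean back to c.\<close>
  define l where "l = (if 2 * a \<le> 1 then 0 else 2 * d - c / real t)"
  define q where "q = exp (l * c + real t * ((2 * d - l)\<^sup>2 - 2 * d\<^sup>2) / 2)"
  have lam0: "0 < lam" using ln_ge_1[OF K] by (simp add: lam_def)
  have K0: "0 < real K" using K by simp
  have a0: "0 < a" "a\<^sup>2 = real t / T" using t T by (auto simp: a_def)
  have "a\<^sup>2 < detection_boundary \<beta>" using below T by (simp add: a0 field_simps)
  note expo = below_boundary_exponents[OF \<beta> less_imp_le[OF a0(1)] this]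
  have td: "real t * d = a * c"
  proof -
    have "a * c = sqrt (real t / T * (2 * real t * lam))" by (simp add: a_def c_def real_sqrt_mult[symmetric])
    also have "real t / T * (2 * real t * lam) = (real t)\<^sup>2 * (2 * (1 / T) * lam)"
      by (simp add: power2_eq_square)
    finally show ?thesis by (simp only: d_def lam_def real_sqrt_mult[of "(real t)\<^sup>2"] real_sqrt_abs abs_of_nat)
  qed
  then have d: "d = a * c / real t" using t by (simp add: field_simps)
  have c: "0 < c" "c\<^sup>2 = 2 * real t * lam" using t lam0 by (auto simp: c_def)
  have cc: "c\<^sup>2 / (2 * real t) = lam" using t by (simp add: c)
  have K_exp: "real K powr x = exp (x * lam)" for x using K0 by (simp add: powr_def lam_def)
  have e: "0 \<le> e" "e \<le> 1" using powr_mono[of "- \<beta>" 0 "real K"] K \<beta> by (auto simp: e_def)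
  have p_eq: "p = real K powr (- (1 - a)\<^sup>2)"
  proof -
    have "(c - real t * d)\<^sup>2 / (2 * real t) = (1 - a)\<^sup>2 * (c\<^sup>2 / (2 * real t))"
    proof -
      have "c - real t * d = (1 - a) * c" unfolding td by (simp add: algebra_simps)
      then show ?thesis by (simp add: power_mult_distrib)
    qed
    then show ?thesis by (simp add: p_def K_exp cc)
  qed
  have p: "0 \<le> p" "p \<le> 1" using t by (auto simp: p_def)
  have Kep: "real K * e * p = real K powr (1 - \<beta> - (1 - a)\<^sup>2)"
  proof -
    have "real K * e * p = real K powr 1 * real K powr - \<beta> * real K powr (- (1 - a)\<^sup>2)"
      using K0 by (simp add: e_def p_eq)
    then show ?thesis by (simp only: powr_add[symmetric]) simp
  qed
  have l0: "0 \<le> l" using t c by (auto simp: l_def d field_simps)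
  have q_le: "real K * e\<^sup>2 * q \<le> 1"
  proof -
    have dd: "real t * d\<^sup>2 = 2 * a\<^sup>2 * lam"
      using t c by (simp add: d power_mult_distrib power_divide power2_eq_square[of "real t"])
    have "l * c + real t * ((2 * d - l)\<^sup>2 - 2 * d\<^sup>2) / 2
        = (if 2 * a \<le> 1 then 2 * a\<^sup>2 else 4 * a - 1 - 2 * a\<^sup>2) * lam"
    proof (cases "2 * a \<le> 1")
      case True
      then show ?thesis using dd by (simp add: l_def power_mult_distrib)
    next
      case False
      have ct: "c * c / real t = 2 * lam" using t c by (simp add: power2_eq_square)
      have "d * c = a * (c * c / real t)" by (simp add: d)
      then have dc: "d * c = 2 * a * lam" unfolding ct by simp
      have "l * c + real t * ((2 * d - l)\<^sup>2 - 2 * d\<^sup>2) / 2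
          = 2 * (d * c) - (c * c / real t) / 2 - real t * d\<^sup>2"
        using False t by (simp add: l_def power2_eq_square field_simps)
      then show ?thesis using False unfolding dc ct dd by (simp add: algebra_simps)
    qed
    then have "q = real K powr (if 2 * a \<le> 1 then 2 * a\<^sup>2 else 4 * a - 1 - 2 * a\<^sup>2)"
      unfolding q_def K_exp by simp
    then have "real K * e\<^sup>2 * q = real K powr 1 * (real K powr - \<beta> * real K powr - \<beta>)
        * real K powr (if 2 * a \<le> 1 then 2 * a\<^sup>2 else 4 * a - 1 - 2 * a\<^sup>2)"
      using K0 by (simp add: e_def power2_eq_square)
    also have "\<dots> = real K powr (1 - 2 * \<beta> + (if 2 * a \<le> 1 then 2 * a\<^sup>2 else 4 * a - 1 - 2 * a\<^sup>2))"
      unfolding powr_add[symmetric] by simp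
    also have "\<dots> \<le> real K powr 0"
    proof (rule powr_mono)
      \<comment> \<open>For 2 * a > 1 this exponent is 2 * (1 - \<beta> - (1 - a)^2), twice that of
        the truncated mass.\<close>
      show "1 - 2 * \<beta> + (if 2 * a \<le> 1 then 2 * a\<^sup>2 else 4 * a - 1 - 2 * a\<^sup>2) \<le> 0"
        using expo by (auto simp: power2_eq_square algebra_simps)
    qed (use K in simp)
    finally show ?thesis using K0 by simp
  qed
  interpret W: prob_space "noise ({1..K} \<times> {1..t})" by (rule prob_space_noise)
  interpret P: prob_space "array_law K e d" by (rule prob_space_array_law)
  have "emeasure (array_law K e d) {x \<in> space (array_law K e d). restrict x ({1..K} \<times> {1..t}) \<in> B}
      = (\<integral>\<^sup>+x. ennreal (likelihood_ratio K t e d x) * indicator B x \<partial>noise ({1..K} \<times> {1..t}))"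
    by (rule emeasure_array_law_restrict[OF B e])
  also have "\<dots> \<le> ennreal (real K * e * p) + ennreal L * emeasure (noise ({1..K} \<times> {1..t})) B
      + ennreal (exp (real K * e\<^sup>2 * q) / L)"
  proof (rule likelihood_ratio_event_le[OF e p(1) _ _ L B])
    show "e * p \<le> 1" using e p by (simp add: mult_le_one)
    show "0 \<le> q" by (simp add: q_def)
    show "(\<integral>\<^sup>+y. ennreal (lr d t y) * indicator {y. c < (\<Sum>u=1..t. y u)} y \<partial>noise {1..t}) \<le> ennreal p"
      unfolding p_def using t td expo(1) c by (intro lr_upper_tail) (auto simp: mult_le_cancel_right2)
    show "(\<integral>\<^sup>+y. ennreal ((lr d t y)\<^sup>2) * indicator {y. (\<Sum>u=1..t. y u) \<le> c} y \<partial>noise {1..t}) \<le> ennreal q"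
      unfolding q_def by (rule lr_square_lower_tail[OF l0])
  qed
  also have "\<dots> = ennreal (real K * e * p + L * measure (noise ({1..K} \<times> {1..t})) B + exp (real K * e\<^sup>2 * q) / L)"
    unfolding W.emeasure_eq_measure using e p L
    by (simp add: ennreal_plus[symmetric] ennreal_mult'[symmetric] del: ennreal_plus)
  finally have "measure (array_law K e d) {x \<in> space (array_law K e d). restrict x ({1..K} \<times> {1..t}) \<in> B}
      \<le> real K * e * p + L * measure (noise ({1..K} \<times> {1..t})) B + exp (real K * e\<^sup>2 * q) / L"
    unfolding P.emeasure_eq_measure using e p L by (subst (asm) ennreal_le_iff) auto
  also have "\<dots> \<le> real K * e * p + L * measure (noise ({1..K} \<times> {1..t})) B + exp 1 / L"
    using q_le L by (intro add_left_mono divide_right_mono) auto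
  finally show ?thesis unfolding Kep unfolding e_def d_def .
qed

lemma rejection_below_boundary:
  fixes C \<beta> T \<alpha> :: real and t :: nat
  assumes C: "1 < C" and \<beta>: "1 / 2 < \<beta>" "\<beta> < 1" and T: "0 < T" and \<alpha>: "0 < \<alpha>" "\<alpha> \<le> 1"
    and t: "1 \<le> t" and below: "real t < T * detection_boundary \<beta>"
  shows "(\<lambda>K. measure (array_law K (real K powr - \<beta>) (sqrt (2 * (1 / T) * ln (real K))))
      {x \<in> space (array_law K (real K powr - \<beta>) (sqrt (2 * (1 / T) * ln (real K)))).
        rejection_time K C \<alpha> x \<le> enat t}) \<longlonglongrightarrow> 0" (is "?P \<longlonglongrightarrow> 0")
proof (rule order_tendstoI)
  define a where "a = sqrt (real t / T)"
  define g where "g = 1 - \<beta> - (1 - a)\<^sup>2"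
  have "a\<^sup>2 < detection_boundary \<beta>" "0 \<le> a" using below T t by (auto simp: a_def field_simps)
  then have g: "g < 0" using below_boundary_exponents[OF \<beta>] by (simp add: g_def)
  fix \<epsilon> :: real assume eps: "0 < \<epsilon>"
  \<comment> \<open>Makes the second-moment term exp 1 / L equal to \<epsilon> / 3; as L does not
    depend on K, L times the null probability still vanishes.\<close>
  define L where "L = 3 * exp 1 / \<epsilon>"
  have L: "0 < L" using eps by (simp add: L_def)
  have "(\<lambda>K. real K powr g) \<longlonglongrightarrow> 0" using g by real_asymp
  then have 1: "\<forall>\<^sub>F K in sequentially. real K powr g < \<epsilon> / 3"
    using eps by (intro order_tendstoD) auto
  have "(\<lambda>K. L * measure (noise ({1..K} \<times> {1..t})) (rejection_event K C \<alpha> t)) \<longlonglongrightarrow> 0"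
    by (intro tendsto_mult_right_zero noise_rejection_event_tendsto_0 C \<alpha>)
  then have 2: "\<forall>\<^sub>F K in sequentially. L * measure (noise ({1..K} \<times> {1..t})) (rejection_event K C \<alpha> t) < \<epsilon> / 3"
    using eps by (intro order_tendstoD) auto
  show "\<forall>\<^sub>F K in sequentially. ?P K < \<epsilon>"
    using 1 2 eventually_ge_at_top[of 3]
  proof eventually_elim
    case (elim K)
    have "?P K \<le> real K powr g + L * measure (noise ({1..K} \<times> {1..t})) (rejection_event K C \<alpha> t) + exp 1 / L"
      unfolding rejection_time_le_event g_def a_def
      by (rule array_law_below_boundary[OF elim(3) \<beta> T t below L sets_rejection_event])
    moreover have "exp 1 / L = \<epsilon> / 3" using eps by (simp add: L_def)
    ultimately show ?case using elim by linarith
  qed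
next
  fix \<epsilon> :: real assume "\<epsilon> < 0"
  then show "\<forall>\<^sub>F K in sequentially. \<epsilon> < ?P K"
    by (intro always_eventually allI) (auto intro: less_le_trans)
qed

section \<open>Above the detection boundary\<close>

text \<open>The number u says where to look: at rows with standardised sum near u * sqrt (2 * ln K).
  The null mass there is about K^(- u^2) and e times the likelihood ratio about K^(2 u a - a^2 -
  \<beta>), so the last claim makes K times the affinity deficit grow. The choices are u = 2 a for a
  \<le> 1 / 2 (the mean under the squared likelihood ratio), u = 1 up to a = 1 (the order of the
  null maximum), and u = a beyond (the mean of a signal row).\<close>

lemma above_boundary_exponents:
  assumes \<beta>: "1 / 2 < \<beta>" "\<beta> < 1" and a: "0 < a" "detection_boundary \<beta> < a\<^sup>2"
  obtains u where "0 < u" "0 < 2 * u * a - a\<^sup>2"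
    "0 < 1 - u\<^sup>2 + min (2 * u * a - a\<^sup>2 - \<beta>) (2 * (2 * u * a - a\<^sup>2 - \<beta>))"
proof (cases "a \<le> 1 / 2")
  case True
  have a2: "a\<^sup>2 \<le> (1 / 2)\<^sup>2" using True a by (intro power_mono) auto
  have b: "\<beta> < 3 / 4"
  proof (rule ccontr)
    assume n: "\<not> \<beta> < 3 / 4"
    then have "sqrt (1 - \<beta>) \<le> sqrt ((1 / 2)\<^sup>2)"
      by (intro real_sqrt_le_mono) (simp add: power2_eq_square)
    then have "sqrt (1 - \<beta>) \<le> 1 / 2" by (simp only: real_sqrt_unique)
    then have "(1 / 2)\<^sup>2 \<le> (1 - sqrt (1 - \<beta>))\<^sup>2" by (intro power_mono) linarith+
    moreover have "detection_boundary \<beta> = (1 - sqrt (1 - \<beta>))\<^sup>2" using n by (simp add: detection_boundary_def)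
    ultimately show False using a2 a(2) by linarith
  qed
  then have ab: "\<beta> - 1 / 2 < a\<^sup>2" using a by (simp add: detection_boundary_def)
  have a4: "a\<^sup>2 \<le> 1 / 4" using a2 by (simp add: power2_eq_square)
  show ?thesis
  proof (rule that[of "2 * a"])
    show "0 < 2 * (2 * a) * a - a\<^sup>2" using a by (simp add: power2_eq_square)
    have "min (3 * a\<^sup>2 - \<beta>) (2 * (3 * a\<^sup>2 - \<beta>)) > 4 * a\<^sup>2 - 1"
      using ab a4 b by (auto simp: min_def)
    moreover have "2 * (2 * a) * a - a\<^sup>2 = 3 * a\<^sup>2" "(2 * a)\<^sup>2 = 4 * a\<^sup>2" by (simp_all add: power2_eq_square)
    ultimately show "0 < 1 - (2 * a)\<^sup>2 + min (2 * (2 * a) * a - a\<^sup>2 - \<beta>) (2 * (2 * (2 * a) * a - a\<^sup>2 - \<beta>))"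
      by (simp only:)
  qed (use a in simp)
next
  case False
  show ?thesis
  proof (cases "a \<le> 1")
    case True
    have "(1 - a)\<^sup>2 < 1 - \<beta>"
    proof (cases "\<beta> < 3 / 4")
      case b: True
      have "(1 - a)\<^sup>2 \<le> (1 / 2)\<^sup>2" using True False by (intro power_mono) auto
      then show ?thesis using b by (simp add: power2_eq_square)
    next
      case b: False
      then have "(1 - sqrt (1 - \<beta>))\<^sup>2 < a\<^sup>2" using a by (simp add: detection_boundary_def)
      then have "1 - sqrt (1 - \<beta>) < a" by (rule power_less_imp_less_base) (use a in simp)
      then have "(1 - a)\<^sup>2 < (sqrt (1 - \<beta>))\<^sup>2" using True by (intro power_strict_mono) auto
      then show ?thesis using \<beta> by simp
    qed
    then have pos: "0 < 2 * a - a\<^sup>2 - \<beta>" by (simp add: power2_eq_square algebra_simps)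
    show ?thesis
      by (rule that[of 1]) (use pos \<beta> in \<open>auto simp: min_def\<close>)
  next
    case False
    then have "1\<^sup>2 < a\<^sup>2" by (intro power_strict_mono) auto
    then have pos: "0 < a\<^sup>2 - \<beta>" using \<beta> by simp
    show ?thesis
      by (rule that[of a]) (use pos \<beta> a in \<open>auto simp: min_def power2_eq_square\<close>)
  qed
qed

text \<open>Both parameters are rounded to the weaker side. A grid step in \<beta> has length at
  most 1 / (2 * (ln K)^2), and a grid step in ln T has length 1 / N with N \<ge> K^(1 - b), which
  grows because \<beta> < 1.\<close>

lemma grid_approximation:
  assumes K: "3 \<le> K" and \<beta>: "1 / 2 < \<beta>" "\<beta> < 1" and T: "1 \<le> T" "T < C"
  shows "\<exists>b T'. (real K powr - b, sqrt (2 * ln (real K) / T')) \<in> grid K C \<and> \<beta> \<le> b \<and>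
    b \<le> \<beta> + 1 / (2 * (ln (real K))\<^sup>2) \<and> T \<le> T' \<and>
    T' \<le> T * exp (real K powr (\<beta> - 1) * exp (1 / (2 * ln (real K))))"
proof -
  define n where "n = real (levels K)"
  define i where "i = \<lceil>(2 * \<beta> - 1) * n\<rceil>"
  define b where "b = grid_beta K i"
  have lnK: "1 \<le> ln (real K)" by (rule ln_ge_1[OF K])
  have n: "0 < n" "(ln (real K))\<^sup>2 \<le> n" using levels_pos[OF K] levels_ge[of K] by (auto simp: n_def)
  have i: "(2 * \<beta> - 1) * n \<le> real_of_int i" "real_of_int i \<le> (2 * \<beta> - 1) * n + 1"
    unfolding i_def by linarith+
  have "0 < (2 * \<beta> - 1) * n" using \<beta> n by simp
  then have i1: "1 \<le> i" unfolding i_def by linarith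
  have "(2 * \<beta> - 1) * n \<le> 1 * n" using \<beta> n by (intro mult_right_mono) auto
  then have i2: "i \<le> \<lceil>(ln (real K))\<^sup>2\<rceil>" unfolding i_def of_int_levels n_def by (simp add: ceiling_le_iff)
  have b_eq: "b = 1 / 2 + real_of_int i / (2 * n)"
    by (simp add: b_def grid_beta_def of_int_levels n_def)
  have b1: "\<beta> \<le> b"
    using i(1) n by (simp add: b_eq field_simps)
  have "b \<le> 1 / 2 + ((2 * \<beta> - 1) * n + 1) / (2 * n)"
    unfolding b_eq using i(2) n by (intro add_left_mono divide_right_mono) auto
  also have "\<dots> = \<beta> + 1 / (2 * n)" using n by (simp add: add_divide_distrib diff_divide_distrib)
  also have "1 / (2 * n) \<le> 1 / (2 * (ln (real K))\<^sup>2)"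
    using n lnK by (intro divide_left_mono mult_left_mono mult_pos_pos zero_less_power) auto
  finally have b2: "b \<le> \<beta> + 1 / (2 * (ln (real K))\<^sup>2)" by simp
  define e where "e = real K powr - b"
  have e: "e \<in> grid_eps K" unfolding grid_eps_def e_def b_def using i1 i2 by (intro imageI) auto
  define N where "N = \<lceil>e * real K\<rceil>"
  have eK: "e * real K = real K powr (1 - b)"
    using K by (simp add: e_def powr_diff powr_minus field_simps)
  have "0 < e * real K" using K by (simp add: eK)
  then have N: "0 < real_of_int N" "e * real K \<le> real_of_int N" unfolding N_def by linarith+
  \<comment> \<open>Floor plus 1 instead of the ceiling gives j \<ge> 1 also for T = 1, where ln T =
    0, and the strict T < C keeps j within the index range.\<close>
  define j where "j = \<lfloor>real_of_int N * ln T\<rfloor> + 1"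
  define T' where "T' = exp (real_of_int j / real_of_int N)"
  have j: "real_of_int N * ln T < real_of_int j" "real_of_int j \<le> real_of_int N * ln T + 1"
    unfolding j_def by linarith+
  have "0 \<le> real_of_int N * ln T" using N T by simp
  then have j1: "1 \<le> j" unfolding j_def by simp
  have "real_of_int N * ln T < real_of_int N * ln C" using N T by simp
  also have "\<dots> \<le> real_of_int (N * \<lceil>ln C\<rceil>)" using N by (simp add: mult_left_mono)
  finally have j2: "j \<le> N * \<lceil>ln C\<rceil>" unfolding j_def by (simp add: floor_less_iff add1_zle_eq)
  have "sqrt (2 * ln (real K) / T') \<in> grid_delta K C e"
    unfolding grid_delta_def T'_def N_def[symmetric] using j1 j2 by (intro imageI) auto
  then have 1: "(e, sqrt (2 * ln (real K) / T')) \<in> grid K C" using e by (simp add: grid_eq_Sigma)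
  have "ln T \<le> real_of_int j / real_of_int N" using j(1) N by (simp add: field_simps)
  then have 2: "T \<le> T'" using T unfolding T'_def by (metis exp_le_cancel_iff exp_ln less_le_trans zero_less_one)
  have "real_of_int j / real_of_int N \<le> ln T + 1 / real_of_int N" using j(2) N by (simp add: field_simps)
  also have "1 / real_of_int N \<le> 1 / (e * real K)"
    using N \<open>0 < e * real K\<close> by (intro frac_le) auto
  also have "\<dots> = real K powr (b - 1)" by (simp add: eK powr_minus_divide[symmetric])
  also have "\<dots> \<le> real K powr (\<beta> - 1 + 1 / (2 * (ln (real K))\<^sup>2))"
    using b2 K by (intro powr_mono) auto
  \<comment> \<open>An error of 1 / (2 * (ln K)^2) in the exponent changes a power of K only by exp
    (1 / (2 * ln K)), which tends to 1.\<close>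
  also have "\<dots> = real K powr (\<beta> - 1) * exp (1 / (2 * ln (real K)))"
  proof -
    have "1 / (2 * (ln (real K))\<^sup>2) * ln (real K) = 1 / (2 * ln (real K))"
      using lnK by (simp add: power2_eq_square)
    then show ?thesis using K unfolding powr_add by (simp add: powr_def)
  qed
  finally have "T' \<le> exp (ln T + real K powr (\<beta> - 1) * exp (1 / (2 * ln (real K))))"
    unfolding T'_def by simp
  also have "\<dots> = T * exp (real K powr (\<beta> - 1) * exp (1 / (2 * ln (real K))))"
    using T by (simp add: exp_add)
  finally have 3: "T' \<le> T * exp (real K powr (\<beta> - 1) * exp (1 / (2 * ln (real K))))" .
  show ?thesis using 1 2 3 b1 b2 unfolding e_def by blast
qed

text \<open>A crude bound from e * K \<le> sqrt K. Polynomial size is enough, because the failure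
  probability it multiplies is exponentially small in a power of K.\<close>

lemma card_grid_le:
  assumes K: "3 \<le> K" and C: "1 < C"
  shows "real (card (grid K C)) \<le> ((ln (real K))\<^sup>2 + 1) * (sqrt (real K) + 1) * real (nat \<lceil>ln C\<rceil>)"
proof -
  define r where "r = sqrt (real K)"
  define D where "D = real (nat \<lceil>ln C\<rceil>)"
  have "real (card (grid K C)) = (\<Sum>i\<in>{1..levels K}. real (nat \<lceil>r * grid_ratio K ^ i\<rceil>)) * D"
    using card_grid_weights[OF K C, of "\<lambda>_. True"]
    unfolding simp_thms Collect_mem_eq D_def[symmetric] r_def[symmetric] by simp
  also have "\<dots> \<le> (\<Sum>i\<in>{1..levels K}. r + 1) * D"
  proof (intro mult_right_mono sum_mono)
    fix i
    have q: "0 \<le> grid_ratio K ^ i" "grid_ratio K ^ i \<le> 1"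
      using grid_ratio_bounds[OF K] by (auto intro: power_le_one)
    have "0 \<le> r" by (simp add: r_def)
    then have "0 \<le> r * grid_ratio K ^ i" "r * grid_ratio K ^ i \<le> r * 1"
      using q by (auto simp del: mult_1_right intro!: mult_left_mono)
    then show "real (nat \<lceil>r * grid_ratio K ^ i\<rceil>) \<le> r + 1" by linarith
  qed (simp add: D_def)
  also have "\<dots> = real (levels K) * (r + 1) * D" by simp
  also have "\<dots> \<le> ((ln (real K))\<^sup>2 + 1) * (r + 1) * D"
    using levels_le[of K] by (intro mult_right_mono) (auto simp: r_def D_def)
  finally show ?thesis unfolding r_def D_def .
qed

text \<open>An average of nonnegative terms is at least any one of them divided by their number, so
  adaptation only raises the threshold for a single grid point from 1 / \<alpha> to
  \<open>M\<close>.\<close>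

lemma array_law_rejection_ge:
  assumes K: "3 \<le> K" and C: "1 < C" and \<alpha>: "0 < \<alpha>" and t: "1 \<le> t" and g: "(e', d') \<in> grid K C"
  defines "M \<equiv> real (card (grid K C)) / \<alpha>"
  shows "1 - measure (array_law K e d) {x \<in> space (array_law K e d). likelihood_ratio K t e' d' x < M}
    \<le> measure (array_law K e d) {x \<in> space (array_law K e d). rejection_time K C \<alpha> x \<le> enat t}"
proof -
  let ?J = "{1..K} \<times> {1..t}" and ?P = "array_law K e d"
  interpret prob_space ?P by (rule prob_space_array_law)
  have card: "0 < card (grid K C)" using g finite_grid by (auto simp: card_gt_0_iff)
  have [measurable]: "(\<lambda>x. restrict x ?J) \<in> measurable ?P (\<Pi>\<^sub>M j\<in>?J. borel)"
    by (rule measurable_restrict_array)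
  have [measurable]: "rejection_event K C \<alpha> t \<in> sets (\<Pi>\<^sub>M j\<in>?J. borel)"
    by (rule sets_rejection_event)
  have R: "{x \<in> space ?P. rejection_time K C \<alpha> x \<le> enat t} \<in> sets ?P"
    unfolding rejection_time_le_event by measurable
  have [measurable]: "likelihood_ratio K t e' d' \<in> borel_measurable (\<Pi>\<^sub>M j\<in>?J. borel)"
    by (rule borel_measurable_likelihood_ratio) simp
  have "(\<lambda>x. likelihood_ratio K t e' d' (restrict x ?J)) \<in> borel_measurable ?P" by measurable
  then have [measurable]: "likelihood_ratio K t e' d' \<in> borel_measurable ?P"
    by (simp add: likelihood_ratio_restrict)
  have S: "{x \<in> space ?P. likelihood_ratio K t e' d' x < M} \<in> sets ?P" by measurable
  have "x \<in> {x \<in> space ?P. rejection_time K C \<alpha> x \<le> enat t}"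
    if x: "x \<in> space ?P" "\<not> likelihood_ratio K t e' d' x < M" for x
  proof -
    have "likelihood_ratio K t e' d' x \<le> (\<Sum>(e, d)\<in>grid K C. likelihood_ratio K t e d x)"
    proof -
      have "(\<Sum>g\<in>{(e', d')}. likelihood_ratio K t (fst g) (snd g) x)
          \<le> (\<Sum>g\<in>grid K C. likelihood_ratio K t (fst g) (snd g) x)"
        using g finite_grid grid_eps_bounds[OF K]
        by (intro sum_mono2) (auto simp: grid_eq_Sigma less_imp_le intro!: likelihood_ratio_nonneg)
      then show ?thesis by (simp add: case_prod_beta)
    qed
    then have "M \<le> (\<Sum>(e, d)\<in>grid K C. likelihood_ratio K t e d x)" using x by simp
    then have "1 / real (card (grid K C)) * M \<le> adaptive_martingale K C t x"
      unfolding adaptive_martingale_def by (intro mult_left_mono) auto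
    then have "1 / \<alpha> \<le> adaptive_martingale K C t x" using card by (simp add: M_def)
    then show ?thesis using x t unfolding rejection_time_le_iff by auto
  qed
  then have "space ?P \<subseteq> {x \<in> space ?P. likelihood_ratio K t e' d' x < M}
      \<union> {x \<in> space ?P. rejection_time K C \<alpha> x \<le> enat t}" by auto
  then have "measure ?P (space ?P) \<le> measure ?P ({x \<in> space ?P. likelihood_ratio K t e' d' x < M}
      \<union> {x \<in> space ?P. rejection_time K C \<alpha> x \<le> enat t})"
    using R S by (intro finite_measure_mono) auto
  also have "\<dots> \<le> measure ?P {x \<in> space ?P. likelihood_ratio K t e' d' x < M}
      + measure ?P {x \<in> space ?P. rejection_time K C \<alpha> x \<le> enat t}"
    using R S by (intro measure_Un_le)
  finally show ?thesis by (simp add: prob_space)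
qed

text \<open>The box bound in powers of K. Each of the t entries is asked to lie near x = u * sqrt (2
  * ln K / t), which puts the standardised sum near u * sqrt (2 * ln K). F is a lower bound for the
  exponent of w that can be kept fixed as K grows; exp (- u * sqrt (2 * t * ln K)) is the
  subpolynomial price for the unit side of the box.\<close>

lemma likelihood_ratio_large_powr:
  fixes K t :: nat
  assumes K: "3 \<le> K" and t: "1 \<le> t" and e: "real K powr - b \<le> e" "e \<le> 1" and b: "0 < b"
    and T': "0 < T'" and d: "sqrt (2 * ln (real K) / T') \<le> d" and M: "0 < M" and u: "0 < u"
  defines "a \<equiv> sqrt (real t / T')"
  assumes l: "ln 2 \<le> (2 * u * a - a\<^sup>2) * ln (real K)" and F: "F \<le> 2 * u * a - a\<^sup>2 - b"
  shows "measure (array_law K e d)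
      {x \<in> space (array_law K e d). likelihood_ratio K t (real K powr - b) (sqrt (2 * ln (real K) / T')) x < M}
    \<le> sqrt M * exp (- ((1 / sqrt (2 * pi)) ^ t * exp (- real t / 2) / 48
        * (real K powr (1 - u\<^sup>2 + min F (2 * F)) * exp (- u * sqrt (2 * real t * ln (real K))))))"
proof -
  define lam where "lam = ln (real K)"
  define d' where "d' = sqrt (2 * ln (real K) / T')"
  define x where "x = u * sqrt (2 * lam / real t)"
  define w where "w = real K powr - b * exp (real t * (d' * x - d'\<^sup>2 / 2)) / 2"
  define m where "m = min F (2 * F)"
  have lam: "1 \<le> lam" unfolding lam_def by (rule ln_ge_1[OF K])
  have K0: "1 < real K" using K by simp
  have K_exp: "real K powr y = exp (y * lam)" for y using K0 by (simp add: powr_def lam_def)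
  have d'0: "0 \<le> d'" using lam T' by (simp add: d'_def lam_def)
  have x0: "0 \<le> x" using u lam by (simp add: x_def)
  have expo: "real t * (d' * x - d'\<^sup>2 / 2) = (2 * u * a - a\<^sup>2) * lam"
  proof -
    have "d' * x = u * sqrt ((2 * lam / T') * (2 * lam / real t))"
      by (simp add: d'_def x_def lam_def real_sqrt_mult[symmetric])
    also have "(2 * lam / T') * (2 * lam / real t) = (2 * lam / real t)\<^sup>2 * (real t / T')"
      using t by (simp add: power2_eq_square)
    also have "sqrt \<dots> = 2 * lam / real t * a"
      using lam by (simp only: real_sqrt_mult real_sqrt_abs a_def) simp
    finally have 1: "real t * (d' * x) = 2 * u * a * lam" using t by simp
    have "real t * (d'\<^sup>2 / 2) = a\<^sup>2 * lam"
      using lam T' by (simp add: d'_def a_def lam_def)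
    then show ?thesis using 1 by (simp add: algebra_simps)
  qed
  have w_eq: "w = real K powr (2 * u * a - a\<^sup>2 - b) / 2"
    unfolding w_def expo K_exp by (simp add: exp_add[symmetric] algebra_simps)
  \<comment> \<open>The factor 1 / 2 in \<open>w\<close> becomes 1 / 4 after squaring; with the 12
    of the affinity bound this gives 48.\<close>
  have minw: "real K powr m / 4 \<le> min w (w\<^sup>2)"
  proof -
    have wF: "real K powr F / 2 \<le> w" unfolding w_eq using K0 F by (intro divide_right_mono powr_mono) auto
    have "real K powr m \<le> real K powr F" using K0 by (intro powr_mono) (auto simp: m_def)
    then have 1: "real K powr m / 4 \<le> w" using wF powr_ge_zero[of "real K" F] by linarith
    have "real K powr m \<le> real K powr (2 * F)" using K0 by (intro powr_mono) (auto simp: m_def)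
    also have "\<dots> = (real K powr F)\<^sup>2" by (simp add: powr_add[symmetric] power2_eq_square)
    finally have "real K powr m / 4 \<le> (real K powr F / 2)\<^sup>2" by (simp add: power_divide)
    also have "\<dots> \<le> w\<^sup>2" using wF by (intro power_mono) auto
    finally show ?thesis using 1 by simp
  qed
  have dens: "std_normal_density (x + 1) ^ t
      = (1 / sqrt (2 * pi)) ^ t * exp (- (u\<^sup>2 * lam + u * sqrt (2 * real t * lam) + real t / 2))"
  proof -
    have "real t * x\<^sup>2 = u\<^sup>2 * (2 * lam)"
      using t lam by (simp add: x_def power_mult_distrib)
    moreover have "real t * x = u * sqrt (2 * real t * lam)"
    proof -
      have "sqrt (2 * real t * lam) = sqrt ((real t)\<^sup>2 * (2 * lam / real t))"
        using t by (simp add: power2_eq_square)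
      also have "\<dots> = real t * sqrt (2 * lam / real t)"
        by (simp only: real_sqrt_mult[of "(real t)\<^sup>2"] real_sqrt_abs abs_of_nat)
      finally show ?thesis by (simp add: x_def)
    qed
    ultimately have "real t * (- (x + 1)\<^sup>2 / 2) = - (u\<^sup>2 * lam + u * sqrt (2 * real t * lam) + real t / 2)"
      by (simp add: power2_eq_square algebra_simps add_divide_distrib diff_divide_distrib)
    then show ?thesis
      unfolding std_normal_density_def power_mult_distrib exp_of_nat_mult[symmetric] by simp
  qed
  have "measure (array_law K e d) {x \<in> space (array_law K e d). likelihood_ratio K t (real K powr - b) d' x < M}
      \<le> sqrt M * exp (- (real K * (min w (w\<^sup>2) / 12 * std_normal_density (x + 1) ^ t)))"
  proof (rule likelihood_ratio_large[OF _ e _ d'0 _ M x0 _ w_def])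
    show "real K powr - b < 1" using K0 b powr_less_mono[of "- b" 0 "real K"] by simp
    show "d' \<le> d" using d by (simp add: d'_def)
    have "exp (ln 2) \<le> exp ((2 * u * a - a\<^sup>2) * lam)" using l by (simp only: exp_le_cancel_iff lam_def)
    then show "2 \<le> exp (real t * (d' * x - d'\<^sup>2 / 2))" unfolding expo by simp
  qed simp
  also have "\<dots> \<le> sqrt M * exp (- (real K * (real K powr m / 4 / 12 * std_normal_density (x + 1) ^ t)))"
  proof -
    have "real K powr m / 4 / 12 * std_normal_density (x + 1) ^ t \<le> min w (w\<^sup>2) / 12 * std_normal_density (x + 1) ^ t"
      using minw by (intro mult_right_mono divide_right_mono) auto
    then have "real K * (real K powr m / 4 / 12 * std_normal_density (x + 1) ^ t)
        \<le> real K * (min w (w\<^sup>2) / 12 * std_normal_density (x + 1) ^ t)"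
      by (rule mult_left_mono) simp
    then show ?thesis using M by (intro mult_left_mono) (simp_all only: exp_le_cancel_iff neg_le_iff_le, simp)
  qed
  also have "real K * (real K powr m / 4 / 12 * std_normal_density (x + 1) ^ t)
      = (1 / sqrt (2 * pi)) ^ t * exp (- real t / 2) / 48
        * (real K powr (1 - u\<^sup>2 + m) * exp (- u * sqrt (2 * real t * lam)))"
  proof -
    have "real K powr (1 - u\<^sup>2 + m) = real K powr 1 * real K powr (- (u\<^sup>2)) * real K powr m"
      unfolding powr_add[symmetric] by simp
    also have "\<dots> = real K * exp (- (u\<^sup>2 * lam)) * real K powr m"
      using K0 K_exp[of "- (u\<^sup>2)"] by simp
    finally have 1: "real K powr (1 - u\<^sup>2 + m) = real K * exp (- (u\<^sup>2 * lam)) * real K powr m" .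
    have 2: "exp (- (u\<^sup>2 * lam + y + real t / 2)) = exp (- (u\<^sup>2 * lam)) * exp (- y) * exp (- real t / 2)" for y
      by (simp add: exp_add[symmetric])
    show ?thesis unfolding dens 1 2 by simp
  qed
  finally show ?thesis unfolding m_def lam_def d'_def .
qed

text \<open>All conditions are strict at the limiting parameters, so they persist for grid
  parameters converging to them. The polynomial factor from the grid size then loses against exp (-
  K^(g - o(1))).\<close>

lemma rejection_above_boundary:
  fixes C \<beta> T \<alpha> :: real and t :: nat
  assumes C: "1 < C" and \<beta>: "1 / 2 < \<beta>" "\<beta> < 1" and T: "0 < T" "T < C" and \<alpha>: "0 < \<alpha>"
    and t: "1 \<le> t" and above: "T * detection_boundary \<beta> < real t"
  shows "(\<lambda>K. measure (array_law K (real K powr - \<beta>) (sqrt (2 * (1 / T) * ln (real K))))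
      {x \<in> space (array_law K (real K powr - \<beta>) (sqrt (2 * (1 / T) * ln (real K)))).
        rejection_time K C \<alpha> x \<le> enat t}) \<longlonglongrightarrow> 1" (is "?P \<longlonglongrightarrow> 1")
proof -
  \<comment> \<open>The grid has no signal stronger than \<open>sqrt (2 * ln K)\<close>, so for \<open>T < 1\<close> one compares with \<open>T = 1\<close>.\<close>
  define T1 where "T1 = max T 1"
  have T1: "1 \<le> T1" "T \<le> T1" "T1 < C" using T C by (auto simp: T1_def)
  \<comment> \<open>Ensures that raising T to 1 does not cross the boundary, because t \<ge>
    1.\<close>
  have "detection_boundary \<beta> < 1"
  proof (cases "\<beta> < 3 / 4")
    case False
    have "0 < sqrt (1 - \<beta>)" "sqrt (1 - \<beta>) < sqrt 1" using \<beta> by (auto simp del: real_sqrt_one)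
    then have "(1 - sqrt (1 - \<beta>))\<^sup>2 < 1\<^sup>2" by (intro power_strict_mono) auto
    then show ?thesis using False by (simp add: detection_boundary_def)
  qed (simp add: detection_boundary_def)
  then have "T1 * detection_boundary \<beta> < real t" using above t by (auto simp: T1_def max_def)
  then have det: "detection_boundary \<beta> < real t / T1" using T1 by (simp add: field_simps)
  define a where "a = sqrt (real t / T1)"
  have a: "0 < a" "detection_boundary \<beta> < a\<^sup>2" using det t T1 by (auto simp: a_def)
  obtain u where u: "0 < u" "0 < 2 * u * a - a\<^sup>2"
    "0 < 1 - u\<^sup>2 + min (2 * u * a - a\<^sup>2 - \<beta>) (2 * (2 * u * a - a\<^sup>2 - \<beta>))"
    using above_boundary_exponents[OF \<beta> a] by blast
  define E where "E = 2 * u * a - a\<^sup>2 - \<beta>"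
  \<comment> \<open>The map x to min x (2 * x) has slope at most 2, so lowering \<open>E\<close> by
    a quarter of the positive margin costs at most half of it and leaves \<open>g\<close> positive;
    the gap between F and E absorbs the convergence of the grid parameters.\<close>
  define F where "F = E - (1 - u\<^sup>2 + min E (2 * E)) / 4"
  define g where "g = 1 - u\<^sup>2 + min F (2 * F)"
  \<comment> \<open>Half the limiting exponent of the likelihood ratio on the box; a positive lower
    bound is what makes that ratio exceed 2 eventually.\<close>
  define h where "h = (2 * u * a - a\<^sup>2) / 2"
  have h: "0 < h" using u by (simp add: h_def)
  have FE: "F < E" using u(3) by (simp add: F_def E_def)
  have g: "0 < g"
  proof -
    have "0 < 1 - u\<^sup>2 + min E (2 * E)" using u(3) by (simp only: E_def)
    moreover have "m - y / 2 \<le> E - y / 4" "m - y / 2 \<le> 2 * (E - y / 4)"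
      if "0 < y" "m \<le> E" "m \<le> 2 * E" for m y :: real
      using that by auto
    ultimately have "min E (2 * E) - (1 - u\<^sup>2 + min E (2 * E)) / 2 \<le> min F (2 * F)"
      unfolding F_def min.bounded_iff by (meson min.cobounded1 min.cobounded2)
    moreover have "0 < y + n" if "m - (y + m) / 2 \<le> n" "0 < y + m" for m n y :: real
      using that by argo
    ultimately show ?thesis using \<open>0 < 1 - u\<^sup>2 + min E (2 * E)\<close> unfolding g_def by blast
  qed
  have "\<forall>K. \<exists>b T'. 3 \<le> K \<longrightarrow> ((real K powr - b, sqrt (2 * ln (real K) / T')) \<in> grid K C \<and> \<beta> \<le> b \<and>
    b \<le> \<beta> + 1 / (2 * (ln (real K))\<^sup>2) \<and> T1 \<le> T' \<and>
    T' \<le> T1 * exp (real K powr (\<beta> - 1) * exp (1 / (2 * ln (real K)))))"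
    using grid_approximation[OF _ \<beta> T1(1,3)] by blast
  then obtain b T' where *: "\<And>K. 3 \<le> K \<Longrightarrow> (real K powr - b K, sqrt (2 * ln (real K) / T' K)) \<in> grid K C \<and> \<beta> \<le> b K \<and>
    b K \<le> \<beta> + 1 / (2 * (ln (real K))\<^sup>2) \<and> T1 \<le> T' K \<and>
    T' K \<le> T1 * exp (real K powr (\<beta> - 1) * exp (1 / (2 * ln (real K))))"
    by metis
  have ev3: "\<forall>\<^sub>F K in sequentially. (3::nat) \<le> K" by (rule eventually_ge_at_top)
  have b_lim: "b \<longlonglongrightarrow> \<beta>"
  proof (rule tendsto_sandwich)
    show "\<forall>\<^sub>F K in sequentially. \<beta> \<le> b K" using ev3 by eventually_elim (use * in blast)
    show "\<forall>\<^sub>F K in sequentially. b K \<le> \<beta> + 1 / (2 * (ln (real K))\<^sup>2)"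
      using ev3 by eventually_elim (use * in blast)
    show "(\<lambda>K. \<beta> + 1 / (2 * (ln (real K))\<^sup>2)) \<longlonglongrightarrow> \<beta>" by real_asymp
  qed simp
  have T_lim: "T' \<longlonglongrightarrow> T1"
  proof (rule tendsto_sandwich)
    show "\<forall>\<^sub>F K in sequentially. T1 \<le> T' K" using ev3 by eventually_elim (use * in blast)
    show "\<forall>\<^sub>F K in sequentially. T' K \<le> T1 * exp (real K powr (\<beta> - 1) * exp (1 / (2 * ln (real K))))"
      using ev3 by eventually_elim (use * in blast)
    have "\<beta> - 1 < 0" using \<beta> by simp
    then have "(\<lambda>K. exp (real K powr (\<beta> - 1) * exp (1 / (2 * ln (real K))))) \<longlonglongrightarrow> 1" by real_asymp
    from tendsto_mult_left[OF this, of T1]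
    show "(\<lambda>K. T1 * exp (real K powr (\<beta> - 1) * exp (1 / (2 * ln (real K))))) \<longlonglongrightarrow> T1" by simp
  qed simp
  define a' where "a' K = sqrt (real t / T' K)" for K
  have a_lim: "a' \<longlonglongrightarrow> a"
    unfolding a'_def a_def using T1 by (intro tendsto_intros T_lim) auto
  have "(\<lambda>K. 2 * u * a' K - (a' K)\<^sup>2 - b K) \<longlonglongrightarrow> E"
    unfolding E_def by (intro tendsto_intros a_lim b_lim)
  then have evF: "\<forall>\<^sub>F K in sequentially. F < 2 * u * a' K - (a' K)\<^sup>2 - b K"
    using FE by (rule order_tendstoD)
  have "(\<lambda>K. 2 * u * a' K - (a' K)\<^sup>2) \<longlonglongrightarrow> 2 * u * a - a\<^sup>2" by (intro tendsto_intros a_lim)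
  moreover have "h < 2 * u * a - a\<^sup>2"
    using gt_half_sum[OF u(2)] unfolding h_def by simp
  ultimately have evh: "\<forall>\<^sub>F K in sequentially. h < 2 * u * a' K - (a' K)\<^sup>2"
    by (rule order_tendstoD)
  have evl: "\<forall>\<^sub>F K in sequentially. ln 2 \<le> h * ln (real K)" using h by real_asymp
  define D where "D = real (nat \<lceil>ln C\<rceil>) / \<alpha>"
  define c where "c = (1 / sqrt (2 * pi)) ^ t * exp (- real t / 2) / 48"
  define v where "v = 2 * real t"
  have D: "0 < D" using C \<alpha> by (simp add: D_def)
  have c: "0 < c" by (simp add: c_def)
  have v: "0 < v" using t by (simp add: v_def)
  define R where "R K = sqrt (((ln (real K))\<^sup>2 + 1) * (sqrt (real K) + 1) * D)
      * exp (- (c * (real K powr g * exp (- u * sqrt (v * ln (real K))))))" for K :: nat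
  have R_lim: "R \<longlonglongrightarrow> 0" unfolding R_def using D c v u(1) g by real_asymp
  have lower: "\<forall>\<^sub>F K in sequentially. 1 - R K \<le> ?P K"
    using ev3 evF evh evl
  proof eventually_elim
    case (elim K)
    let ?e = "real K powr - \<beta>" and ?d = "sqrt (2 * (1 / T) * ln (real K))"
    let ?d' = "sqrt (2 * ln (real K) / T' K)"
    define M where "M = real (card (grid K C)) / \<alpha>"
    note K = elim(1)
    have lnK: "1 \<le> ln (real K)" by (rule ln_ge_1[OF K])
    have grid: "(real K powr - b K, ?d') \<in> grid K C" and bT: "\<beta> \<le> b K" "T1 \<le> T' K" using *[OF K] by auto
    have "0 < card (grid K C)" using grid finite_grid by (auto simp: card_gt_0_iff)
    then have M: "0 < M" using \<alpha> by (simp add: M_def)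
    have MD: "M \<le> ((ln (real K))\<^sup>2 + 1) * (sqrt (real K) + 1) * D"
      using divide_right_mono[OF card_grid_le[OF K C], of \<alpha>] \<alpha> by (simp add: M_def D_def)
    have "2 * ln (real K) / T' K \<le> 2 * ln (real K) / T"
      using lnK T T1 bT by (intro divide_left_mono) auto
    then have d: "?d' \<le> ?d" by simp
    have "h * ln (real K) \<le> (2 * u * a' K - (a' K)\<^sup>2) * ln (real K)"
      using elim(3) lnK by (intro mult_right_mono) auto
    then have l: "ln 2 \<le> (2 * u * a' K - (a' K)\<^sup>2) * ln (real K)" using elim(4) by linarith
    have "1 - ?P K \<le> measure (array_law K ?e ?d)
        {x \<in> space (array_law K ?e ?d). likelihood_ratio K t (real K powr - b K) ?d' x < M}"
      using array_law_rejection_ge[OF K C \<alpha> t grid, of ?e ?d] unfolding M_def by simp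
    also have "\<dots> \<le> sqrt M * exp (- (c * (real K powr g * exp (- u * sqrt (v * ln (real K))))))"
      unfolding c_def g_def v_def
    proof (rule likelihood_ratio_large_powr[OF K t _ _ _ _ d M u(1)])
      show "real K powr - b K \<le> ?e" using K bT by (intro powr_mono) auto
      show "?e \<le> 1" using powr_mono[of "- \<beta>" 0 "real K"] K \<beta> by simp
      show "0 < b K" using \<beta> bT by simp
      show "0 < T' K" using T1 bT by simp
      show "ln 2 \<le> (2 * u * sqrt (real t / T' K) - (sqrt (real t / T' K))\<^sup>2) * ln (real K)"
        using l by (simp only: a'_def)
      show "F \<le> 2 * u * sqrt (real t / T' K) - (sqrt (real t / T' K))\<^sup>2 - b K"
        using elim(2) by (simp only: a'_def)
    qed
    also have "\<dots> \<le> R K"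
      unfolding R_def using MD by (intro mult_right_mono real_sqrt_le_mono) auto
    finally show ?case by simp
  qed
  show ?thesis
  proof (rule tendsto_sandwich[OF lower])
    show "\<forall>\<^sub>F K in sequentially. ?P K \<le> 1"
      by (intro always_eventually allI prob_space.prob_le_1 prob_space_array_law)
    show "(\<lambda>K. 1 - R K) \<longlonglongrightarrow> 1" using tendsto_diff[OF tendsto_const R_lim, of 1] by simp
  qed simp
qed

theorem theorem2p7:
  fixes C \<beta> T \<alpha> :: real and t :: nat
  assumes "C > 1"
    and "1 / 2 < \<beta>" and "\<beta> < 1"
    and "0 < T" and "T < C"
    and "0 < \<alpha>" and "\<alpha> \<le> 1"
    and "t \<ge> 1"
  shows "let \<delta>star = (\<lambda>K :: nat. sqrt (2 * (1 / T) * ln (real K)));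
             \<epsilon>star = (\<lambda>K :: nat. real K powr (- \<beta>));
             Pstar = (\<lambda>K :: nat. array_law K (\<epsilon>star K) (\<delta>star K));
             tstar = T * detection_boundary \<beta>
         in (real t < tstar \<longrightarrow>
               (\<lambda>K. \<P>(x in Pstar K. rejection_time K C \<alpha> x \<le> enat t)) \<longlonglongrightarrow> 0) \<and>
            (real t > tstar \<longrightarrow>
               (\<lambda>K. \<P>(x in Pstar K. rejection_time K C \<alpha> x \<le> enat t)) \<longlonglongrightarrow> 1)"
  using rejection_below_boundary[of C \<beta> T \<alpha> t] rejection_above_boundary[of C \<beta> T \<alpha> t] assms
  unfolding Let_def by blast

end
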